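(* Let $G(s)$ and $\bar G(s)$ be $m\times m$ transfer function matrices. Suppose that $\bar G(s)$ is strictly negative imaginary (SNI) and that $G(s)$ is strictly proper and negative imaginary (NI) with $G_1=0$ and $G_2\ne0$. Let $G_2=JJ^T$ with $J$ of full column rank, and suppose that $J^T\bar G(0)J$ is non-singular. Let $N_2=\bar G(0)-\bar G(0)J\left(J^T\bar G(0)J\right)^{-1}J^T\bar G(0)$. (a) If $N_2$ is positive semidefinite, then the positive-feedback interconnection $[G(s),\bar G(s)]$ is internally stable if and only if $$J^T\bar G(0)J<0\quad\text{and}\quad I-N_2^{1/2}G_0N_2^{1/2}>0 .$$ (b) If $N_2$ is negative semidefinite, then, with $\tilde N_2=(-N_2)^{1/2}$, the positive-feedback interconnection $[G(s),\bar G(s)]$ is internally stable if and only if $$J^T\bar G(0)J<0\quad\text{and}\quad \det(I+\tilde N_2G_0\tilde N_2)\neq0 .$$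
   Context: Conventions. Transfer function matrices are square, real, rational and proper, $G(s)=C(sI-A)^{-1}B+D$ with real $A,B,C,D$; $G$ is strictly proper if $G(\infty)=D=0$. $M^*$ is the conjugate transpose; $>0,\ \ge 0,\ <0$ denote (Hermitian/symmetric) positive definiteness, positive semidefiniteness, negative definiteness; $(\cdot)^{1/2}$ is the positive semidefinite square root of a positive semidefinite matrix. NI. A square $G(s)$ is NI if: (1) $G(s)$ has no pole in $\mathrm{Re}[s]>0$; (2) for all $\omega>0$ such that $j\omega$ is not a pole of $G(s)$, $j(G(j\omega)-G(j\omega)^* )\ge 0$; (3) if $s=j\omega_0$ with $\omega_0>0$ is a pole of $G(s)$, it is a simple pole and $K=\lim_{s\to j\omega_0}(s-j\omega_0)jG(s)$ is Hermitian and positive semidefinite; (4) if $s=0$ is a pole of $G(s)$, then $\lim_{s\to0}s^kG(s)=0$ for all $k\ge 3$ and $\lim_{s\to 0}s^2G(s)$ is Hermitian and positive semidefinite. SNI. A square $\bar G(s)$ is SNI if it has no pole in $\mathrm{Re}[s]\ge 0$ and $j(\bar G(j\omega)-\bar G(j\omega)^* )>0$ for all $\omega>0$. Internal stability. Let $G$ have minimal realization $(A,B,C,D)$ and $\bar G$ minimal realization $(\bar A,\bar B,\bar C,\bar D)$ with $I-D\bar D$ nonsingular. The positive feedback interconnection $[G(s),\bar G(s)]$ is internally stable if $$\breve A=\begin{bmatrix}A+B\bar D(I-D\bar D)^{-1}C & B\bar C+B\bar D(I-D\bar D)^{-1}D\bar C\\ \bar B(I-D\bar D)^{-1}C & \bar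 A+\bar B(I-D\bar D)^{-1}D\bar C\end{bmatrix}$$ is Hurwitz (all eigenvalues in the open left half plane). Matrices attached to an NI $G$: $G_2=\lim_{s\to0}s^2G(s)$, $G_1=\lim_{s\to0}s\left(G(s)-\frac{G_2}{s^2}\right)$, $G_0=\lim_{s\to0}\left(G(s)-\frac{G_2}{s^2}-\frac{G_1}{s}\right)$. For NI $G$, $G_2\ge0$, so if $G_2\neq0$ it can be decomposed as $G_2=JJ^T$ with $J$ real of full column rank. *)

theory Defs
  imports
    Complex_Main
    "HOL-Computational_Algebra.Field_as_Ring"
    "HOL-Computational_Algebra.Polynomial_Factorial"
    "HOL-Computational_Algebra.Normalized_Fraction"
    "Jordan_Normal_Form.Gauss_Jordan_Elimination"
    "Jordan_Normal_Form.Schur_Decomposition"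
    "Jordan_Normal_Form.Char_Poly"
    "Jordan_Normal_Form.DL_Rank"
begin

section \<open>Matrices\<close>

text \<open>Only meaningful for invertible square matrices.\<close>

definition matinv :: "'a::field mat \<Rightarrow> 'a mat" where
  "matinv A = the (mat_inverse A)"

abbreviation cmat :: "real mat \<Rightarrow> complex mat" where
  "cmat \<equiv> map_mat complex_of_real"

definition hermitian_mat :: "complex mat \<Rightarrow> bool" where
  "hermitian_mat A \<longleftrightarrow> square_mat A \<and> mat_adjoint A = A"

text \<open>The scalar \<open>(A *\<^sub>v v) \<bullet>c v\<close> is the quadratic form \<open>v* A v\<close>.\<close>

definition pos_def :: "complex mat \<Rightarrow> bool" where
  "pos_def A \<longleftrightarrow> hermitian_mat A \<and>
     (\<forall>v \<in> carrier_vec (dim_row A). v \<noteq> 0\<^sub>v (dim_row A) \<longrightarrow> 0 < Re ((A *\<^sub>v v) \<bullet>c v))"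

definition pos_semidef :: "complex mat \<Rightarrow> bool" where
  "pos_semidef A \<longleftrightarrow> hermitian_mat A \<and>
     (\<forall>v \<in> carrier_vec (dim_row A). 0 \<le> Re ((A *\<^sub>v v) \<bullet>c v))"

definition neg_def :: "complex mat \<Rightarrow> bool" where
  "neg_def A \<longleftrightarrow> hermitian_mat A \<and>
     (\<forall>v \<in> carrier_vec (dim_row A). v \<noteq> 0\<^sub>v (dim_row A) \<longrightarrow> Re ((A *\<^sub>v v) \<bullet>c v) < 0)"

definition neg_semidef :: "complex mat \<Rightarrow> bool" where
  "neg_semidef A \<longleftrightarrow> hermitian_mat A \<and>
     (\<forall>v \<in> carrier_vec (dim_row A). Re ((A *\<^sub>v v) \<bullet>c v) \<le> 0)"

text \<open>Only meaningful for positive semidefinite \<open>A\<close>, where the root exists and is unique.\<close>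

definition psd_sqrt :: "complex mat \<Rightarrow> complex mat" where
  "psd_sqrt A = (THE S. S \<in> carrier_mat (dim_row A) (dim_row A) \<and> pos_semidef S \<and> S * S = A)"

definition full_column_rank :: "real mat \<Rightarrow> bool" where
  "full_column_rank J \<longleftrightarrow> vec_space.rank (dim_row J) J = dim_col J"

definition hurwitz :: "real mat \<Rightarrow> bool" where
  "hurwitz A \<longleftrightarrow> square_mat A \<and> (\<forall>k. eigenvalue (cmat A) k \<longrightarrow> Re k < 0)"

definition mat_tendsto ::
    "nat \<Rightarrow> (complex \<Rightarrow> complex mat) \<Rightarrow> complex mat \<Rightarrow> complex filter \<Rightarrow> bool" where
  "mat_tendsto m f L F \<longleftrightarrow> L \<in> carrier_mat m m \<and>
     (\<forall>i<m. \<forall>j<m. ((\<lambda>s. f s $$ (i, j)) \<longlongrightarrow> L $$ (i, j)) F)"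

text \<open>Only meaningful if the entrywise limit exists.\<close>

definition mat_Lim :: "nat \<Rightarrow> complex filter \<Rightarrow> (complex \<Rightarrow> complex mat) \<Rightarrow> complex mat" where
  "mat_Lim m F f = mat m m (\<lambda>(i, j). Lim F (\<lambda>s. f s $$ (i, j)))"

section \<open>Transfer function matrices\<close>

text \<open>
  A transfer function matrix is a matrix over the field \<open>\<real>(s)\<close> of real rational functions.
  Evaluation and poles refer to the representation of each entry in lowest terms (given by
  \<^const>\<open>quot_of_fract\<close>), so removable singularities do not count as poles.
  At a pole, evaluation returns the irrelevant value 0.
\<close>

type_synonym tfm = "real poly fract mat"

definition cnumer :: "real poly fract \<Rightarrow> complex poly" where
  "cnumer g = map_poly complex_of_real (fst (quot_of_fract g))"

definition cdenom :: "real poly fract \<Rightarrow> complex poly" where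
  "cdenom g = map_poly complex_of_real (snd (quot_of_fract g))"

definition tf_eval :: "tfm \<Rightarrow> complex \<Rightarrow> complex mat" where
  "tf_eval G s = map_mat (\<lambda>g. poly (cnumer g) s / poly (cdenom g) s) G"

definition tf_pole :: "tfm \<Rightarrow> complex \<Rightarrow> bool" where
  "tf_pole G s \<longleftrightarrow> (\<exists>i<dim_row G. \<exists>j<dim_col G. poly (cdenom (G $$ (i, j))) s = 0)"

text \<open>The order of a pole of a matrix is the largest pole order among its entries.\<close>

definition tf_simple_pole :: "tfm \<Rightarrow> complex \<Rightarrow> bool" where
  "tf_simple_pole G s \<longleftrightarrow> tf_pole G s \<and>
     (\<forall>i<dim_row G. \<forall>j<dim_col G. Polynomial.order s (cdenom (G $$ (i, j))) \<le> 1)"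

definition rat_const :: "real mat \<Rightarrow> tfm" where
  "rat_const A = map_mat (\<lambda>c. to_fract [:c:]) A"

definition rat_s :: "real poly fract" where
  "rat_s = to_fract [:0, 1:]"

text \<open>
  \<open>G = C (sI - A)\<^sup>-\<^sup>1 B + D\<close> as an identity over \<open>\<real>(s)\<close>; the state dimension \<open>n\<close> may be 0.
\<close>

definition realization ::
    "nat \<Rightarrow> nat \<Rightarrow> real mat \<Rightarrow> real mat \<Rightarrow> real mat \<Rightarrow> real mat \<Rightarrow> tfm \<Rightarrow> bool" where
  "realization m n A B C D G \<longleftrightarrow>
     A \<in> carrier_mat n n \<and> B \<in> carrier_mat n m \<and> C \<in> carrier_mat m n \<and> D \<in> carrier_mat m m \<and>
     G = rat_const C * matinv (rat_s \<cdot>\<^sub>m 1\<^sub>m n - rat_const A) * rat_const B + rat_const D"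

definition minimal_realization ::
    "nat \<Rightarrow> nat \<Rightarrow> real mat \<Rightarrow> real mat \<Rightarrow> real mat \<Rightarrow> real mat \<Rightarrow> tfm \<Rightarrow> bool" where
  "minimal_realization m n A B C D G \<longleftrightarrow> realization m n A B C D G \<and>
     (\<forall>n' A' B' C' D'. realization m n' A' B' C' D' G \<longrightarrow> n \<le> n')"

text \<open>Square, real, rational and proper; being proper is implied by having a realization.\<close>

definition transfer_function_matrix :: "nat \<Rightarrow> tfm \<Rightarrow> bool" where
  "transfer_function_matrix m G \<longleftrightarrow> G \<in> carrier_mat m m \<and> (\<exists>n A B C D. realization m n A B C D G)"

definition strictly_proper :: "nat \<Rightarrow> tfm \<Rightarrow> bool" where
  "strictly_proper m G \<longleftrightarrow> mat_tendsto m (tf_eval G) (0\<^sub>m m m) at_infinity"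

definition negative_imaginary :: "nat \<Rightarrow> tfm \<Rightarrow> bool" where
  "negative_imaginary m G \<longleftrightarrow> G \<in> carrier_mat m m \<and>
     (\<forall>s. Re s > 0 \<longrightarrow> \<not> tf_pole G s) \<and>
     (\<forall>\<omega>::real. \<omega> > 0 \<longrightarrow> \<not> tf_pole G (\<i> * \<omega>) \<longrightarrow>
        pos_semidef (\<i> \<cdot>\<^sub>m (tf_eval G (\<i> * \<omega>) - mat_adjoint (tf_eval G (\<i> * \<omega>))))) \<and>
     (\<forall>\<omega>\<^sub>0::real. \<omega>\<^sub>0 > 0 \<longrightarrow> tf_pole G (\<i> * \<omega>\<^sub>0) \<longrightarrow>
        tf_simple_pole G (\<i> * \<omega>\<^sub>0) \<and>
        (\<exists>K. mat_tendsto m (\<lambda>s. ((s - \<i> * \<omega>\<^sub>0) * \<i>) \<cdot>\<^sub>m tf_eval G s) K (at (\<i> * \<omega>\<^sub>0)) \<and>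
             pos_semidef K)) \<and>
     (tf_pole G 0 \<longrightarrow>
        (\<forall>k\<ge>3. mat_tendsto m (\<lambda>s. s ^ k \<cdot>\<^sub>m tf_eval G s) (0\<^sub>m m m) (at 0)) \<and>
        (\<exists>K. mat_tendsto m (\<lambda>s. s\<^sup>2 \<cdot>\<^sub>m tf_eval G s) K (at 0) \<and> pos_semidef K))"

definition strictly_negative_imaginary :: "nat \<Rightarrow> tfm \<Rightarrow> bool" where
  "strictly_negative_imaginary m G \<longleftrightarrow> G \<in> carrier_mat m m \<and>
     (\<forall>s. Re s \<ge> 0 \<longrightarrow> \<not> tf_pole G s) \<and>
     (\<forall>\<omega>::real. \<omega> > 0 \<longrightarrow>
        pos_def (\<i> \<cdot>\<^sub>m (tf_eval G (\<i> * \<omega>) - mat_adjoint (tf_eval G (\<i> * \<omega>)))))"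

text \<open>For negative imaginary \<open>G\<close> the following limits exist, as \<open>G\<close> has a pole of order at most 2 at 0.\<close>

definition G2 :: "nat \<Rightarrow> tfm \<Rightarrow> complex mat" where
  "G2 m G = mat_Lim m (at 0) (\<lambda>s. s\<^sup>2 \<cdot>\<^sub>m tf_eval G s)"

definition G1 :: "nat \<Rightarrow> tfm \<Rightarrow> complex mat" where
  "G1 m G = mat_Lim m (at 0) (\<lambda>s. s \<cdot>\<^sub>m (tf_eval G s - (1 / s\<^sup>2) \<cdot>\<^sub>m G2 m G))"

definition G0 :: "nat \<Rightarrow> tfm \<Rightarrow> complex mat" where
  "G0 m G = mat_Lim m (at 0)
     (\<lambda>s. tf_eval G s - (1 / s\<^sup>2) \<cdot>\<^sub>m G2 m G - (1 / s) \<cdot>\<^sub>m G1 m G)"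

section \<open>Positive feedback interconnection\<close>

definition closed_loop_matrix ::
    "nat \<Rightarrow> real mat \<Rightarrow> real mat \<Rightarrow> real mat \<Rightarrow> real mat \<Rightarrow>
     real mat \<Rightarrow> real mat \<Rightarrow> real mat \<Rightarrow> real mat \<Rightarrow> real mat" where
  "closed_loop_matrix m A B C D A' B' C' D' =
     (let X = matinv (1\<^sub>m m - D * D') in
      four_block_mat
        (A + B * D' * X * C)  (B * C' + B * D' * X * D * C')
        (B' * X * C)          (A' + B' * X * D * C'))"

text \<open>
  Minimal realizations are unique up to similarity of the state space, under which the closed loop
  matrix also changes by a similarity, so the choice of realizations is immaterial.
\<close>

definition internally_stable :: "nat \<Rightarrow> tfm \<Rightarrow> tfm \<Rightarrow> bool" where
  "internally_stable m G G' \<longleftrightarrow>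
     (\<exists>n A B C D n' A' B' C' D'.
        minimal_realization m n A B C D G \<and> minimal_realization m n' A' B' C' D' G' \<and>
        invertible_mat (1\<^sub>m m - D * D') \<and>
        hurwitz (closed_loop_matrix m A B C D A' B' C' D'))"

end

theory Submission
  imports "HOL-Complex_Analysis.Conformal_Mappings" Defs
begin

hide_const (open) Determinants.det
unbundle no vec_syntax
unbundle no inner_syntax

text \<open>
  Let \<open>k\<close> be a closed loop eigenvalue with \<open>Re k \<ge> 0\<close>. Its eigenvector yields \<open>u\<close>, \<open>w\<close> with
  \<open>w = Gbar(k) u\<close> and \<open>u = G(k) w\<close>. The maximum principle for rational functions, applied to
  \<open>u\<^sup>* (Gbar(0) - Gbar(s)) u / s\<close> and to \<open>(s z\<^sup>* - p\<^sup>*) G(s) (s z + p) / s + p\<^sup>* G\<^sub>0 p / s\<close>, bounds the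
  energy \<open>Re (k w\<^sup>* u) / Re k\<close> above by \<open>u\<^sup>* Gbar(0) u\<close> and below by \<open>2 Re (p\<^sup>* u) - p\<^sup>* G\<^sub>0 p\<close> for
  every \<open>p\<close> with \<open>J\<^sup>T p = 0\<close>. The choices \<open>p = N\<^sub>2 u\<close> in (a) and \<open>p = 0\<close> in (b) then force \<open>u = 0\<close>.
  On the imaginary axis strictness of \<open>Gbar\<close> does this instead; if \<open>k\<close> is a pole of \<open>G\<close>, the
  relation \<open>u = G(k) w\<close> holds as a limit because minimal realizations are controllable.

  Conversely, let the loop be stable and let \<open>Z\<close> be the response \<open>u\<close> to an exogenous signal \<open>d\<close>.
  Then \<open>s d\<^sup>* Z(s) d\<close> has nonnegative real part on the right half plane. Its limit at the origin
  along suitable \<open>d\<close> gives \<open>Re (d\<^sup>* u) \<ge> 0\<close> whenever \<open>u = J q + G\<^sub>0 p\<close>, \<open>d = p - Gbar(0) u\<close> and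
  \<open>J\<^sup>T p = 0\<close>. Taking \<open>p = 0\<close> and \<open>p = N\<^sub>2\<^sup>1\<^sup>/\<^sup>2 v\<close> yields the two definiteness conditions.
\<close>

section \<open>Rational functions on the right half plane\<close>

text \<open>The poles of \<open>G\<close> on the imaginary axis, above all the double pole at the
  origin, shape the proof: there \<open>G(k)\<close> has no value. All estimates are therefore made
  for scalar quadratic forms, which are rational functions over a characteristic polynomial, and all
  loop relations are stated as state equations, which make sense at every point. The vectors
  \<open>p\<close> are confined to the kernel of \<open>J\<^sup>T\<close> because
  \<open>G\<^sub>2 p = 0\<close> there; this removes the double pole from every term that contains
  \<open>p\<close>. The matrix \<open>N2\<close> supplies such vectors: it maps into that kernel. It
  also splits the form of \<open>Gbar(0)\<close> at \<open>u\<close> into the form of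
  \<open>N2\<close> at \<open>u\<close> plus the form of \<open>K = J\<^sup>T Gbar(0) J\<close> at
  the coordinates of a projection of \<open>u\<close> onto the range of \<open>J\<close>. Negative
  definiteness of \<open>K\<close> governs the second part, semidefiniteness of \<open>N2\<close>
  and the condition on \<open>G\<^sub>0\<close> the first. The determinant in (b) is nonzero because
  the energy bound with zero signal makes \<open>G\<^sub>0\<close> nonnegative on the kernel of
  \<open>J\<^sup>T\<close>.\<close>

lemma poly_quotient_tendsto_at_infinity:
  fixes p q :: "'a::real_normed_field poly"
  assumes "q \<noteq> 0" "degree p \<le> degree q"
  shows "((\<lambda>x. poly p x / poly q x) \<longlongrightarrow> coeff p (degree q) / lead_coeff q) at_infinity"
proof (cases "degree p = degree q")
  case True
  have nz: "eventually (\<lambda>x::'a. x \<noteq> 0) at_infinity"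
    by (rule eventually_at_infinityI[of 1]) auto
  have "((\<lambda>x. (poly p x / x ^ degree p) / (poly q x / x ^ degree q)) \<longlongrightarrow>
      lead_coeff p / lead_coeff q) at_infinity"
    using assms(1) by (intro tendsto_intros poly_divide_tendsto_aux) auto
  moreover have "eventually (\<lambda>x. (poly p x / x ^ degree p) / (poly q x / x ^ degree q)
      = poly p x / poly q x) at_infinity"
    using nz by eventually_elim (simp add: True)
  ultimately show ?thesis
    using True by (simp only: tendsto_cong)
next
  case False
  then show ?thesis
    using assms poly_divide_tendsto_0_at_infinity[of p q] by (simp add: coeff_eq_0)
qed

text \<open>The maximum principle on large half discs, with the limit at infinity controlling the
  arc. The finite set \<open>F\<close> allows for points of the axis where the quotient is regular
  but its sign is known only nearby; continuity fills these in.\<close>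

lemma rational_nonneg_right_half_plane_no_imaginary_pole:
  fixes P Q :: "complex poly"
  assumes Q: "Q \<noteq> 0" "degree P \<le> degree Q" "\<And>s. Re s \<ge> 0 \<Longrightarrow> poly Q s \<noteq> 0"
    and F: "finite F" "\<And>\<omega>::real. \<i> * \<omega> \<notin> F \<Longrightarrow> Re (poly P (\<i> * \<omega>) / poly Q (\<i> * \<omega>)) \<ge> 0"
    and s: "Re s \<ge> 0"
  shows "Re (poly P s / poly Q s) \<ge> 0"
proof -
  define h where "h = (\<lambda>s. poly P s / poly Q s)"
  define T where "T = {t::real. \<i> * t \<in> F}"
  have finT: "finite T"
  proof (rule finite_imageD)
    show "finite ((\<lambda>t::real. \<i> * complex_of_real t) ` T)"
      using F(1) by (rule finite_subset[rotated]) (auto simp: T_def)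
  qed (auto intro!: inj_onI)
  have axis: "Re (h (\<i> * t)) \<ge> 0" for t :: real
  proof -
    have "((\<lambda>t::real. Re (h (\<i> * t))) \<longlongrightarrow> Re (h (\<i> * t))) (at t)"
      unfolding h_def using Q(3) by (intro tendsto_intros) auto
    moreover have "eventually (\<lambda>x. x \<notin> T) (at t)"
    proof -
      have "open (- (T - {t}))" using finT by (intro open_Compl finite_imp_closed) auto
      then have "eventually (\<lambda>x. x \<in> - (T - {t})) (at t)"
        by (intro eventually_at_in_open') auto
      moreover have "eventually (\<lambda>x. x \<noteq> t) (at t)" by (simp add: eventually_at_filter)
      ultimately show ?thesis by eventually_elim auto
    qed
    then have "eventually (\<lambda>x. 0 \<le> Re (h (\<i> * x))) (at t)"
      by eventually_elim (use F(2) in \<open>auto simp: T_def h_def\<close>)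
    ultimately show ?thesis by (rule tendsto_lowerbound) auto
  qed
  \<comment> \<open>Properness gives the same limit in all directions, and approaching it along the
    imaginary axis shows that its real part is nonnegative.\<close>
  define L where "L = coeff P (degree Q) / lead_coeff Q"
  have L: "(h \<longlongrightarrow> L) at_infinity"
    unfolding h_def L_def by (rule poly_quotient_tendsto_at_infinity) (use Q in auto)
  have "filterlim (\<lambda>t. \<i> * complex_of_real t) at_infinity at_top"
    by (intro tendsto_mult_filterlim_at_infinity[of _ "\<i>"] tendsto_const)
       (auto intro: filterlim_of_real_at_infinity)
  from filterlim_compose[OF L this] have "((\<lambda>t. Re (h (\<i> * complex_of_real t))) \<longlongrightarrow> Re L) at_top"
    by (intro tendsto_intros)
  then have ReL: "Re L \<ge> 0"
    by (rule tendsto_lowerbound) (use axis in auto)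
  show ?thesis
  proof (rule field_le_epsilon)
    fix e :: real assume e: "e > 0"
    have "eventually (\<lambda>x. dist (h x) L < e) at_infinity"
      using L e by (rule tendstoD)
    then obtain R0 where R0: "\<And>x. norm x \<ge> R0 \<Longrightarrow> dist (h x) L < e"
      unfolding eventually_at_infinity by blast
    \<comment> \<open>On the arc of radius \<open>R\<close> the quotient is within \<open>e\<close>
      of \<open>L\<close>; \<open>norm s\<close> is included so that \<open>s\<close> lies in the
      half disc.\<close>
    define R where "R = max R0 (norm s)"
    define S where "S = {z. 0 \<le> Re z} \<inter> cball 0 R"
    have closedS: "closed S" unfolding S_def
      by (intro closed_Int closed_halfspace_Re_ge closed_cball)
    have "Re (- h s) \<le> e"
    proof (rule maximum_real_frontier[of "\<lambda>x. - h x" S])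
      show "(\<lambda>x. - h x) holomorphic_on interior S"
        unfolding h_def using interior_subset[of S] Q(3)
        by (intro holomorphic_intros) (auto simp: S_def)
      show "continuous_on (closure S) (\<lambda>x. - h x)"
        unfolding h_def closure_closed[OF closedS] using Q(3)
        by (intro continuous_intros) (auto simp: S_def)
      show "bounded S" unfolding S_def by (rule bounded_Int) auto
      show "s \<in> S" using s by (auto simp: S_def R_def)
      fix z assume z: "z \<in> frontier S"
      then have zS: "z \<in> S" "z \<notin> interior S"
        using closedS by (auto simp: frontier_def)
      have "Re z = 0 \<or> norm z = R"
      proof (rule ccontr)
        assume a: "\<not> (Re z = 0 \<or> norm z = R)"
        have "open ({z. 0 < Re z} \<inter> ball 0 R)" by (intro open_Int open_halfspace_Re_gt open_ball)
        moreover have "{z. 0 < Re z} \<inter> ball 0 R \<subseteq> S" by (auto simp: S_def)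
        ultimately have "{z. 0 < Re z} \<inter> ball 0 R \<subseteq> interior S" by (rule interior_maximal[rotated])
        moreover have "z \<in> {z. 0 < Re z} \<inter> ball 0 R" using a zS(1) by (auto simp: S_def)
        ultimately show False using zS(2) by blast
      qed
      then show "Re (- h z) \<le> e"
      proof
        assume "Re z = 0"
        then have "z = \<i> * complex_of_real (Im z)" by (simp add: complex_eq_iff)
        then show ?thesis using axis[of "Im z"] e by simp
      next
        assume "norm z = R"
        then have "dist (h z) L < e" by (intro R0) (auto simp: R_def)
        then have "\<bar>Re (h z - L)\<bar> < e"
          using abs_Re_le_cmod[of "h z - L"] by (simp add: dist_norm)
        then show ?thesis using ReL by simp
      qed
    qed
    then show "0 \<le> Re (poly P s / poly Q s) + e" by (simp add: h_def)
  qed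
qed

text \<open>Induction on the denominator: an imaginary root either cancels, or its partial fraction
  \<open>k / (s - a)\<close> with \<open>k \<ge> 0\<close> is split off, which is imaginary on the axis and has nonnegative real
  part to its right.\<close>

lemma rational_nonneg_right_half_plane:
  fixes P Q :: "complex poly"
  assumes "Q \<noteq> 0" "degree P \<le> degree Q" "\<And>s. Re s > 0 \<Longrightarrow> poly Q s \<noteq> 0"
    and "finite F" "\<And>\<omega>::real. \<i> * \<omega> \<notin> F \<Longrightarrow> Re (poly P (\<i> * \<omega>) / poly Q (\<i> * \<omega>)) \<ge> 0"
    and "\<And>a. Re a = 0 \<Longrightarrow> poly Q a = 0 \<Longrightarrow>
      \<exists>k\<ge>0. ((\<lambda>s. (s - a) * (poly P s / poly Q s)) \<longlongrightarrow> complex_of_real k) (at a)"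
    and "Re s > 0"
  shows "Re (poly P s / poly Q s) \<ge> 0"
  using assms
proof (induction "degree Q" arbitrary: P Q F)
  case 0
  then obtain c where c: "Q = [:c:]" by (metis degree_eq_zeroE)
  show ?case
    by (rule rational_nonneg_right_half_plane_no_imaginary_pole[of Q P F]) (use 0 c in auto)
next
  case (Suc n Q P F)
  show ?case
  proof (cases "\<exists>a. Re a = 0 \<and> poly Q a = 0")
    case False
    show ?thesis
      by (rule rational_nonneg_right_half_plane_no_imaginary_pole[of Q P F])
         (use Suc.prems False in \<open>auto simp: less_le\<close>)
  next
    case True
    then obtain a where a: "Re a = 0" "poly Q a = 0" by blast
    then obtain Q1 where Q1: "Q = [:-a, 1:] * Q1" by (metis dvdE poly_eq_0_iff_dvd)
    have Q1nz: "Q1 \<noteq> 0" using Suc.prems(1) Q1 by auto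
    have degQ: "degree Q = Suc (degree Q1)" unfolding Q1 using Q1nz by (subst degree_mult_eq) auto
    have pQ: "poly Q s = (s - a) * poly Q1 s" for s by (simp add: Q1 algebra_simps)
    obtain k where k: "k \<ge> 0" "((\<lambda>s. (s - a) * (poly P s / poly Q s)) \<longlongrightarrow> complex_of_real k) (at a)"
      using Suc.prems(6)[OF a] by blast
    have evr: "eventually (\<lambda>s. poly Q1 s \<noteq> 0 \<and> s \<noteq> a) (at b)" for b
    proof -
      have "finite {s. poly Q s = 0}" using Suc.prems(1) by (rule poly_roots_finite)
      then have "open (- ({s. poly Q s = 0} - {b}))" by (intro open_Compl finite_imp_closed) auto
      then have "eventually (\<lambda>x. x \<in> - ({s. poly Q s = 0} - {b})) (at b)"
        by (intro eventually_at_in_open') auto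
      moreover have "eventually (\<lambda>x. x \<noteq> b) (at b)" by (simp add: eventually_at_filter)
      ultimately show ?thesis by eventually_elim (auto simp: pQ)
    qed
    \<comment> \<open>The amount to split off is 0 if \<open>a\<close> is also a root of
      \<open>P\<close>, and the residue otherwise. In the latter case finiteness of the residue
      forces \<open>a\<close> to be a simple root of \<open>Q\<close>, whence the last
      disjunct.\<close>
    have "\<exists>k\<ge>0. poly P a = complex_of_real k * poly Q1 a \<and> (k = 0 \<or> poly Q1 a \<noteq> 0)"
    proof (cases "poly P a = 0")
      case True
      then show ?thesis by (intro exI[of _ 0]) auto
    next
      case False
      have "((\<lambda>s. (s - a) * (poly P s / poly Q s) * poly Q1 s) \<longlongrightarrow> k * poly Q1 a) (at a)"
        using k by (intro tendsto_intros) auto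
      moreover have "eventually (\<lambda>s. (s - a) * (poly P s / poly Q s) * poly Q1 s = poly P s) (at a)"
        using evr by eventually_elim (auto simp: pQ)
      ultimately have "((\<lambda>s. poly P s) \<longlongrightarrow> k * poly Q1 a) (at a)"
        by (auto dest: tendsto_cong)
      moreover have "((\<lambda>s. poly P s) \<longlongrightarrow> poly P a) (at a)" by (intro tendsto_intros)
      ultimately have "poly P a = k * poly Q1 a" by (intro tendsto_unique) auto
      with False k(1) show ?thesis by auto
    qed
    then obtain c where c: "c \<ge> 0" "poly P a = complex_of_real c * poly Q1 a" "c = 0 \<or> poly Q1 a \<noteq> 0"
      by blast
    have "poly (P - Polynomial.smult c Q1) a = 0" using c by simp
    then obtain P1 where P1: "P - Polynomial.smult c Q1 = [:-a, 1:] * P1" by (metis dvdE poly_eq_0_iff_dvd)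
    have pP1: "(s - a) * poly P1 s = poly P s - c * poly Q1 s" for s
      using arg_cong[OF P1, of "\<lambda>p. poly p s"] by (simp add: algebra_simps)
    have quot: "poly P1 s / poly Q1 s = poly P s / poly Q s - c / (s - a)" if "s \<noteq> a" "poly Q1 s \<noteq> 0" for s
    proof -
      have "poly P s / poly Q s - c / (s - a) = (poly P s - c * poly Q1 s) / ((s - a) * poly Q1 s)"
        using that by (simp add: pQ diff_divide_distrib)
      also have "\<dots> = poly P1 s / poly Q1 s" using that by (simp flip: pP1)
      finally show ?thesis by simp
    qed
    have degP1: "degree P1 \<le> degree Q1"
    proof (cases "P1 = 0")
      case False
      have "Suc (degree P1) = degree (P - Polynomial.smult c Q1)"
        unfolding P1 using False by (subst degree_mult_eq) auto
      also have "\<dots> \<le> max (degree P) (degree (Polynomial.smult (complex_of_real c) Q1))" by (rule degree_diff_le_max)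
      also have "\<dots> \<le> Suc (degree Q1)" using Suc.prems(2) degQ by auto
      finally show ?thesis by simp
    qed auto
    \<comment> \<open>The exceptional set grows by \<open>a\<close> and the roots of
      \<open>Q1\<close>, where the quotients take default values and cannot be compared.\<close>
    have "Re (poly P1 s / poly Q1 s) \<ge> 0"
    proof (rule Suc.hyps(1)[of Q1 P1 "F \<union> {a} \<union> {s. poly Q1 s = 0}"])
      show "n = degree Q1" using Suc.hyps(2) degQ by simp
      show "Q1 \<noteq> 0" by fact
      show "degree P1 \<le> degree Q1" by fact
      show "poly Q1 s \<noteq> 0" if "Re s > 0" for s using Suc.prems(3)[OF that] by (auto simp: pQ)
      show "finite (F \<union> {a} \<union> {s. poly Q1 s = 0})" using Suc.prems(4) Q1nz poly_roots_finite by auto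
      show "Re (poly P1 (\<i> * \<omega>) / poly Q1 (\<i> * \<omega>)) \<ge> 0"
        if "\<i> * complex_of_real \<omega> \<notin> F \<union> {a} \<union> {s. poly Q1 s = 0}" for \<omega>
      proof -
        have "Re (c / (\<i> * \<omega> - a)) = 0" using a(1) by (simp add: Re_divide)
        then show ?thesis using that Suc.prems(5)[of \<omega>] by (subst quot) auto
      qed
      show "0 < Re s" by fact
      fix b assume b: "Re b = 0" "poly Q1 b = 0"
      then have "poly Q b = 0" by (simp add: pQ)
      from Suc.prems(6)[OF b(1) this] obtain l where l: "l \<ge> 0"
        "((\<lambda>s. (s - b) * (poly P s / poly Q s)) \<longlongrightarrow> complex_of_real l) (at b)" by blast
      \<comment> \<open>The fraction split off leaves the remaining residues unchanged. If
        \<open>b = a\<close>, then \<open>Q1\<close> vanishes at \<open>a\<close>, and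
        \<open>c = 0\<close> by its choice.\<close>
      have "((\<lambda>s. (s - b) * (c / (s - a))) \<longlongrightarrow> 0) (at b)"
      proof (cases "c = 0")
        case False
        then have "b \<noteq> a" using c b by auto
        then have "((\<lambda>s. (s - b) * (c / (s - a))) \<longlongrightarrow> (b - b) * (c / (b - a))) (at b)"
          by (intro tendsto_intros) auto
        then show ?thesis by simp
      qed auto
      from tendsto_diff[OF l(2) this]
      have "((\<lambda>s. (s - b) * (poly P s / poly Q s) - (s - b) * (c / (s - a))) \<longlongrightarrow> l) (at b)" by simp
      moreover have "eventually (\<lambda>s. (s - b) * (poly P s / poly Q s) - (s - b) * (c / (s - a)) =
          (s - b) * (poly P1 s / poly Q1 s)) (at b)"
        using evr by eventually_elim (auto simp: quot algebra_simps)
      ultimately have "((\<lambda>s. (s - b) * (poly P1 s / poly Q1 s)) \<longlongrightarrow> l) (at b)"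
        by (auto dest: tendsto_cong)
      with l(1) show "\<exists>k\<ge>0. ((\<lambda>s. (s - b) * (poly P1 s / poly Q1 s)) \<longlongrightarrow> complex_of_real k) (at b)"
        by blast
    qed
    moreover have "Re (c / (s - a)) \<ge> 0"
      using c(1) a(1) Suc.prems(7) by (simp add: Re_divide)
    moreover have "s \<noteq> a" "poly Q1 s \<noteq> 0" using a(1) Suc.prems(3)[OF Suc.prems(7)] Suc.prems(7) by (auto simp: pQ)
    ultimately show ?thesis using quot[of s] by simp
  qed
qed

section \<open>Hermitian matrices and square roots\<close>

lemma mat_adjoint_carrier: "A \<in> carrier_mat n m \<Longrightarrow> mat_adjoint A \<in> carrier_mat m n"
  by (auto simp: mat_adjoint_def)

lemma dim_mat_adjoint [simp]: "dim_row (mat_adjoint A) = dim_col A" "dim_col (mat_adjoint A) = dim_row A"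
  by (auto simp: mat_adjoint_def)

lemma index_mat_adjoint [simp]:
  "i < dim_col A \<Longrightarrow> j < dim_row A \<Longrightarrow> mat_adjoint A $$ (i, j) = conjugate (A $$ (j, i))"
  by (simp add: mat_adjoint_def mat_of_rows_index)

lemma mat_adjoint_adjoint [simp]: "mat_adjoint (mat_adjoint (A :: complex mat)) = A"
  by (rule eq_matI) auto

lemma mat_adjoint_mult:
  fixes A B :: "complex mat"
  assumes "A \<in> carrier_mat n m" "B \<in> carrier_mat m k"
  shows "mat_adjoint (A * B) = mat_adjoint B * mat_adjoint A"
  using assms by (intro eq_matI) (auto simp: scalar_prod_def mult.commute intro!: sum.cong)

lemma cinner_sum: "(x :: complex vec) \<bullet>c y = (\<Sum>i<dim_vec y. x $ i * cnj (y $ i))"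
  by (auto simp: scalar_prod_def atLeast0LessThan intro!: sum.cong)

lemma cinner_commute:
  fixes x y :: "complex vec"
  assumes "x \<in> carrier_vec n" "y \<in> carrier_vec n"
  shows "x \<bullet>c y = cnj (y \<bullet>c x)"
  using assms by (auto simp: cinner_sum mult.commute)

lemma cinner_add_left:
  fixes x y z :: "complex vec"
  assumes "x \<in> carrier_vec n" "y \<in> carrier_vec n" "z \<in> carrier_vec n"
  shows "(x + y) \<bullet>c z = x \<bullet>c z + y \<bullet>c z"
  using assms by (auto simp: cinner_sum algebra_simps sum.distrib)

lemma cinner_add_right:
  fixes x y z :: "complex vec"
  assumes "x \<in> carrier_vec n" "y \<in> carrier_vec n" "z \<in> carrier_vec n"
  shows "z \<bullet>c (x + y) = z \<bullet>c x + z \<bullet>c y"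
  using assms by (auto simp: cinner_sum algebra_simps sum.distrib)

lemma cinner_diff_left:
  fixes x y z :: "complex vec"
  assumes "x \<in> carrier_vec n" "y \<in> carrier_vec n" "z \<in> carrier_vec n"
  shows "(x - y) \<bullet>c z = x \<bullet>c z - y \<bullet>c z"
  using assms by (auto simp: cinner_sum algebra_simps sum_subtractf)

lemma cinner_diff_right:
  fixes x y z :: "complex vec"
  assumes "x \<in> carrier_vec n" "y \<in> carrier_vec n" "z \<in> carrier_vec n"
  shows "z \<bullet>c (x - y) = z \<bullet>c x - z \<bullet>c y"
  using assms by (auto simp: cinner_sum algebra_simps sum_subtractf)

lemma cinner_smult_left:
  fixes x y :: "complex vec"
  assumes "x \<in> carrier_vec n" "y \<in> carrier_vec n"
  shows "(a \<cdot>\<^sub>v x) \<bullet>c y = a * (x \<bullet>c y)"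
  using assms by (auto simp: cinner_sum sum_distrib_left mult_ac intro!: sum.cong)

lemma cinner_smult_right:
  fixes x y :: "complex vec"
  assumes "x \<in> carrier_vec n" "y \<in> carrier_vec n"
  shows "x \<bullet>c (a \<cdot>\<^sub>v y) = cnj a * (x \<bullet>c y)"
  using assms by (auto simp: cinner_sum sum_distrib_left mult_ac intro!: sum.cong)

lemmas cinner_simps = cinner_add_left cinner_add_right cinner_diff_left cinner_diff_right
  cinner_smult_left cinner_smult_right

lemma cinner_zero [simp]:
  "(0\<^sub>v n :: complex vec) \<bullet>c (0\<^sub>v n) = 0"
  "x \<in> carrier_vec n \<Longrightarrow> (x :: complex vec) \<bullet>c 0\<^sub>v n = 0"
  "x \<in> carrier_vec n \<Longrightarrow> (0\<^sub>v n :: complex vec) \<bullet>c x = 0"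
  by (auto simp: cinner_sum)

lemma cinner_self: "(x :: complex vec) \<bullet>c x = complex_of_real (\<Sum>i<dim_vec x. (cmod (x $ i))\<^sup>2)"
  by (simp add: cinner_sum complex_norm_square del: of_real_power)

lemma cinner_self_ge_0 [simp]: "0 \<le> Re ((x :: complex vec) \<bullet>c x)"
  unfolding cinner_self by (simp add: sum_nonneg)

lemma cinner_self_eq_0:
  fixes x :: "complex vec"
  assumes "x \<in> carrier_vec n" "Re (x \<bullet>c x) \<le> 0"
  shows "x = 0\<^sub>v n"
proof -
  have "Re (x \<bullet>c x) = 0" using assms(2) cinner_self_ge_0[of x] by linarith
  then have "x \<bullet>c x = 0" by (simp add: cinner_self)
  with assms(1) show ?thesis by (simp del: cinner_self)
qed

lemma cinner_mult_adjoint: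
  fixes A :: "complex mat"
  assumes "A \<in> carrier_mat n m" "x \<in> carrier_vec m" "y \<in> carrier_vec n"
  shows "(A *\<^sub>v x) \<bullet>c y = x \<bullet>c (mat_adjoint A *\<^sub>v y)"
proof -
  have "(A *\<^sub>v x) \<bullet>c y = (\<Sum>i<n. \<Sum>j<m. A $$ (i, j) * x $ j * cnj (y $ i))"
    using assms by (auto simp: cinner_sum scalar_prod_def atLeast0LessThan sum_distrib_right intro!: sum.cong)
  also have "\<dots> = (\<Sum>j<m. \<Sum>i<n. A $$ (i, j) * x $ j * cnj (y $ i))" by (rule sum.swap)
  also have "\<dots> = x \<bullet>c (mat_adjoint A *\<^sub>v y)"
    using assms by (auto simp: cinner_sum scalar_prod_def atLeast0LessThan sum_distrib_left mult_ac intro!: sum.cong)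
  finally show ?thesis .
qed

lemma hermitian_mat_cinner:
  assumes "hermitian_mat A" "A \<in> carrier_mat n n" "x \<in> carrier_vec n" "y \<in> carrier_vec n"
  shows "(A *\<^sub>v x) \<bullet>c y = x \<bullet>c (A *\<^sub>v y)"
  using assms cinner_mult_adjoint[of A n n x y] by (simp add: hermitian_mat_def)

lemma hermitian_mat_Im_0:
  assumes "hermitian_mat A" "A \<in> carrier_mat n n" "x \<in> carrier_vec n"
  shows "Im ((A *\<^sub>v x) \<bullet>c x) = 0"
proof -
  have "(A *\<^sub>v x) \<bullet>c x = cnj ((A *\<^sub>v x) \<bullet>c x)"
    using hermitian_mat_cinner[OF assms(1,2,3,3)] cinner_commute[of x n "A *\<^sub>v x"] assms by auto
  then show ?thesis by (simp add: complex_eq_iff)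
qed

text \<open>Polarization: the form of \<open>A\<close> at \<open>e\<^sub>j + c e\<^sub>i\<close> being real for \<open>c = 1\<close> and \<open>c = \<i>\<close> gives
  the relation between the entries \<open>(i, j)\<close> and \<open>(j, i)\<close>.\<close>

lemma hermitian_matI_real_form:
  fixes A :: "complex mat"
  assumes A: "A \<in> carrier_mat n n" and re: "\<And>v. v \<in> carrier_vec n \<Longrightarrow> Im ((A *\<^sub>v v) \<bullet>c v) = 0"
  shows "hermitian_mat A"
proof -
  have form: "(A *\<^sub>v unit_vec n j) \<bullet>c unit_vec n i = A $$ (i, j)" if "i < n" "j < n" for i j
  proof -
    have "(A *\<^sub>v unit_vec n j) \<bullet>c unit_vec n i = (\<Sum>k<n. if k = i then A $$ (k, j) else 0)"
      unfolding cinner_sum using that A by (intro sum.cong) (auto simp: scalar_prod_right_unit)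
    then show ?thesis using that by simp
  qed
  have "cnj (A $$ (j, i)) = A $$ (i, j)" if ij: "i < n" "j < n" for i j
  proof -
    have *: "Im (cnj c * A $$ (i, j) + c * A $$ (j, i)) = 0" for c
    proof -
      let ?v = "unit_vec n j + c \<cdot>\<^sub>v unit_vec n i"
      have "(A *\<^sub>v ?v) \<bullet>c ?v = A $$ (j, j) + cnj c * A $$ (i, j) + c * A $$ (j, i) + c * cnj c * A $$ (i, i)"
        using ij A by (simp add: mult_add_distrib_mat_vec[of A n n] mult_mat_vec[of A n n]
            cinner_simps[where n = n] form algebra_simps)
      moreover have "Im (A $$ (i, i)) = 0" "Im (A $$ (j, j)) = 0"
        using re[of "unit_vec n i"] re[of "unit_vec n j"] form ij by auto
      ultimately show ?thesis using re[of ?v] by simp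
    qed
    show ?thesis using *[of 1] *[of \<i>] by (simp add: complex_eq_iff)
  qed
  then have "mat_adjoint A = A" using A by (intro eq_matI) auto
  then show ?thesis using A by (simp add: hermitian_mat_def)
qed

text \<open>A first variation argument: for small \<open>t\<close> a nonzero linear term would
  dominate and change sign.\<close>

lemma nonneg_quadratic_imp_linear_zero:
  fixes b c :: real
  assumes "\<And>t. 0 \<le> 2 * t * b + t\<^sup>2 * c"
  shows "b = 0"
proof (rule ccontr)
  assume b: "b \<noteq> 0"
  \<comment> \<open>The minimizer of the quadratic with \<open>c\<close> replaced by the larger
    \<open>\<bar>c\<bar> + 1\<close>, which is positive whatever the sign of
    \<open>c\<close>.\<close>
  define t where "t = - b / (\<bar>c\<bar> + 1)"
  have "2 * t * b + t\<^sup>2 * c \<le> 2 * t * b + t\<^sup>2 * (\<bar>c\<bar> + 1)"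
    by (intro add_left_mono mult_left_mono) auto
  also have "\<dots> = - (b\<^sup>2 / (\<bar>c\<bar> + 1))"
  proof -
    have "\<bar>c\<bar> + 1 \<noteq> 0" using abs_ge_zero[of c] by linarith
    then show ?thesis by (simp add: t_def power2_eq_square)
  qed
  also have "\<dots> < 0" using b by (simp add: divide_pos_pos add_nonneg_pos)
  finally show False using assms[of t] by linarith
qed

text \<open>Moving from \<open>v\<close> in the direction \<open>A v\<close> changes the form to
  first order by twice the squared norm of \<open>A v\<close>. As the form is minimal at
  \<open>v\<close>, this must vanish.\<close>

lemma semidef_form_zero_imp_kernel:
  fixes A :: "complex mat"
  assumes A: "hermitian_mat A" "A \<in> carrier_mat n n"
    and psd: "\<And>x. x \<in> carrier_vec n \<Longrightarrow> 0 \<le> Re ((A *\<^sub>v x) \<bullet>c x)"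
    and v: "v \<in> carrier_vec n" "Re ((A *\<^sub>v v) \<bullet>c v) = 0"
  shows "A *\<^sub>v v = 0\<^sub>v n"
proof (rule cinner_self_eq_0)
  let ?w = "A *\<^sub>v v"
  have w: "?w \<in> carrier_vec n" using A v by simp
  have "Re (?w \<bullet>c ?w) = 0"
  proof (rule nonneg_quadratic_imp_linear_zero)
    fix t :: real
    let ?y = "v + complex_of_real t \<cdot>\<^sub>v ?w"
    have y: "?y \<in> carrier_vec n" using w v by simp
    have "(A *\<^sub>v ?w) \<bullet>c v = ?w \<bullet>c ?w" by (rule hermitian_mat_cinner[OF A w v(1)])
    then have "Re ((A *\<^sub>v ?y) \<bullet>c ?y) = 2 * t * Re (?w \<bullet>c ?w) + t\<^sup>2 * Re ((A *\<^sub>v ?w) \<bullet>c ?w)"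
      using A w v by (simp add: mult_add_distrib_mat_vec[of A n n] mult_mat_vec[of A n n]
            cinner_simps[where n = n] power2_eq_square algebra_simps)
    with psd[OF y] show "0 \<le> 2 * t * Re (?w \<bullet>c ?w) + t\<^sup>2 * Re ((A *\<^sub>v ?w) \<bullet>c ?w)" by simp
  qed
  then show "Re (?w \<bullet>c ?w) \<le> 0" by simp
qed (use A v in simp)


section \<open>The spectral theorem for Hermitian matrices, and square roots\<close>

definition real_diag :: "nat \<Rightarrow> (nat \<Rightarrow> real) \<Rightarrow> complex mat" where
  "real_diag n d = mat n n (\<lambda>(i, j). if i = j then complex_of_real (d i) else 0)"

lemma real_diag_carrier [simp]: "real_diag n d \<in> carrier_mat n n"
  by (simp add: real_diag_def)

lemma dim_real_diag [simp]: "dim_row (real_diag n d) = n" "dim_col (real_diag n d) = n"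
  by (simp_all add: real_diag_def)

lemma mat_adjoint_real_diag [simp]: "mat_adjoint (real_diag n d) = real_diag n d"
  by (intro eq_matI) (auto simp: real_diag_def)

lemma real_diag_mult: "real_diag n d * real_diag n e = real_diag n (\<lambda>i. d i * e i)"
proof (intro eq_matI)
  fix i j assume ij: "i < dim_row (real_diag n (\<lambda>i. d i * e i))" "j < dim_col (real_diag n (\<lambda>i. d i * e i))"
  then have "(real_diag n d * real_diag n e) $$ (i, j) =
      (\<Sum>k<n. (if i = k then complex_of_real (d i) else 0) * (if k = j then complex_of_real (e k) else 0))"
    by (simp add: scalar_prod_def real_diag_def atLeast0LessThan)
  also have "\<dots> = (\<Sum>k<n. if k = i then (if i = j then complex_of_real (d i * e i) else 0) else 0)"
    by (intro sum.cong) auto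
  finally have "(real_diag n d * real_diag n e) $$ (i, j) = (if i = j then complex_of_real (d i * e i) else 0)"
    using ij by simp
  then show "(real_diag n d * real_diag n e) $$ (i, j) = real_diag n (\<lambda>i. d i * e i) $$ (i, j)"
    using ij by (simp add: real_diag_def)
qed auto

lemma real_diag_mult_vec:
  "x \<in> carrier_vec n \<Longrightarrow> real_diag n d *\<^sub>v x = vec n (\<lambda>i. d i * x $ i)"
proof (intro eq_vecI)
  fix i assume x: "x \<in> carrier_vec n" and i: "i < dim_vec (vec n (\<lambda>i. d i * x $ i))"
  then have "(real_diag n d *\<^sub>v x) $ i = (\<Sum>k<n. (if i = k then complex_of_real (d i) else 0) * x $ k)"
    by (simp add: scalar_prod_def real_diag_def atLeast0LessThan)
  also have "\<dots> = (\<Sum>k<n. if k = i then d i * x $ i else 0)" by (intro sum.cong) auto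
  finally show "(real_diag n d *\<^sub>v x) $ i = vec n (\<lambda>i. d i * x $ i) $ i"
    using i by simp
qed auto

text \<open>Gram-Schmidt on a basis that starts with \<open>v\<close> keeps the direction of its
  first vector. The scalar \<open>c\<close> is left open because the deflation below needs only the
  direction.\<close>

lemma unitary_first_column_exists:
  fixes v :: "complex vec"
  assumes v: "v \<in> carrier_vec n" "v \<noteq> 0\<^sub>v n"
  shows "\<exists>U c. U \<in> carrier_mat n n \<and> mat_adjoint U * U = 1\<^sub>m n \<and> col U 0 = c \<cdot>\<^sub>v v"
proof -
  define b where "b = basis_completion v"
  define ws where "ws = gram_schmidt n b"
  interpret cof_vec_space n "TYPE(complex)" .
  from basis_completion[OF v, folded b_def]
  have dist_b: "distinct b" and indep: "\<not> lin_dep (set b)" and b: "set b \<subseteq> carrier_vec n"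
    and hdb: "hd b = v" and len_b: "length b = n" by auto
  have n: "n > 0" using v by (cases n) auto
  from hdb len_b n obtain vs where bv: "b = v # vs" by (cases b, auto)
  from gram_schmidt_result[OF b dist_b indep refl, folded ws_def]
  have ws: "set ws \<subseteq> carrier_vec n" "corthogonal ws" "length ws = n"
    by (auto simp: len_b)
  have hdws: "ws ! 0 = v" using gram_schmidt_hd[OF v(1), of vs, folded bv] ws n
    by (metis hd_conv_nth length_greater_0_conv ws_def)
  have wsn [simp]: "ws ! i \<in> carrier_vec n" if "i < n" for i using ws that by auto
  \<comment> \<open>The vectors \<open>ws\<close> are orthogonal but not normalized;
    \<open>l\<close> holds their reciprocal norms.\<close>
  define l where "l = (\<lambda>i. 1 / sqrt (Re (ws ! i \<bullet>c ws ! i)))"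
  define U where "U = mat n n (\<lambda>(i, j). complex_of_real (l j) * ws ! j $ i)"
  have colU: "col U j = complex_of_real (l j) \<cdot>\<^sub>v ws ! j" if "j < n" for j
    using that by (intro eq_vecI) (auto simp: U_def carrier_vecD[OF wsn])
  have "mat_adjoint U * U = 1\<^sub>m n"
  proof (intro eq_matI)
    fix i j assume "i < dim_row (1\<^sub>m n :: complex mat)" "j < dim_col (1\<^sub>m n :: complex mat)"
    then have ij: "i < n" "j < n" by auto
    have "(mat_adjoint U * U) $$ (i, j) = col U j \<bullet>c col U i"
      using ij by (auto simp: U_def cinner_sum scalar_prod_def atLeast0LessThan mult_ac intro!: sum.cong)
    also have "\<dots> = l j * l i * (ws ! j \<bullet>c ws ! i)"
      using ij by (simp add: colU cinner_smult_left[of _ n] cinner_smult_right[of _ n])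
    also have "\<dots> = (if i = j then 1 else 0)"
    proof (cases "i = j")
      case True
      have "ws ! i \<bullet>c ws ! i \<noteq> 0" using corthogonalD[OF ws(2), of i i] ij ws by auto
      moreover have re: "ws ! i \<bullet>c ws ! i = Re (ws ! i \<bullet>c ws ! i)" by (simp add: cinner_self)
      ultimately have "Re (ws ! i \<bullet>c ws ! i) \<noteq> 0" by (metis of_real_0)
      then have pos: "Re (ws ! i \<bullet>c ws ! i) > 0" using cinner_self_ge_0[of "ws ! i"] by linarith
      from re have "l i * l i * (ws ! i \<bullet>c ws ! i) = complex_of_real (l i * l i * Re (ws ! i \<bullet>c ws ! i))"
        by (metis of_real_mult)
      also have "l i * l i * Re (ws ! i \<bullet>c ws ! i) = 1" using pos by (simp add: l_def)
      finally show ?thesis using True by simp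
    next
      case False
      then show ?thesis using corthogonalD[OF ws(2), of j i] ij ws by auto
    qed
    finally show "(mat_adjoint U * U) $$ (i, j) = 1\<^sub>m n $$ (i, j)" using ij by simp
  qed (auto simp: U_def)
  moreover have "U \<in> carrier_mat n n" by (simp add: U_def)
  ultimately show ?thesis using colU[OF n] hdws by metis
qed

lemma unitary_right_inverse:
  fixes U :: "complex mat"
  assumes "U \<in> carrier_mat n n" "mat_adjoint U * U = 1\<^sub>m n"
  shows "U * mat_adjoint U = 1\<^sub>m n"
  using mat_mult_left_right_inverse[OF mat_adjoint_carrier[OF assms(1)] assms] .

lemma complex_eigenvalue_exists:
  fixes A :: "complex mat"
  assumes "A \<in> carrier_mat n n" "n > 0"
  shows "\<exists>e v. v \<in> carrier_vec n \<and> v \<noteq> 0\<^sub>v n \<and> A *\<^sub>v v = e \<cdot>\<^sub>v v"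
proof -
  have "degree (char_poly A) = n" using degree_monic_char_poly[OF assms(1)] by simp
  then have "\<not> constant (poly (char_poly A))" using assms(2) by (simp add: constant_degree)
  then obtain e where "poly (char_poly A) e = 0" using fundamental_theorem_of_algebra by blast
  then have "eigenvalue A e" using eigenvalue_root_char_poly[OF assms(1)] by simp
  then show ?thesis using assms by (auto simp: eigenvalue_def eigenvector_def)
qed

text \<open>Deflation: in a unitary basis that begins with an eigenvector the first column is zero
  below the diagonal, by symmetry so is the first row to its right, and the remaining block is again
  Hermitian.\<close>

theorem hermitian_unitary_diagonalization:
  assumes "A \<in> carrier_mat n n" "hermitian_mat A"
  shows "\<exists>U d. U \<in> carrier_mat n n \<and> mat_adjoint U * U = 1\<^sub>m n \<and> A = U * real_diag n d * mat_adjoint U"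
  using assms
proof (induction n arbitrary: A)
  case 0
  then show ?case by (intro exI[of _ "1\<^sub>m 0"] exI[of _ "\<lambda>_. 0"]) auto
next
  case (Suc k)
  let ?n = "Suc k"
  note A = Suc.prems
  obtain e v where v: "v \<in> carrier_vec ?n" "v \<noteq> 0\<^sub>v ?n" "A *\<^sub>v v = e \<cdot>\<^sub>v v"
    using complex_eigenvalue_exists[OF A(1)] by auto
  obtain U c where U: "U \<in> carrier_mat ?n ?n" "mat_adjoint U * U = 1\<^sub>m ?n" "col U 0 = c \<cdot>\<^sub>v v"
    using unitary_first_column_exists[OF v(1,2)] by blast
  have U': "U * mat_adjoint U = 1\<^sub>m ?n" by (rule unitary_right_inverse[OF U(1,2)])
  note aU = mat_adjoint_carrier[OF U(1)]
  define B where "B = mat_adjoint U * A * U"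
  have B: "B \<in> carrier_mat ?n ?n" using U(1) aU A by (auto simp: B_def)
  have adjB: "mat_adjoint B = B"
    using A U(1) aU unfolding B_def hermitian_mat_def
    by (simp add: mat_adjoint_mult[of _ ?n ?n _ ?n] assoc_mult_mat[of _ ?n ?n _ ?n _ ?n])
  have hermB: "cnj (B $$ (j, i)) = B $$ (i, j)" if "i < ?n" "j < ?n" for i j
    using index_mat_adjoint[of i B j] that B unfolding adjB by simp
  have colB: "B $$ (i, 0) = (if i = 0 then e else 0)" if i: "i < ?n" for i
  proof -
    have "col U 0 = U *\<^sub>v unit_vec ?n 0"
      using U(1) by (intro eq_vecI) (auto simp: scalar_prod_right_unit)
    then have Ue: "U *\<^sub>v unit_vec ?n 0 = c \<cdot>\<^sub>v v" using U(3) by simp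
    have "A *\<^sub>v (U *\<^sub>v unit_vec ?n 0) = e \<cdot>\<^sub>v (U *\<^sub>v unit_vec ?n 0)"
      unfolding Ue using v A(1) by (simp add: mult_mat_vec[of A ?n ?n] smult_smult_assoc mult.commute)
    moreover have "B *\<^sub>v unit_vec ?n 0 = mat_adjoint U *\<^sub>v (A *\<^sub>v (U *\<^sub>v unit_vec ?n 0))"
      using A(1) U(1) aU unfolding B_def by (simp add: assoc_mult_mat_vec[of _ ?n ?n _ ?n])
    ultimately have "B *\<^sub>v unit_vec ?n 0 = mat_adjoint U *\<^sub>v (e \<cdot>\<^sub>v (U *\<^sub>v unit_vec ?n 0))" by simp
    also have "\<dots> = e \<cdot>\<^sub>v ((mat_adjoint U * U) *\<^sub>v unit_vec ?n 0)"
      using U(1) aU by (simp add: assoc_mult_mat_vec[of _ ?n ?n _ ?n] mult_mat_vec[of _ ?n ?n])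
    also have "\<dots> = e \<cdot>\<^sub>v unit_vec ?n 0" by (simp add: U(2))
    finally have "(B *\<^sub>v unit_vec ?n 0) $ i = (e \<cdot>\<^sub>v unit_vec ?n 0) $ i" by simp
    then show ?thesis using i B by (simp add: scalar_prod_right_unit)
  qed
  have e: "e = complex_of_real (Re e)" using hermB[of 0 0] colB[of 0] by (simp add: complex_eq_iff)
  have rowB: "B $$ (0, j) = 0" if "0 < j" "j < ?n" for j
    using hermB[of 0 j] colB[of j] that by simp
  define B3 where "B3 = mat k k (\<lambda>(i, j). B $$ (Suc i, Suc j))"
  have "hermitian_mat B3"
    unfolding hermitian_mat_def by (auto simp: B3_def hermB intro!: eq_matI)
  from Suc.IH[OF _ this] obtain V d where V: "V \<in> carrier_mat k k" "mat_adjoint V * V = 1\<^sub>m k"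
    "B3 = V * real_diag k d * mat_adjoint V" by (auto simp: B3_def)
  note aV = mat_adjoint_carrier[OF V(1)]
  define Z where "Z = four_block_mat (1\<^sub>m 1) (0\<^sub>m 1 k) (0\<^sub>m k 1) V"
  define d' where "d' = case_nat (Re e) d"
  have D: "real_diag ?n d' = four_block_mat (real_diag 1 d') (0\<^sub>m 1 k) (0\<^sub>m k 1) (real_diag k d)"
    by (intro eq_matI) (auto simp: real_diag_def d'_def split: nat.splits)
  have Z: "Z \<in> carrier_mat ?n ?n" using V by (auto simp: Z_def)
  note aZ = mat_adjoint_carrier[OF Z]
  have adjZ: "mat_adjoint Z = four_block_mat (1\<^sub>m 1) (0\<^sub>m 1 k) (0\<^sub>m k 1) (mat_adjoint V)"
    using V by (intro eq_matI) (auto simp: Z_def)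
  have "mat_adjoint Z * Z = four_block_mat (1\<^sub>m 1) (0\<^sub>m 1 k) (0\<^sub>m k 1) (1\<^sub>m k)"
    unfolding adjZ using V aV by (simp add: Z_def mult_four_block_mat[of _ 1 1 _ k _ k _ _ 1 _ k])
  then have ZZ: "mat_adjoint Z * Z = 1\<^sub>m ?n" by simp
  have "Z * real_diag ?n d' * mat_adjoint Z = four_block_mat (real_diag 1 d') (0\<^sub>m 1 k) (0\<^sub>m k 1) B3"
    unfolding adjZ D using V aV mult_carrier_mat[OF mult_carrier_mat[OF V(1) real_diag_carrier] aV, of d]
    by (simp add: Z_def mult_four_block_mat[of _ 1 1 _ k _ k _ _ 1 _ k])
  also have "\<dots> = B"
    using B colB rowB e[symmetric]
    by (intro eq_matI) (auto simp: B3_def real_diag_def d'_def)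
  finally have BZ: "B = Z * real_diag ?n d' * mat_adjoint Z" ..
  have "U * B * mat_adjoint U = (U * mat_adjoint U) * A * (U * mat_adjoint U)"
    using A U(1) aU unfolding B_def by (simp add: assoc_mult_mat[of _ ?n ?n _ ?n _ ?n])
  then have "A = U * B * mat_adjoint U" using A by (simp add: U')
  also have "\<dots> = (U * Z) * real_diag ?n d' * mat_adjoint (U * Z)"
    using U(1) Z aU aZ mult_carrier_mat[OF real_diag_carrier aZ, of d']
      mult_carrier_mat[OF Z mult_carrier_mat[OF real_diag_carrier aZ], of d'] unfolding BZ by (simp add: mat_adjoint_mult[of _ ?n ?n _ ?n] assoc_mult_mat[of _ ?n ?n _ ?n _ ?n])
  finally have "A = (U * Z) * real_diag ?n d' * mat_adjoint (U * Z)" .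
  moreover have "mat_adjoint (U * Z) * (U * Z) = mat_adjoint Z * (mat_adjoint U * U) * Z"
    using U(1) Z aU aZ by (simp add: mat_adjoint_mult[of _ ?n ?n _ ?n] assoc_mult_mat[of _ ?n ?n _ ?n _ ?n])
  then have "mat_adjoint (U * Z) * (U * Z) = 1\<^sub>m ?n" using Z ZZ by (simp add: U(2))
  ultimately show ?case using U(1) Z by (intro exI[of _ "U * Z"] exI[of _ d']) auto
qed


lemma real_diag_form:
  assumes "x \<in> carrier_vec n"
  shows "Re ((real_diag n d *\<^sub>v x) \<bullet>c x) = (\<Sum>i<n. d i * (cmod (x $ i))\<^sup>2)"
proof -
  have "(real_diag n d *\<^sub>v x) \<bullet>c x = (\<Sum>i<n. complex_of_real (d i * (cmod (x $ i))\<^sup>2))"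
    unfolding cinner_sum using assms
    by (intro sum.cong) (auto simp: real_diag_mult_vec complex_norm_square simp del: of_real_power)
  then show ?thesis by simp
qed

lemma unitary_conj_form:
  fixes U B :: "complex mat"
  assumes "U \<in> carrier_mat n n" "B \<in> carrier_mat n n" "v \<in> carrier_vec n"
  shows "((U * B * mat_adjoint U) *\<^sub>v v) \<bullet>c v = (B *\<^sub>v (mat_adjoint U *\<^sub>v v)) \<bullet>c (mat_adjoint U *\<^sub>v v)"
  using assms mat_adjoint_carrier[OF assms(1)]
  by (simp add: assoc_mult_mat_vec[of _ n n _ n] cinner_mult_adjoint[of U n n])

lemma unitary_eigencolumn:
  fixes U :: "complex mat"
  assumes "U \<in> carrier_mat n n" "mat_adjoint U * U = 1\<^sub>m n" "i < n"
  defines "u \<equiv> U *\<^sub>v unit_vec n i"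
  shows "(U * real_diag n d * mat_adjoint U) *\<^sub>v u = complex_of_real (d i) \<cdot>\<^sub>v u" "u \<bullet>c u = 1"
proof -
  note aU = mat_adjoint_carrier[OF assms(1)]
  have 1: "mat_adjoint U *\<^sub>v u = unit_vec n i"
    unfolding u_def by (subst assoc_mult_mat_vec[OF aU assms(1), symmetric]) (simp_all add: assms(2))
  have "real_diag n d *\<^sub>v unit_vec n i = complex_of_real (d i) \<cdot>\<^sub>v unit_vec n i"
    using assms(3) by (intro eq_vecI) (auto simp: real_diag_mult_vec)
  then show "(U * real_diag n d * mat_adjoint U) *\<^sub>v u = complex_of_real (d i) \<cdot>\<^sub>v u"
    using assms(1,3) aU 1 by (simp add: assoc_mult_mat_vec[of _ n n _ n] mult_mat_vec[of U n n] u_def)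
  have "u \<bullet>c u = unit_vec n i \<bullet>c (mat_adjoint U *\<^sub>v u)"
    using assms(1,3) by (simp add: u_def cinner_mult_adjoint[of U n n])
  also have "\<dots> = (\<Sum>k<n. if k = i then 1 else 0)"
    unfolding 1 cinner_sum using assms(3) by (intro sum.cong) auto
  also have "\<dots> = 1" using assms(3) by simp
  finally show "u \<bullet>c u = 1" .
qed

text \<open>The root is taken on the eigenvalues, which are nonnegative because they are the values
  of the form at the columns of \<open>U\<close>.\<close>

lemma pos_semidef_square_root_exists:
  assumes A: "A \<in> carrier_mat n n" "pos_semidef A"
  shows "\<exists>S. S \<in> carrier_mat n n \<and> pos_semidef S \<and> S * S = A"
proof -
  obtain U d where U: "U \<in> carrier_mat n n" "mat_adjoint U * U = 1\<^sub>m n"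
    and AU: "A = U * real_diag n d * mat_adjoint U"
    using hermitian_unitary_diagonalization[of A n] A by (auto simp: pos_semidef_def)
  have d: "d i \<ge> 0" if "i < n" for i
  proof -
    let ?u = "U *\<^sub>v unit_vec n i"
    have u: "?u \<in> carrier_vec n" using U by simp
    have "0 \<le> Re ((A *\<^sub>v ?u) \<bullet>c ?u)" using A u by (auto simp: pos_semidef_def)
    also have "\<dots> = d i"
      using unitary_eigencolumn(1)[OF U that, of d] unitary_eigencolumn(2)[OF U that] u by (simp add: AU cinner_smult_left[of _ n])
    finally show ?thesis .
  qed
  define E where "E = real_diag n (\<lambda>i. sqrt (d i))"
  have E: "E \<in> carrier_mat n n" "mat_adjoint E = E" by (simp_all add: E_def)
  define S where "S = U * E * mat_adjoint U"
  note aU = mat_adjoint_carrier[OF U(1)]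
  have S: "S \<in> carrier_mat n n" unfolding S_def by (rule mult_carrier_mat[OF mult_carrier_mat[OF U(1) E(1)] aU])
  have "mat_adjoint S = S"
    using U(1) aU E unfolding S_def by (simp add: mat_adjoint_mult[of _ n n _ n])
  moreover have "0 \<le> Re ((S *\<^sub>v v) \<bullet>c v)" if "v \<in> carrier_vec n" for v
    unfolding S_def unitary_conj_form[OF U(1) E(1) that] unfolding E_def
    using d mult_mat_vec_carrier[OF aU that] by (auto simp: real_diag_form intro!: sum_nonneg)
  ultimately have "pos_semidef S" using S by (auto simp: pos_semidef_def hermitian_mat_def)
  have "S * S = U * (E * (mat_adjoint U * U) * E) * mat_adjoint U"
  proof -
    have "(U * E * V) * (U * E * V) = U * (E * (V * U) * E) * V" if "V \<in> carrier_mat n n" for V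
      using that U(1) E(1) by (simp add: assoc_mult_mat[of _ n n _ n _ n])
    from this[OF aU] show ?thesis unfolding S_def .
  qed
  also have "\<dots> = U * (E * E) * mat_adjoint U"
    using E unfolding U(2) by simp
  also have "E * E = real_diag n d"
    unfolding E_def real_diag_mult using d by (intro eq_matI) (auto simp: real_diag_def)
  finally have "S * S = A" by (simp add: AU)
  with S \<open>pos_semidef S\<close> show ?thesis by blast
qed

text \<open>For two roots \<open>S\<close>, \<open>T\<close> and \<open>X = S - T\<close> one has \<open>S X + X T = 0\<close>. At an eigenvector of \<open>X\<close>
  with nonzero eigenvalue the forms of \<open>S\<close> and \<open>T\<close> would then both vanish, hence also that of \<open>X\<close>.\<close>

lemma pos_semidef_square_root_unique:
  assumes S: "S \<in> carrier_mat n n" "pos_semidef S" and T: "T \<in> carrier_mat n n" "pos_semidef T"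
    and eq: "S * S = T * T"
  shows "S = T"
proof -
  define X where "X = S - T"
  have X: "X \<in> carrier_mat n n" using S T by (auto simp: X_def)
  have herm: "hermitian_mat S" "hermitian_mat T" using S T by (auto simp: pos_semidef_def)
  have hX: "hermitian_mat X"
  proof (rule hermitian_matI_real_form[OF X])
    fix v :: "complex vec" assume "v \<in> carrier_vec n"
    then show "Im ((X *\<^sub>v v) \<bullet>c v) = 0"
      using S T herm hermitian_mat_Im_0[of S n v] hermitian_mat_Im_0[of T n v]
      by (simp add: X_def minus_mult_distrib_mat_vec[of _ n n] cinner_diff_left[of _ n])
  qed
  obtain U d where U: "U \<in> carrier_mat n n" "mat_adjoint U * U = 1\<^sub>m n"
    and XU: "X = U * real_diag n d * mat_adjoint U"
    using hermitian_unitary_diagonalization[OF X hX] by blast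
  have "d i = 0" if i: "i < n" for i
  proof (rule ccontr)
    assume di: "d i \<noteq> 0"
    let ?u = "U *\<^sub>v unit_vec n i"
    have u: "?u \<in> carrier_vec n" using U by simp
    note ev = unitary_eigencolumn(1)[OF U i, of d, folded XU] unitary_eigencolumn(2)[OF U i]
    have Xv: "X *\<^sub>v v = S *\<^sub>v v - T *\<^sub>v v" if "v \<in> carrier_vec n" for v
      using that S T unfolding X_def by (simp add: minus_mult_distrib_mat_vec[of _ n n])
    have "(S *\<^sub>v (X *\<^sub>v ?u)) \<bullet>c ?u + (X *\<^sub>v (T *\<^sub>v ?u)) \<bullet>c ?u =
        ((S * S) *\<^sub>v ?u) \<bullet>c ?u - ((T * T) *\<^sub>v ?u) \<bullet>c ?u"
      using S T u by (simp add: Xv mult_minus_distrib_mat_vec[of _ n n] cinner_diff_left[of _ n]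
          assoc_mult_mat_vec[of _ n n _ n])
    also have "\<dots> = 0" by (simp add: eq)
    finally have "(S *\<^sub>v (X *\<^sub>v ?u)) \<bullet>c ?u + (X *\<^sub>v (T *\<^sub>v ?u)) \<bullet>c ?u = 0" .
    moreover have "(X *\<^sub>v (T *\<^sub>v ?u)) \<bullet>c ?u = d i * ((T *\<^sub>v ?u) \<bullet>c ?u)"
      using hermitian_mat_cinner[OF hX X, of "T *\<^sub>v ?u" ?u] T u ev
      by (simp add: cinner_smult_right[of _ n])
    moreover have "(S *\<^sub>v (X *\<^sub>v ?u)) \<bullet>c ?u = d i * ((S *\<^sub>v ?u) \<bullet>c ?u)"
      using S u ev by (simp add: mult_mat_vec[of S n n] cinner_smult_left[of _ n])
    ultimately have "d i * ((S *\<^sub>v ?u) \<bullet>c ?u + (T *\<^sub>v ?u) \<bullet>c ?u) = 0" by (simp add: algebra_simps)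
    then have 0: "(S *\<^sub>v ?u) \<bullet>c ?u + (T *\<^sub>v ?u) \<bullet>c ?u = 0" using di by simp
    have "Re ((S *\<^sub>v ?u) \<bullet>c ?u) + Re ((T *\<^sub>v ?u) \<bullet>c ?u) = 0"
      using arg_cong[OF 0, of Re] by simp
    moreover have "Re ((S *\<^sub>v ?u) \<bullet>c ?u) \<ge> 0" "Re ((T *\<^sub>v ?u) \<bullet>c ?u) \<ge> 0"
      using S T u by (auto simp: pos_semidef_def)
    moreover have "d i = Re ((S *\<^sub>v ?u) \<bullet>c ?u) - Re ((T *\<^sub>v ?u) \<bullet>c ?u)"
      using arg_cong[OF ev(1), of "\<lambda>w. Re (w \<bullet>c ?u)"] ev(2) S T u
      by (simp add: Xv cinner_smult_left[of _ n] cinner_diff_left[of _ n])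
    ultimately show False using di by linarith
  qed
  then have "real_diag n d = 0\<^sub>m n n" by (intro eq_matI) (auto simp: real_diag_def)
  then have "X = 0\<^sub>m n n" using U by (simp add: XU)
  have "S $$ (i, j) = T $$ (i, j)" if "i < n" "j < n" for i j
    using arg_cong[OF \<open>X = 0\<^sub>m n n\<close>, of "\<lambda>M. M $$ (i, j)"] that S T by (simp add: X_def)
  then show ?thesis using S T by (intro eq_matI) auto
qed

lemma psd_sqrt:
  assumes A: "A \<in> carrier_mat n n" "pos_semidef A"
  shows "psd_sqrt A \<in> carrier_mat n n" "pos_semidef (psd_sqrt A)" "psd_sqrt A * psd_sqrt A = A"
proof -
  have "\<exists>!S. S \<in> carrier_mat n n \<and> pos_semidef S \<and> S * S = A"
    using pos_semidef_square_root_exists[OF A] pos_semidef_square_root_unique by blast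
  from theI'[OF this] show "psd_sqrt A \<in> carrier_mat n n" "pos_semidef (psd_sqrt A)" "psd_sqrt A * psd_sqrt A = A"
    using A(1) unfolding psd_sqrt_def by auto
qed

section \<open>Transfer functions and realizations\<close>

lemma matinv:
  fixes A :: "'a::field mat"
  assumes A: "A \<in> carrier_mat n n" "det A \<noteq> 0"
  shows "matinv A \<in> carrier_mat n n" "A * matinv A = 1\<^sub>m n" "matinv A * A = 1\<^sub>m n"
proof -
  have "mat_inverse A \<noteq> None"
    using mat_inverse(1)[OF A(1), where b = "()"] det_non_zero_imp_unit[OF A, of "()"] by blast
  then obtain B where "mat_inverse A = Some B" by blast
  with mat_inverse(2)[OF A(1) this]
  show "matinv A \<in> carrier_mat n n" "A * matinv A = 1\<^sub>m n" "matinv A * A = 1\<^sub>m n"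
    by (auto simp: matinv_def)
qed

lemma invertible_mat_det:
  fixes A :: "'a::field mat"
  assumes "A \<in> carrier_mat n n" "invertible_mat A"
  shows "det A \<noteq> 0"
proof -
  obtain B where B: "A * B = 1\<^sub>m n" "B * A = 1\<^sub>m (dim_row B)"
    using assms by (auto simp: invertible_mat_def inverts_mat_def)
  have "B \<in> carrier_mat n n"
    using arg_cong[OF B(1), of dim_col] arg_cong[OF B(2), of dim_col] assms(1) by auto
  then have "det A * det B = 1" using B(1) assms(1) by (metis det_mult det_one)
  then show ?thesis by auto
qed

section \<open>Evaluation of rational functions at points that are not poles\<close>

definition rat_regular :: "real poly fract \<Rightarrow> complex \<Rightarrow> bool" where
  "rat_regular g s \<longleftrightarrow> poly (cdenom g) s \<noteq> 0"

definition rat_eval :: "real poly fract \<Rightarrow> complex \<Rightarrow> complex" where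
  "rat_eval g s = poly (cnumer g) s / poly (cdenom g) s"

lemma tf_eval_alt: "tf_eval G s = map_mat (\<lambda>g. rat_eval g s) G"
  by (simp add: tf_eval_def rat_eval_def)

lemma poly_of_real_hom:
  "poly (map_poly complex_of_real (p * q)) s = poly (map_poly complex_of_real p) s * poly (map_poly complex_of_real q) s"
  "poly (map_poly complex_of_real (p + q)) s = poly (map_poly complex_of_real p) s + poly (map_poly complex_of_real q) s"
proof -
  interpret cp: map_poly_comm_ring_hom complex_of_real ..
  show "poly (map_poly complex_of_real (p * q)) s = poly (map_poly complex_of_real p) s * poly (map_poly complex_of_real q) s"
    "poly (map_poly complex_of_real (p + q)) s = poly (map_poly complex_of_real p) s + poly (map_poly complex_of_real q) s"
    by (simp_all add: cp.hom_mult cp.hom_add)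
qed

lemma poly_of_real_const [simp]: "poly (map_poly complex_of_real [:c:]) s = complex_of_real c"
  by (simp add: of_real_hom.map_poly_pCons_hom)

text \<open>The denominator in lowest terms divides every other one, so each representation whose
  denominator does not vanish at \<open>s\<close> may be used for evaluation. This is what makes
  evaluation compatible with sums and products.\<close>

lemma rat_eval_Fract:
  assumes q: "poly (map_poly complex_of_real q) s \<noteq> 0"
  shows "rat_regular (Fract p q) s"
    and "rat_eval (Fract p q) s = poly (map_poly complex_of_real p) s / poly (map_poly complex_of_real q) s"
proof -
  let ?a = "fst (quot_of_fract (Fract p q))" and ?b = "snd (quot_of_fract (Fract p q))"
  have q0: "q \<noteq> 0" using q by auto
  have "Fract ?a ?b = Fract p q" by simp
  then have eq: "?a * q = p * ?b" using q0 by (subst (asm) eq_fract) auto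
  then have "?b dvd ?a * q" by simp
  then have "?b dvd q" using coprime_quot_of_fract[of "Fract p q"] by (simp add: coprime_dvd_mult_right_iff coprime_commute)
  then obtain c where c: "q = ?b * c" by auto
  have "?a * (?b * c) = p * ?b" by (simp only: eq c[symmetric])
  then have "p * ?b = (?a * c) * ?b" by (simp only: mult_ac)
  then have p: "p = ?a * c" using mult_right_cancel[OF snd_quot_of_fract_nonzero] by blast
  have nz: "poly (map_poly complex_of_real ?b) s \<noteq> 0" "poly (map_poly complex_of_real c) s \<noteq> 0"
    using q poly_of_real_hom(1)[of ?b c s] by (auto simp flip: c)
  then show "rat_regular (Fract p q) s" by (simp add: rat_regular_def cdenom_def)
  show "rat_eval (Fract p q) s = poly (map_poly complex_of_real p) s / poly (map_poly complex_of_real q) s"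
    using nz poly_of_real_hom(1)[of ?b c s] poly_of_real_hom(1)[of ?a c s]
    by (simp add: rat_eval_def cdenom_def cnumer_def flip: c p)
qed

lemma rat_regular_Fract_rep:
  assumes "rat_regular g s"
  obtains p q where "g = Fract p q" "q \<noteq> 0" "poly (map_poly complex_of_real q) s \<noteq> 0"
    "rat_eval g s = poly (map_poly complex_of_real p) s / poly (map_poly complex_of_real q) s"
  using assms that[of "fst (quot_of_fract g)" "snd (quot_of_fract g)"]
  by (simp add: rat_regular_def rat_eval_def cnumer_def cdenom_def)

lemma rat_eval_mult:
  assumes "rat_regular g s" "rat_regular h s"
  shows "rat_regular (g * h) s" "rat_eval (g * h) s = rat_eval g s * rat_eval h s"
proof -
  obtain a b c d where *: "g = Fract a b" "b \<noteq> 0" "h = Fract c d" "d \<noteq> 0"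
    "poly (map_poly complex_of_real b) s \<noteq> 0" "poly (map_poly complex_of_real d) s \<noteq> 0"
    "rat_eval g s = poly (map_poly complex_of_real a) s / poly (map_poly complex_of_real b) s"
    "rat_eval h s = poly (map_poly complex_of_real c) s / poly (map_poly complex_of_real d) s"
    using rat_regular_Fract_rep[OF assms(1)] rat_regular_Fract_rep[OF assms(2)] by metis
  have nz: "poly (map_poly complex_of_real (b * d)) s \<noteq> 0" using * by (simp add: poly_of_real_hom)
  show "rat_regular (g * h) s" "rat_eval (g * h) s = rat_eval g s * rat_eval h s"
    using rat_eval_Fract[OF nz, of "a * c"] unfolding *(7,8)
    by (simp_all add: *(1,3) poly_of_real_hom)
qed

lemma rat_eval_add:
  assumes "rat_regular g s" "rat_regular h s"
  shows "rat_regular (g + h) s" "rat_eval (g + h) s = rat_eval g s + rat_eval h s"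
proof -
  obtain a b c d where *: "g = Fract a b" "b \<noteq> 0" "h = Fract c d" "d \<noteq> 0"
    "poly (map_poly complex_of_real b) s \<noteq> 0" "poly (map_poly complex_of_real d) s \<noteq> 0"
    "rat_eval g s = poly (map_poly complex_of_real a) s / poly (map_poly complex_of_real b) s"
    "rat_eval h s = poly (map_poly complex_of_real c) s / poly (map_poly complex_of_real d) s"
    using rat_regular_Fract_rep[OF assms(1)] rat_regular_Fract_rep[OF assms(2)] by metis
  have nz: "poly (map_poly complex_of_real (b * d)) s \<noteq> 0" using * by (simp add: poly_of_real_hom)
  show "rat_regular (g + h) s" "rat_eval (g + h) s = rat_eval g s + rat_eval h s"
    using rat_eval_Fract[OF nz, of "a * d + c * b"] *(2,4,5,6) unfolding *(7,8)
    by (simp_all add: *(1,3) poly_of_real_hom add_divide_distrib)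
qed

lemma rat_eval_to_fract [simp]:
  "rat_regular (to_fract p) s" "rat_eval (to_fract p) s = poly (map_poly complex_of_real p) s"
  using rat_eval_Fract[of 1 s p] by (simp_all add: Fract_conv_to_fract)

lemma rat_eval_sum:
  assumes "\<And>i. i \<in> I \<Longrightarrow> rat_regular (f i) s"
  shows "rat_regular (sum f I) s \<and> rat_eval (sum f I) s = (\<Sum>i\<in>I. rat_eval (f i) s)"
  using assms
proof (induction I rule: infinite_finite_induct)
  case (insert x I)
  then show ?case by (simp add: rat_eval_add)
qed (use rat_eval_to_fract[of 0] in simp_all)

definition mat_regular :: "tfm \<Rightarrow> complex \<Rightarrow> bool" where
  "mat_regular G s \<longleftrightarrow> (\<forall>i<dim_row G. \<forall>j<dim_col G. rat_regular (G $$ (i, j)) s)"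

lemma tf_pole_iff_not_regular: "tf_pole G s \<longleftrightarrow> \<not> mat_regular G s"
  by (auto simp: tf_pole_def mat_regular_def rat_regular_def)

lemma tf_eval_mult:
  assumes c: "G \<in> carrier_mat n k" "H \<in> carrier_mat k m" and r: "mat_regular G s" "mat_regular H s"
  shows "mat_regular (G * H) s" "tf_eval (G * H) s = tf_eval G s * tf_eval H s"
proof -
  have *: "rat_regular ((G * H) $$ (i, j)) s \<and>
      rat_eval ((G * H) $$ (i, j)) s = (\<Sum>l<k. rat_eval (G $$ (i, l)) s * rat_eval (H $$ (l, j)) s)"
    if ij: "i < n" "j < m" for i j
  proof -
    have "(G * H) $$ (i, j) = (\<Sum>l<k. G $$ (i, l) * H $$ (l, j))"
      using c ij by (simp add: scalar_prod_def atLeast0LessThan)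
    moreover have "rat_regular (G $$ (i, l) * H $$ (l, j)) s \<and>
        rat_eval (G $$ (i, l) * H $$ (l, j)) s = rat_eval (G $$ (i, l)) s * rat_eval (H $$ (l, j)) s" if "l < k" for l
      using c r ij that by (simp add: mat_regular_def rat_eval_mult)
    ultimately show ?thesis
      using rat_eval_sum[of "{..<k}" "\<lambda>l. G $$ (i, l) * H $$ (l, j)" s] by simp
  qed
  then show "mat_regular (G * H) s" using c by (simp add: mat_regular_def)
  show "tf_eval (G * H) s = tf_eval G s * tf_eval H s"
    using c * by (intro eq_matI) (simp_all add: tf_eval_alt scalar_prod_def atLeast0LessThan)
qed

lemma tf_eval_add:
  assumes c: "G \<in> carrier_mat n m" "H \<in> carrier_mat n m" and r: "mat_regular G s" "mat_regular H s"
  shows "mat_regular (G + H) s" "tf_eval (G + H) s = tf_eval G s + tf_eval H s"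
  using c r by (auto simp: mat_regular_def tf_eval_alt rat_eval_add intro!: eq_matI)

lemma tf_eval_rat_const [simp]: "mat_regular (rat_const A) s" "tf_eval (rat_const A) s = cmat A"
  by (auto simp: mat_regular_def rat_const_def tf_eval_alt intro!: eq_matI)

lemma rat_const_carrier: "A \<in> carrier_mat n m \<Longrightarrow> rat_const A \<in> carrier_mat n m"
  by (simp add: rat_const_def)

section \<open>Resolvents and state equations\<close>

definition rat_pencil :: "nat \<Rightarrow> real mat \<Rightarrow> tfm" where
  "rat_pencil n A = rat_s \<cdot>\<^sub>m 1\<^sub>m n - rat_const A"

lemma rat_pencil_carrier: "A \<in> carrier_mat n n \<Longrightarrow> rat_pencil n A \<in> carrier_mat n n"
  by (auto simp: rat_pencil_def rat_const_def)

text \<open>The link to the characteristic matrix: through it the determinant of the pencil is the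
  characteristic polynomial, and its adjugate has polynomial entries.\<close>

lemma rat_pencil_eq: "A \<in> carrier_mat n n \<Longrightarrow> rat_pencil n A = map_mat to_fract (char_poly_matrix A)"
  by (intro eq_matI) (auto simp: rat_pencil_def rat_const_def rat_s_def char_poly_matrix_def
      simp flip: to_fract_add to_fract_uminus to_fract_diff)

lemma tf_eval_rat_pencil:
  assumes "A \<in> carrier_mat n n"
  shows "mat_regular (rat_pencil n A) s" "tf_eval (rat_pencil n A) s = s \<cdot>\<^sub>m 1\<^sub>m n - cmat A"
proof -
  show "mat_regular (rat_pencil n A) s"
    using assms by (auto simp: rat_pencil_eq mat_regular_def)
  show "tf_eval (rat_pencil n A) s = s \<cdot>\<^sub>m 1\<^sub>m n - cmat A"
    using assms by (intro eq_matI) (auto simp: rat_pencil_eq tf_eval_alt char_poly_matrix_def poly_of_real_hom)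
qed

lemma det_rat_pencil:
  assumes "A \<in> carrier_mat n n"
  shows "det (rat_pencil n A) = to_fract (char_poly A)" "det (rat_pencil n A) \<noteq> 0"
proof -
  interpret tf: comm_ring_hom "to_fract :: real poly \<Rightarrow> real poly fract" by unfold_locales auto
  show 1: "det (rat_pencil n A) = to_fract (char_poly A)"
    unfolding rat_pencil_eq[OF assms] char_poly_def by (rule tf.hom_det)
  have "char_poly A \<noteq> 0" using degree_monic_char_poly[OF assms] by auto
  then show "det (rat_pencil n A) \<noteq> 0" by (simp add: 1)
qed

lemmas rat_resolvent = matinv[OF rat_pencil_carrier det_rat_pencil(2)]

text \<open>By Cramer's rule the inverse is the adjugate over the characteristic polynomial, so its
  entries can have poles only at eigenvalues of \<open>A\<close>.\<close>

lemma mat_regular_rat_resolvent: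
  assumes A: "A \<in> carrier_mat n n" and s: "poly (char_poly (cmat A)) s \<noteq> 0"
  shows "mat_regular (matinv (rat_pencil n A)) s"
proof -
  interpret tf: comm_ring_hom "to_fract :: real poly \<Rightarrow> real poly fract" by unfold_locales auto
  let ?M = "char_poly_matrix A" and ?R = "rat_pencil n A"
  note M = char_poly_matrix_closed[OF A]
  note adj = adj_mat[OF M, folded char_poly_def]
  have chi: "poly (map_poly complex_of_real (char_poly A)) s \<noteq> 0"
    using s by (simp add: of_real_hom.char_poly_hom[OF A])
  have c0: "to_fract (char_poly A) \<noteq> 0" using det_rat_pencil[OF A] by simp
  define N where "N = map_mat (\<lambda>p. Fract p (char_poly A)) (adj_mat ?M)"
  have N: "N \<in> carrier_mat n n" using adj(1) by (simp add: N_def)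
  have "N = (1 / to_fract (char_poly A)) \<cdot>\<^sub>m map_mat to_fract (adj_mat ?M)"
    by (intro eq_matI) (auto simp: N_def Fract_conv_to_fract)
  moreover have "?R * map_mat to_fract (adj_mat ?M) = to_fract (char_poly A) \<cdot>\<^sub>m 1\<^sub>m n"
    unfolding rat_pencil_eq[OF A] tf.mat_hom_mult[OF M adj(1), symmetric] adj(2)
    by (intro eq_matI) auto
  ultimately have "?R * N = (1 / to_fract (char_poly A)) \<cdot>\<^sub>m (to_fract (char_poly A) \<cdot>\<^sub>m 1\<^sub>m n)"
    using mult_smult_distrib[OF rat_pencil_carrier[OF A], of "map_mat to_fract (adj_mat ?M)" n] adj(1) by simp
  also have "\<dots> = 1\<^sub>m n" using c0 by (intro eq_matI) auto
  finally have RN: "?R * N = 1\<^sub>m n" .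
  have "matinv ?R = matinv ?R * (?R * N)" unfolding RN using rat_resolvent(1)[OF A A] by simp
  also have "\<dots> = N" using rat_resolvent[OF A A] N rat_pencil_carrier[OF A]
    by (simp flip: assoc_mult_mat[of _ n n _ n _ n])
  finally show ?thesis
    using chi by (auto simp: N_def mat_regular_def rat_eval_Fract)
qed

lemma resolvent_unique:
  fixes A :: "complex mat"
  assumes A: "A \<in> carrier_mat n n" "poly (char_poly A) s \<noteq> 0"
    and x: "x \<in> carrier_vec n" "y \<in> carrier_vec n"
    and eq: "s \<cdot>\<^sub>v x = A *\<^sub>v x + b" "s \<cdot>\<^sub>v y = A *\<^sub>v y + b" "b \<in> carrier_vec n"
  shows "x = y"
proof -
  have "A *\<^sub>v (x - y) = s \<cdot>\<^sub>v (x - y)"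
  proof -
    have "A *\<^sub>v (x - y) = A *\<^sub>v x - A *\<^sub>v y" using A x by (simp add: mult_minus_distrib_mat_vec[of _ n n])
    also have "\<dots> = s \<cdot>\<^sub>v (x - y)"
    proof (intro eq_vecI)
      fix i assume i: "i < dim_vec (s \<cdot>\<^sub>v (x - y))"
      then have "(s \<cdot>\<^sub>v x) $ i = (A *\<^sub>v x + b) $ i" "(s \<cdot>\<^sub>v y) $ i = (A *\<^sub>v y + b) $ i" using eq by simp_all
      then show "(A *\<^sub>v x - A *\<^sub>v y) $ i = (s \<cdot>\<^sub>v (x - y)) $ i"
        using i x A eq(3) by (simp add: algebra_simps)
    qed (use A x in auto)
    finally show ?thesis .
  qed
  moreover have "\<not> eigenvalue A s" using eigenvalue_root_char_poly[OF A(1)] A(2) by simp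
  moreover have "x - y \<in> carrier_vec n" using x by simp
  ultimately have "x - y = 0\<^sub>v n"
    using A(1) by (auto simp: eigenvalue_def eigenvector_def)
  then have "(x - y) $ i = 0" if "i < n" for i using that by simp
  then show ?thesis using x by (intro eq_vecI) auto
qed

text \<open>The bridge from rational matrices to state equations. Evaluating
  \<open>(s I - A) N = I\<close> at \<open>s\<close> shows that \<open>N(s) B w\<close> solves the
  state equation, and off the spectrum of \<open>A\<close> the solution is unique. Later arguments
  about values of \<open>G\<close> go through the state \<open>x\<close>.\<close>

theorem tf_eval_realization:
  assumes R: "realization m n A B C D G" and s: "poly (char_poly (cmat A)) s \<noteq> 0"
  shows "mat_regular G s"
    and "x \<in> carrier_vec n \<Longrightarrow> w \<in> carrier_vec m \<Longrightarrow> s \<cdot>\<^sub>v x = cmat A *\<^sub>v x + cmat B *\<^sub>v w \<Longrightarrow>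
      tf_eval G s *\<^sub>v w = cmat C *\<^sub>v x + cmat D *\<^sub>v w"
proof -
  have c: "A \<in> carrier_mat n n" "B \<in> carrier_mat n m" "C \<in> carrier_mat m n" "D \<in> carrier_mat m m"
    and G: "G = rat_const C * matinv (rat_pencil n A) * rat_const B + rat_const D"
    using R by (auto simp: realization_def rat_pencil_def)
  let ?N = "matinv (rat_pencil n A)" and ?n = "tf_eval (matinv (rat_pencil n A)) s"
  note N = rat_resolvent[OF c(1) c(1)] and rc = rat_const_carrier[OF c(2)] rat_const_carrier[OF c(3)] rat_const_carrier[OF c(4)]
  note rN = mat_regular_rat_resolvent[OF c(1) s]
  have n: "?n \<in> carrier_mat n n" using N(1) by (simp add: tf_eval_def)
  note CN = tf_eval_mult[OF rc(2) N(1) _ rN, simplified]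
  note CNB = tf_eval_mult[OF mult_carrier_mat[OF rc(2) N(1)] rc(1) CN(1), simplified]
  note CNBD = tf_eval_add[OF mult_carrier_mat[OF mult_carrier_mat[OF rc(2) N(1)] rc(1)] rc(3) CNB(1), simplified]
  show "mat_regular G s" unfolding G by (rule CNBD(1))
  have Gs: "tf_eval G s = cmat C * ?n * cmat B + cmat D"
    unfolding G CNBD(2) CNB(2) CN(2) by simp
  have "tf_eval (rat_pencil n A * ?N) s = (s \<cdot>\<^sub>m 1\<^sub>m n - cmat A) * ?n"
    using tf_eval_mult(2)[OF rat_pencil_carrier[OF c(1)] N(1) tf_eval_rat_pencil(1)[OF c(1)] rN]
    by (simp add: tf_eval_rat_pencil(2)[OF c(1)])
  moreover have "tf_eval (1\<^sub>m n) s = 1\<^sub>m n"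
    using rat_eval_to_fract(2)[of 0 s] rat_eval_to_fract(2)[of 1 s]
    by (intro eq_matI) (auto simp: tf_eval_alt)
  ultimately have inv: "(s \<cdot>\<^sub>m 1\<^sub>m n - cmat A) * ?n = 1\<^sub>m n" by (simp add: N(2))
  assume x: "x \<in> carrier_vec n" and w: "w \<in> carrier_vec m" and eq: "s \<cdot>\<^sub>v x = cmat A *\<^sub>v x + cmat B *\<^sub>v w"
  let ?b = "cmat B *\<^sub>v w" and ?y = "?n *\<^sub>v (cmat B *\<^sub>v w)"
  have b: "?b \<in> carrier_vec n" using c w by simp
  have y: "?y \<in> carrier_vec n" using n b by simp
  have cA: "cmat A \<in> carrier_mat n n" using c by simp
  have "((s \<cdot>\<^sub>m 1\<^sub>m n - cmat A) * ?n) *\<^sub>v ?b = (s \<cdot>\<^sub>m 1\<^sub>m n - cmat A) *\<^sub>v ?y"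
    using n b cA by (intro assoc_mult_mat_vec[of _ n n _ n]) auto
  also have "\<dots> = (s \<cdot>\<^sub>m 1\<^sub>m n) *\<^sub>v ?y - cmat A *\<^sub>v ?y"
    using y cA by (intro minus_mult_distrib_mat_vec[of _ n n]) auto
  also have "(s \<cdot>\<^sub>m 1\<^sub>m n) *\<^sub>v v = s \<cdot>\<^sub>v v" if "v \<in> carrier_vec n" for v
    using that by (intro eq_vecI) auto
  note this[OF y]
  finally have *: "?b = s \<cdot>\<^sub>v ?y - cmat A *\<^sub>v ?y" unfolding inv using b by simp
  have "s \<cdot>\<^sub>v ?y = cmat A *\<^sub>v ?y + ?b"
  proof (intro eq_vecI)
    fix i assume "i < dim_vec (cmat A *\<^sub>v ?y + ?b)"
    then have i: "i < n" using c by simp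
    have "?b $ i = (s \<cdot>\<^sub>v ?y - cmat A *\<^sub>v ?y) $ i" using * by simp
    then show "(s \<cdot>\<^sub>v ?y) $ i = (cmat A *\<^sub>v ?y + ?b) $ i" using i carrier_vecD[OF b] carrier_vecD[OF y] c by simp
  qed (use n c in auto)
  then have "x = ?y" using resolvent_unique[OF cA s x y eq _ b] by simp
  have "tf_eval G s *\<^sub>v w = (cmat C * ?n * cmat B) *\<^sub>v w + cmat D *\<^sub>v w"
    unfolding Gs using c n w by (intro add_mult_distrib_mat_vec[of _ m m]) auto
  also have "(cmat C * ?n * cmat B) *\<^sub>v w = (cmat C * ?n) *\<^sub>v ?b"
    using c n w by (intro assoc_mult_mat_vec[of _ m n _ m]) auto
  also have "\<dots> = cmat C *\<^sub>v ?y"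
    using c n b by (intro assoc_mult_mat_vec[of _ m n _ n]) auto
  finally show "tf_eval G s *\<^sub>v w = cmat C *\<^sub>v x + cmat D *\<^sub>v w" by (simp add: \<open>x = ?y\<close>)
qed

text \<open>Comparing degrees in \<open>s p = A p + \<chi> b\<close> shows that \<open>p\<close> has lower degree than \<open>\<chi>\<close>.\<close>

lemma resolvent_numerator:
  fixes A :: "complex mat"
  assumes A: "A \<in> carrier_mat n n" and b: "b \<in> carrier_vec n"
  shows "\<exists>p. (\<forall>i<n. p i = 0 \<or> degree (p i) < n) \<and>
    (\<forall>s. s \<cdot>\<^sub>v vec n (\<lambda>i. poly (p i) s) = A *\<^sub>v vec n (\<lambda>i. poly (p i) s) + poly (char_poly A) s \<cdot>\<^sub>v b)"
proof -
  let ?M = "char_poly_matrix A"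
  note M = char_poly_matrix_closed[OF A]
  note adj = adj_mat[OF M, folded char_poly_def]
  define bp where "bp = map_vec (\<lambda>c. [:c:]) b"
  define pv where "pv = adj_mat ?M *\<^sub>v bp"
  define p where "p = (\<lambda>i. pv $ i)"
  have bp: "bp \<in> carrier_vec n" using b by (simp add: bp_def)
  have pv: "pv \<in> carrier_vec n" using adj(1) bp by (simp add: pv_def)
  have "?M *\<^sub>v pv = (char_poly A \<cdot>\<^sub>m 1\<^sub>m n) *\<^sub>v bp"
    unfolding pv_def using assoc_mult_mat_vec[OF M adj(1) bp] adj(2) by simp
  also have "\<dots> = char_poly A \<cdot>\<^sub>v bp" using bp by (intro eq_vecI) auto
  finally have Mp: "?M *\<^sub>v pv = char_poly A \<cdot>\<^sub>v bp" .
  have eq: "[:0, 1:] * p i = (\<Sum>j<n. Polynomial.smult (A $$ (i, j)) (p j)) + Polynomial.smult (b $ i) (char_poly A)"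
    if i: "i < n" for i
  proof -
    have "(?M *\<^sub>v pv) $ i = (\<Sum>j<n. ?M $$ (i, j) * p j)"
      using i M pv by (simp add: scalar_prod_def atLeast0LessThan p_def)
    also have "\<dots> = (\<Sum>j<n. (if j = i then [:0, 1:] * p i else 0) - Polynomial.smult (A $$ (i, j)) (p j))"
      using i A by (intro sum.cong) (auto simp: char_poly_matrix_def algebra_simps)
    also have "\<dots> = [:0, 1:] * p i - (\<Sum>j<n. Polynomial.smult (A $$ (i, j)) (p j))"
      using i by (simp only: sum_subtractf) simp
    finally show ?thesis using i b by (simp add: Mp bp_def algebra_simps)
  qed
  have chi: "degree (char_poly A) = n" using degree_monic_char_poly[OF A] by simp
  have deg: "p i = 0 \<or> degree (p i) < n" if i: "i < n" for i
  proof (rule ccontr)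
    assume "\<not> (p i = 0 \<or> degree (p i) < n)"
    \<comment> \<open>At an index \<open>k\<close> of maximal degree \<open>d \<ge> n\<close> the
      left side of \<open>eq\<close> has degree \<open>d + 1\<close>, the right side at most
      \<open>d\<close>.\<close>
    define d where "d = Max ((\<lambda>i. degree (p i)) ` {..<n})"
    have dle: "degree (p j) \<le> d" if "j < n" for j using that by (auto simp: d_def)
    have dn: "n \<le> d" using dle[OF i] \<open>\<not> _\<close> by simp
    have "d \<in> (\<lambda>i. degree (p i)) ` {..<n}" unfolding d_def using i by (intro Max_in) auto
    then obtain k where k: "k < n" "d = degree (p k)" by auto
    have "p k \<noteq> 0" using i dn k by auto
    then have "degree ([:0, 1:] * p k) = Suc d" using k by (subst degree_mult_eq) auto
    moreover have "degree ([:0, 1:] * p k) \<le> d"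
      unfolding eq[OF k(1)] using dle dn chi
      by (intro degree_add_le degree_sum_le) (auto intro: order_trans[OF degree_smult_le])
    ultimately show False by simp
  qed
  have "s \<cdot>\<^sub>v vec n (\<lambda>i. poly (p i) s) = A *\<^sub>v vec n (\<lambda>i. poly (p i) s) + poly (char_poly A) s \<cdot>\<^sub>v b" for s
  proof (intro eq_vecI)
    fix i assume "i < dim_vec (A *\<^sub>v vec n (\<lambda>i. poly (p i) s) + poly (char_poly A) s \<cdot>\<^sub>v b)"
    then have i: "i < n" using b by simp
    show "(s \<cdot>\<^sub>v vec n (\<lambda>i. poly (p i) s)) $ i = (A *\<^sub>v vec n (\<lambda>i. poly (p i) s) + poly (char_poly A) s \<cdot>\<^sub>v b) $ i"
      using arg_cong[OF eq[OF i], of "\<lambda>q. poly q s"] i A b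
      by (simp add: scalar_prod_def atLeast0LessThan poly_sum mult.commute)
  qed (use A b in auto)
  with deg show ?thesis by blast
qed

lemma resolvent_exists:
  fixes A :: "complex mat"
  assumes A: "A \<in> carrier_mat n n" "poly (char_poly A) s \<noteq> 0" and b: "b \<in> carrier_vec n"
  shows "\<exists>x\<in>carrier_vec n. s \<cdot>\<^sub>v x = A *\<^sub>v x + b"
proof -
  obtain p where p: "s \<cdot>\<^sub>v vec n (\<lambda>i. poly (p i) s) = A *\<^sub>v vec n (\<lambda>i. poly (p i) s) + poly (char_poly A) s \<cdot>\<^sub>v b"
    using resolvent_numerator[OF A(1) b] by blast
  let ?y = "vec n (\<lambda>i. poly (p i) s)" and ?c = "poly (char_poly A) s"
  have "s \<cdot>\<^sub>v ((1 / ?c) \<cdot>\<^sub>v ?y) = A *\<^sub>v ((1 / ?c) \<cdot>\<^sub>v ?y) + b"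
  proof (intro eq_vecI)
    fix i assume "i < dim_vec (A *\<^sub>v ((1 / ?c) \<cdot>\<^sub>v ?y) + b)"
    then have i: "i < n" using b by simp
    then show "(s \<cdot>\<^sub>v ((1 / ?c) \<cdot>\<^sub>v ?y)) $ i = (A *\<^sub>v ((1 / ?c) \<cdot>\<^sub>v ?y) + b) $ i"
      using arg_cong[OF p, of "\<lambda>v. v $ i / ?c"] A b
      by (simp add: mult_mat_vec[of A n n] add_divide_distrib del: index_mult_mat_vec)
  qed (use A b in auto)
  then show ?thesis by (intro bexI[of _ "(1 / ?c) \<cdot>\<^sub>v ?y"]) auto
qed

text \<open>A linear functional of the resolvent is one strictly proper rational function of
  \<open>s\<close>, which is the shape that the half plane principle accepts. The alternative
  \<open>P = 0\<close> is listed separately because the dimension \<open>n\<close> may be 0.\<close>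

lemma resolvent_form_numerator:
  fixes A :: "complex mat"
  assumes A: "A \<in> carrier_mat n n" and b: "b \<in> carrier_vec n" and c: "c \<in> carrier_vec n"
  shows "\<exists>P. (P = 0 \<or> degree P < n) \<and>
    (\<forall>s x. poly (char_poly A) s \<noteq> 0 \<longrightarrow> x \<in> carrier_vec n \<longrightarrow> s \<cdot>\<^sub>v x = A *\<^sub>v x + b \<longrightarrow>
      x \<bullet>c c = poly P s / poly (char_poly A) s)"
proof -
  obtain p where p: "\<And>i. i < n \<Longrightarrow> p i = 0 \<or> degree (p i) < n"
    "\<And>s. s \<cdot>\<^sub>v vec n (\<lambda>i. poly (p i) s) = A *\<^sub>v vec n (\<lambda>i. poly (p i) s) + poly (char_poly A) s \<cdot>\<^sub>v b"
    using resolvent_numerator[OF A b] by blast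
  define P where "P = (\<Sum>i<n. Polynomial.smult (cnj (c $ i)) (p i))"
  have "P = 0 \<or> degree P < n"
  proof (cases "n = 0")
    case False
    have "degree (p i) \<le> n - 1" if "i < n" for i using p(1)[OF that] by auto
    then have "degree P \<le> n - 1" unfolding P_def
      by (intro degree_sum_le) (auto intro: order_trans[OF degree_smult_le])
    then show ?thesis using False by auto
  qed (simp add: P_def)
  moreover have "x \<bullet>c c = poly P s / poly (char_poly A) s"
    if s: "poly (char_poly A) s \<noteq> 0" and x: "x \<in> carrier_vec n" and eq: "s \<cdot>\<^sub>v x = A *\<^sub>v x + b" for s x
  proof -
    let ?y = "vec n (\<lambda>i. poly (p i) s)" and ?c = "poly (char_poly A) s"
    have "s \<cdot>\<^sub>v (?c \<cdot>\<^sub>v x) = A *\<^sub>v (?c \<cdot>\<^sub>v x) + ?c \<cdot>\<^sub>v b"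
    proof (intro eq_vecI)
      fix i assume "i < dim_vec (A *\<^sub>v (?c \<cdot>\<^sub>v x) + ?c \<cdot>\<^sub>v b)"
      then have i: "i < n" using b by simp
      then show "(s \<cdot>\<^sub>v (?c \<cdot>\<^sub>v x)) $ i = (A *\<^sub>v (?c \<cdot>\<^sub>v x) + ?c \<cdot>\<^sub>v b) $ i"
        using arg_cong[OF eq, of "\<lambda>v. ?c * v $ i"] A b x
        by (simp add: mult_mat_vec[of A n n] algebra_simps del: index_mult_mat_vec)
    qed (use A b x in auto)
    then have "?c \<cdot>\<^sub>v x = ?y"
      using resolvent_unique[OF A s, of "?c \<cdot>\<^sub>v x" ?y "?c \<cdot>\<^sub>v b"] p(2)[of s] x b by simp
    then have "?y \<bullet>c c = ?c * (x \<bullet>c c)" using cinner_smult_left[OF x c, of ?c] by simp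
    moreover have "?y \<bullet>c c = poly P s"
      using c by (simp add: cinner_sum P_def poly_sum mult.commute)
    ultimately show ?thesis using s by (simp add: field_simps)
  qed
  ultimately show ?thesis by blast
qed

section \<open>Minimal realizations\<close>

text \<open>Padding with zero rows gives a singular square matrix: row \<open>n\<close> is one of
  them, so the transpose kills \<open>unit_vec k n\<close>.\<close>

lemma mult_mat_vec_append_zero:
  fixes M :: "real mat"
  assumes "M \<in> carrier_mat n k" "n < k"
  shows "\<exists>y. y \<in> carrier_vec k \<and> y \<noteq> 0\<^sub>v k \<and> M *\<^sub>v y = 0\<^sub>v n"
proof -
  define N where "N = mat k k (\<lambda>(i, j). if i < n then M $$ (i, j) else 0)"
  have N: "N \<in> carrier_mat k k" by (simp add: N_def)
  have "transpose_mat N *\<^sub>v unit_vec k n = 0\<^sub>v k"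
    using assms by (intro eq_vecI) (auto simp: N_def scalar_prod_right_unit)
  moreover have "unit_vec k n \<noteq> (0\<^sub>v k :: real vec)" using assms(2) by simp
  ultimately have "det (transpose_mat N) = 0"
    using det_0_iff_vec_prod_zero_field[of "transpose_mat N" k] N by (metis transpose_carrier_mat unit_vec_carrier)
  then have "det N = 0" using det_transpose[OF N] by simp
  then obtain y where y: "y \<in> carrier_vec k" "y \<noteq> 0\<^sub>v k" "N *\<^sub>v y = 0\<^sub>v k"
    using det_0_iff_vec_prod_zero_field[OF N] by blast
  have "(M *\<^sub>v y) $ i = 0" if i: "i < n" for i
  proof -
    have "(M *\<^sub>v y) $ i = (N *\<^sub>v y) $ i"
      using i assms y(1) by (simp add: N_def scalar_prod_def)
    then show ?thesis using y(3) i assms by simp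
  qed
  then have "M *\<^sub>v y = 0\<^sub>v n" using assms by (intro eq_vecI) auto
  with y show ?thesis by blast
qed

text \<open>The rows of \<open>\<Psi>\<close> are a basis of the real vectors \<open>w\<close> with \<open>w\<^sup>T v = 0\<close>.\<close>

lemma real_annihilator_basis:
  fixes v :: "complex vec"
  assumes v: "v \<in> carrier_vec n" "v \<noteq> 0\<^sub>v n"
  shows "\<exists>k \<Psi>. k < n \<and> \<Psi> \<in> carrier_mat k n \<and> cmat \<Psi> *\<^sub>v v = 0\<^sub>v k \<and>
    (\<forall>l M. M \<in> carrier_mat l n \<longrightarrow> cmat M *\<^sub>v v = 0\<^sub>v l \<longrightarrow> (\<exists>N\<in>carrier_mat l k. M = N * \<Psi>))"
proof -
  \<comment> \<open>Independent real rows that annihilate the complex vector \<open>v\<close>, a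
    maximal family of which is taken. They have to be real because they will serve to reduce a real
    realization.\<close>
  define good where "good = (\<lambda>k \<Psi>. \<Psi> \<in> carrier_mat k n \<and> cmat \<Psi> *\<^sub>v v = 0\<^sub>v k \<and>
    (\<forall>y\<in>carrier_vec k. transpose_mat \<Psi> *\<^sub>v y = 0\<^sub>v n \<longrightarrow> y = 0\<^sub>v k))"
  have le: "k \<le> n" if "good k \<Psi>" for k \<Psi>
    using mult_mat_vec_append_zero[of "transpose_mat \<Psi>" n k] that by (force simp: good_def)
  have "good 0 (0\<^sub>m 0 n)" using v by (auto simp: good_def)
  then have ex: "\<exists>k. \<exists>\<Psi>. good k \<Psi>" by blast
  define k where "k = (GREATEST k. \<exists>\<Psi>. good k \<Psi>)"
  have "\<exists>\<Psi>. good k \<Psi>" unfolding k_def by (rule GreatestI_ex_nat[OF ex, of n]) (use le in blast)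
  then obtain \<Psi> where g: "good k \<Psi>" by blast
  have max: "j \<le> k" if "good j \<Psi>'" for j \<Psi>'
    unfolding k_def by (rule Greatest_le_nat[of _ _ n]) (use that le in blast)+
  have P: "\<Psi> \<in> carrier_mat k n" "cmat \<Psi> *\<^sub>v v = 0\<^sub>v k"
    and inj: "\<And>y. y \<in> carrier_vec k \<Longrightarrow> transpose_mat \<Psi> *\<^sub>v y = 0\<^sub>v n \<Longrightarrow> y = 0\<^sub>v k"
    using g by (auto simp: good_def)
  \<comment> \<open>With \<open>n\<close> independent rows \<open>\<Psi>\<close> would be invertible
    and could not kill \<open>v\<close>.\<close>
  have "k \<noteq> n"
  proof
    assume kn: "k = n"
    have "det (transpose_mat \<Psi>) \<noteq> 0"
      using det_0_iff_vec_prod_zero_field[of "transpose_mat \<Psi>" n] P(1) inj by (auto simp: kn)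
    then have "det (cmat \<Psi>) \<noteq> 0" using det_transpose[of \<Psi> n] P(1) by (simp add: kn of_real_hom.hom_det)
    then show False
      using det_0_iff_vec_prod_zero_field[of "cmat \<Psi>" n] P v by (auto simp: kn)
  qed
  then have "k < n" using le[OF g] by simp
  have span: "\<exists>y\<in>carrier_vec k. w = transpose_mat \<Psi> *\<^sub>v y"
    if w: "w \<in> carrier_vec n" "(\<Sum>j<n. complex_of_real (w $ j) * v $ j) = 0" for w
  proof -
    \<comment> \<open>By maximality, appending \<open>w\<close> as a last row destroys independence.
      In the resulting relation \<open>z\<close> the coefficient of \<open>w\<close> cannot vanish,
      since the old rows are independent; so \<open>w\<close> is a combination of them.\<close>
    define \<Psi>' where "\<Psi>' = mat (Suc k) n (\<lambda>(i, j). if i < k then \<Psi> $$ (i, j) else w $ j)"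
    have P': "\<Psi>' \<in> carrier_mat (Suc k) n" by (simp add: \<Psi>'_def)
    have "(cmat \<Psi>' *\<^sub>v v) $ i = 0" if i: "i < Suc k" for i
    proof (cases "i < k")
      case True
      have "(cmat \<Psi>' *\<^sub>v v) $ i = (cmat \<Psi> *\<^sub>v v) $ i"
        using True P(1) v(1) by (simp add: \<Psi>'_def scalar_prod_def)
      then show ?thesis using P(2) True by simp
    next
      case False
      then show ?thesis using i v(1) w(2) by (simp add: \<Psi>'_def scalar_prod_def atLeast0LessThan)
    qed
    then have "cmat \<Psi>' *\<^sub>v v = 0\<^sub>v (Suc k)" using P' by (intro eq_vecI) auto
    moreover have "\<not> good (Suc k) \<Psi>'" using max[of "Suc k" \<Psi>'] by auto
    ultimately obtain z where z: "z \<in> carrier_vec (Suc k)" "transpose_mat \<Psi>' *\<^sub>v z = 0\<^sub>v n" "z \<noteq> 0\<^sub>v (Suc k)"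
      using P' by (auto simp: good_def)
    define y where "y = vec k (\<lambda>i. z $ i)"
    have zk: "(transpose_mat \<Psi> *\<^sub>v y) $ j + z $ k * w $ j = 0" if j: "j < n" for j
    proof -
      have "(transpose_mat \<Psi>' *\<^sub>v z) $ j = (\<Sum>i<k. \<Psi> $$ (i, j) * z $ i) + w $ j * z $ k"
        using j z(1) P(1) by (simp add: \<Psi>'_def scalar_prod_def atLeast0LessThan)
      moreover have "(transpose_mat \<Psi> *\<^sub>v y) $ j = (\<Sum>i<k. \<Psi> $$ (i, j) * z $ i)"
        using j P(1) by (simp add: y_def scalar_prod_def atLeast0LessThan)
      ultimately show ?thesis using z(2) j by (simp add: mult.commute)
    qed
    have "z $ k \<noteq> 0"
    proof
      assume "z $ k = 0"
      then have "transpose_mat \<Psi> *\<^sub>v y = 0\<^sub>v n" using zk P(1) by (intro eq_vecI) auto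
      then have y0: "y = 0\<^sub>v k" using inj[of y] by (simp add: y_def)
      have "z $ i = 0" if "i < Suc k" for i
        using arg_cong[OF y0, of "\<lambda>v. v $ i"] that \<open>z $ k = 0\<close> by (cases "i = k") (auto simp: y_def)
      then show False using z by (metis carrier_vecD eq_vecI index_zero_vec)
    qed
    then have "w = transpose_mat \<Psi> *\<^sub>v ((- 1 / z $ k) \<cdot>\<^sub>v y)"
    proof (intro eq_vecI)
      fix j assume "j < dim_vec (transpose_mat \<Psi> *\<^sub>v ((- 1 / z $ k) \<cdot>\<^sub>v y))"
      then have j: "j < n" using P(1) by simp
      have "(transpose_mat \<Psi> *\<^sub>v ((- 1 / z $ k) \<cdot>\<^sub>v y)) $ j = (- 1 / z $ k) * (transpose_mat \<Psi> *\<^sub>v y) $ j"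
        using j P(1) by (subst mult_mat_vec[of _ n k]) (auto simp: y_def)
      also have "\<dots> = w $ j" using zk[OF j] \<open>z $ k \<noteq> 0\<close> by (simp add: field_simps)
      finally show "w $ j = (transpose_mat \<Psi> *\<^sub>v ((- 1 / z $ k) \<cdot>\<^sub>v y)) $ j" by simp
    qed (use w P in auto)
    then show ?thesis by (intro bexI[of _ "(- 1 / z $ k) \<cdot>\<^sub>v y"]) (auto simp: y_def)
  qed
  have "\<exists>N\<in>carrier_mat l k. M = N * \<Psi>" if M: "M \<in> carrier_mat l n" "cmat M *\<^sub>v v = 0\<^sub>v l" for l M
  proof -
    have "\<exists>y\<in>carrier_vec k. row M i = transpose_mat \<Psi> *\<^sub>v y" if i: "i < l" for i
    proof (rule span)
      show "row M i \<in> carrier_vec n" using M i by auto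
      have "(cmat M *\<^sub>v v) $ i = (\<Sum>j<n. complex_of_real (row M i $ j) * v $ j)"
        using M(1) i v(1) by (simp add: scalar_prod_def atLeast0LessThan)
      then show "(\<Sum>j<n. complex_of_real (row M i $ j) * v $ j) = 0" using M(2) i by simp
    qed
    then obtain y where y: "\<And>i. i < l \<Longrightarrow> y i \<in> carrier_vec k \<and> row M i = transpose_mat \<Psi> *\<^sub>v y i" by metis
    define N where "N = mat l k (\<lambda>(i, j). y i $ j)"
    have "M $$ (i, j) = (N * \<Psi>) $$ (i, j)" if ij: "i < l" "j < n" for i j
    proof -
      have "M $$ (i, j) = (transpose_mat \<Psi> *\<^sub>v y i) $ j" using y[OF ij(1)] M(1) ij by (metis carrier_matD index_row(1))
      moreover have "dim_vec (y i) = k" using y[OF ij(1)] by auto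
      ultimately show ?thesis
        using P(1) ij by (auto simp: N_def scalar_prod_def mult.commute intro!: sum.cong)
    qed
    then show ?thesis using M(1) P(1) by (intro bexI[of _ N] eq_matI) (auto simp: N_def)
  qed
  with \<open>k < n\<close> P show ?thesis by blast
qed

lemma rat_const_mult:
  assumes "A \<in> carrier_mat n k" "B \<in> carrier_mat k m"
  shows "rat_const (A * B) = rat_const A * rat_const B"
proof (intro eq_matI)
  fix i j assume "i < dim_row (rat_const A * rat_const B)" "j < dim_col (rat_const A * rat_const B)"
  then have ij: "i < n" "j < m" using assms by (auto simp: rat_const_def)
  have "[:\<Sum>l<k. A $$ (i, l) * B $$ (l, j):] = (\<Sum>l<k. [:A $$ (i, l):] * [:B $$ (l, j):])"
    by (simp add: mult.commute flip: sum_to_poly)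
  then show "rat_const (A * B) $$ (i, j) = (rat_const A * rat_const B) $$ (i, j)"
    using ij assms by (simp add: rat_const_def scalar_prod_def atLeast0LessThan flip: to_fract_mult)
qed (use assms in \<open>auto simp: rat_const_def\<close>)

text \<open>The eigenvector test for observability. For an unobservable eigenvector \<open>v\<close>
  the row space of \<open>\<Psi>\<close> is invariant under \<open>A\<close> and contains the rows
  of \<open>C\<close>. Hence \<open>\<Psi> A = A2 \<Psi>\<close> and \<open>C = C2 \<Psi>\<close>,
  and passing to the state \<open>\<Psi> x\<close> gives a realization of dimension
  \<open>k < n\<close>.\<close>

lemma minimal_realization_observable:
  assumes min: "minimal_realization m n A B C D G"
    and v: "v \<in> carrier_vec n" "cmat A *\<^sub>v v = l \<cdot>\<^sub>v v" "cmat C *\<^sub>v v = 0\<^sub>v m"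
  shows "v = 0\<^sub>v n"
proof (rule ccontr)
  assume "v \<noteq> 0\<^sub>v n"
  from real_annihilator_basis[OF v(1) this] obtain k \<Psi> where k: "k < n" and P: "\<Psi> \<in> carrier_mat k n"
    "cmat \<Psi> *\<^sub>v v = 0\<^sub>v k"
    and fac: "\<And>l M. M \<in> carrier_mat l n \<Longrightarrow> cmat M *\<^sub>v v = 0\<^sub>v l \<Longrightarrow> \<exists>N\<in>carrier_mat l k. M = N * \<Psi>"
    by blast
  have c: "A \<in> carrier_mat n n" "B \<in> carrier_mat n m" "C \<in> carrier_mat m n" "D \<in> carrier_mat m m"
    and G: "G = rat_const C * matinv (rat_pencil n A) * rat_const B + rat_const D"
    using min by (auto simp: minimal_realization_def realization_def rat_pencil_def)
  have least: "n \<le> n'" if "realization m n' A' B' C' D' G" for n' A' B' C' D'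
    using min that unfolding minimal_realization_def by blast
  obtain C2 where C2: "C2 \<in> carrier_mat m k" "C = C2 * \<Psi>" using fac[OF c(3) v(3)] by blast
  have "cmat (\<Psi> * A) *\<^sub>v v = cmat \<Psi> *\<^sub>v (cmat A *\<^sub>v v)"
    using P(1) c v(1) by (subst of_real_hom.mat_hom_mult[OF P(1) c(1)]) (simp add: assoc_mult_mat_vec[of _ k n _ n])
  also have "\<dots> = 0\<^sub>v k"
    unfolding v(2) using P v(1) by (subst mult_mat_vec[of _ k n]) auto
  finally obtain A2 where A2: "A2 \<in> carrier_mat k k" "\<Psi> * A = A2 * \<Psi>"
    using fac[of "\<Psi> * A" k] P(1) c by auto
  let ?R = "rat_pencil n A" and ?R2 = "rat_pencil k A2" and ?P = "rat_const \<Psi>"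
  note R = rat_pencil_carrier[OF c(1)] and R2 = rat_pencil_carrier[OF A2(1)] and rP = rat_const_carrier[OF P(1)]
  note inv = rat_resolvent[OF c(1) c(1)] and inv2 = rat_resolvent[OF A2(1) A2(1)]
  note rc = rat_const_carrier[OF c(1)] rat_const_carrier[OF c(2)] rat_const_carrier[OF C2(1)] rat_const_carrier[OF A2(1)]
  have "?P * ?R = ?P * (rat_s \<cdot>\<^sub>m 1\<^sub>m n) - ?P * rat_const A"
    unfolding rat_pencil_def using rP rc by (intro mult_minus_distrib_mat[of _ k n _ n]) auto
  also have "?P * (rat_s \<cdot>\<^sub>m 1\<^sub>m n) = (rat_s \<cdot>\<^sub>m 1\<^sub>m k) * ?P"
    using rP by (simp add: mult_smult_distrib[of _ k n _ n] mult_smult_assoc_mat[of _ k k _ n])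
  also have "?P * rat_const A = rat_const A2 * ?P"
    using rat_const_mult[OF P(1) c(1)] rat_const_mult[OF A2(1) P(1)] A2(2) by simp
  also have "(rat_s \<cdot>\<^sub>m 1\<^sub>m k) * ?P - rat_const A2 * ?P = ?R2 * ?P"
    unfolding rat_pencil_def using rP rc by (intro minus_mult_distrib_mat[of _ k k, symmetric]) auto
  finally have PR: "?P * ?R = ?R2 * ?P" .
  \<comment> \<open>The intertwining relation between the pencils passes to their inverses.\<close>
  have "?P * matinv ?R = (matinv ?R2 * ?R2) * (?P * matinv ?R)"
    using inv2(3) rP inv(1) by simp
  also have "\<dots> = matinv ?R2 * ((?R2 * ?P) * matinv ?R)"
    using rP inv(1) inv2(1) R2 by (simp add: assoc_mult_mat[of _ k k _ k _ n] assoc_mult_mat[of _ k k _ n _ n])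
  also have "(?R2 * ?P) * matinv ?R = ?P * (?R * matinv ?R)"
    unfolding PR[symmetric] using rP inv(1) R by (simp add: assoc_mult_mat[of _ k n _ n _ n])
  also have "\<dots> = ?P" using rP inv(2) by simp
  finally have PI: "?P * matinv ?R = matinv ?R2 * ?P" .
  have "G = rat_const C2 * ?P * matinv ?R * rat_const B + rat_const D"
    unfolding G C2(2) rat_const_mult[OF C2(1) P(1)] by simp
  also have "rat_const C2 * ?P * matinv ?R = rat_const C2 * (?P * matinv ?R)"
    using rc rP inv(1) by (simp add: assoc_mult_mat[of _ m k _ n _ n])
  also have "\<dots> * rat_const B = rat_const C2 * matinv ?R2 * (?P * rat_const B)"
    unfolding PI using rc rP inv2(1)
    by (simp add: assoc_mult_mat[of _ m k _ k _ m] assoc_mult_mat[of _ m k _ n _ m] assoc_mult_mat[of _ k k _ n _ m])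
  also have "?P * rat_const B = rat_const (\<Psi> * B)" using rat_const_mult[OF P(1) c(2)] by simp
  finally have "realization m k A2 (\<Psi> * B) C2 D G"
    using A2(1) C2(1) P(1) c by (simp add: realization_def rat_pencil_def)
  from least[OF this] k show False by simp
qed

lemma transpose_rat_const: "transpose_mat (rat_const A) = rat_const (transpose_mat A)"
  by (auto simp: rat_const_def intro!: eq_matI)

lemma transpose_rat_pencil: "A \<in> carrier_mat n n \<Longrightarrow> transpose_mat (rat_pencil n A) = rat_pencil n (transpose_mat A)"
  by (auto simp: rat_pencil_def rat_const_def intro!: eq_matI)

lemma realization_transpose:
  assumes "realization m n A B C D G"
  shows "realization m n (transpose_mat A) (transpose_mat C) (transpose_mat B) (transpose_mat D) (transpose_mat G)"
proof -
  have c: "A \<in> carrier_mat n n" "B \<in> carrier_mat n m" "C \<in> carrier_mat m n" "D \<in> carrier_mat m m"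
    and G: "G = rat_const C * matinv (rat_pencil n A) * rat_const B + rat_const D"
    using assms by (auto simp: realization_def rat_pencil_def)
  have tA: "transpose_mat A \<in> carrier_mat n n" using c by simp
  let ?N = "matinv (rat_pencil n A)" and ?M = "matinv (rat_pencil n (transpose_mat A))"
  note inv = rat_resolvent[OF c(1) c(1)] and inv2 = rat_resolvent[OF tA tA]
  note R = rat_pencil_carrier[OF c(1)] and rc = rat_const_carrier[OF c(2)] rat_const_carrier[OF c(3)] rat_const_carrier[OF c(4)]
  have N: "transpose_mat ?N \<in> carrier_mat n n" using inv(1) by simp
  have "transpose_mat (?N * rat_pencil n A) = 1\<^sub>m n" unfolding inv(3) by simp
  then have "rat_pencil n (transpose_mat A) * transpose_mat ?N = 1\<^sub>m n"
    using transpose_mult[OF inv(1) R] by (simp add: transpose_rat_pencil[OF c(1)])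
  then have "?M * (rat_pencil n (transpose_mat A) * transpose_mat ?N) = ?M" using inv2(1) by simp
  moreover have "?M * (rat_pencil n (transpose_mat A) * transpose_mat ?N) = transpose_mat ?N"
    using inv2 N rat_pencil_carrier[OF tA] by (simp flip: assoc_mult_mat[of _ n n _ n _ n])
  ultimately have NM: "transpose_mat ?N = ?M" by simp
  have "transpose_mat G = transpose_mat (rat_const C * ?N * rat_const B) + transpose_mat (rat_const D)"
    unfolding G using rc inv(1) by (intro transpose_add[of _ m m]) auto
  also have "transpose_mat (rat_const C * ?N * rat_const B) = transpose_mat (rat_const B) * transpose_mat (rat_const C * ?N)"
    using rc inv(1) by (intro transpose_mult[of _ m n _ m]) auto
  also have "transpose_mat (rat_const C * ?N) = ?M * transpose_mat (rat_const C)"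
    using transpose_mult[OF rc(2) inv(1)] NM by simp
  also have "transpose_mat (rat_const B) * (?M * transpose_mat (rat_const C)) = transpose_mat (rat_const B) * ?M * transpose_mat (rat_const C)"
    using rc inv2(1) by (intro assoc_mult_mat[of _ m n _ n _ m, symmetric]) auto
  finally show ?thesis
    using c by (simp add: realization_def rat_pencil_def transpose_rat_const)
qed

lemma minimal_realization_transpose:
  assumes "minimal_realization m n A B C D G"
  shows "minimal_realization m n (transpose_mat A) (transpose_mat C) (transpose_mat B) (transpose_mat D) (transpose_mat G)"
  using assms realization_transpose realization_transpose[of m _ _ _ _ _ "transpose_mat G"]
  unfolding minimal_realization_def by (metis transpose_transpose)

text \<open>Duality: transposition exchanges the roles of \<open>B\<close> and \<open>C\<close> and
  preserves minimality.\<close>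

lemma minimal_realization_controllable:
  assumes "minimal_realization m n A B C D G"
    and "v \<in> carrier_vec n" "cmat (transpose_mat A) *\<^sub>v v = l \<cdot>\<^sub>v v" "cmat (transpose_mat B) *\<^sub>v v = 0\<^sub>v m"
  shows "v = 0\<^sub>v n"
  using minimal_realization_observable[OF minimal_realization_transpose[OF assms(1)] assms(2-4)] .

section \<open>Convergence of vectors and perturbation of state equations\<close>

definition vec_tendsto :: "nat \<Rightarrow> ('a \<Rightarrow> complex vec) \<Rightarrow> complex vec \<Rightarrow> 'a filter \<Rightarrow> bool" where
  "vec_tendsto n f L F \<longleftrightarrow> (\<forall>i<n. ((\<lambda>s. f s $ i) \<longlongrightarrow> L $ i) F)"

lemma vec_tendsto_const: "vec_tendsto n (\<lambda>_. L) L F"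
  by (simp add: vec_tendsto_def)

lemma vec_tendsto_add:
  assumes "vec_tendsto n f L F" "vec_tendsto n g M F" "\<And>s. g s \<in> carrier_vec n" "M \<in> carrier_vec n"
  shows "vec_tendsto n (\<lambda>s. f s + g s) (L + M) F"
  using assms(1,2,4) by (auto simp: vec_tendsto_def carrier_vecD[OF assms(3)] intro!: tendsto_intros)

lemma vec_tendsto_diff:
  assumes "vec_tendsto n f L F" "vec_tendsto n g M F" "\<And>s. g s \<in> carrier_vec n" "M \<in> carrier_vec n"
  shows "vec_tendsto n (\<lambda>s. f s - g s) (L - M) F"
  using assms(1,2,4) by (auto simp: vec_tendsto_def carrier_vecD[OF assms(3)] intro!: tendsto_intros)

lemma vec_tendsto_smult:
  assumes "vec_tendsto n f L F" "(c \<longlongrightarrow> a) F" "\<And>s. f s \<in> carrier_vec n" "L \<in> carrier_vec n"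
  shows "vec_tendsto n (\<lambda>s. c s \<cdot>\<^sub>v f s) (a \<cdot>\<^sub>v L) F"
  using assms(1,2,4) by (auto simp: vec_tendsto_def carrier_vecD[OF assms(3)] intro!: tendsto_intros)

lemma tendsto_cinner:
  assumes "vec_tendsto n f L F" "vec_tendsto n g M F" "\<And>s. g s \<in> carrier_vec n" "M \<in> carrier_vec n"
  shows "((\<lambda>s. f s \<bullet>c g s) \<longlongrightarrow> L \<bullet>c M) F"
  using assms(1,2,4) unfolding cinner_sum
  by (auto simp: vec_tendsto_def carrier_vecD[OF assms(3)] intro!: tendsto_intros)

lemma vec_tendsto_mult_mat_fun:
  assumes "\<And>s. M s \<in> carrier_mat m n" "N \<in> carrier_mat m n"
    and "\<And>i j. i < m \<Longrightarrow> j < n \<Longrightarrow> ((\<lambda>s. M s $$ (i, j)) \<longlongrightarrow> N $$ (i, j)) F"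
    and "vec_tendsto n f L F" "\<And>s. f s \<in> carrier_vec n" "L \<in> carrier_vec n"
  shows "vec_tendsto m (\<lambda>s. M s *\<^sub>v f s) (N *\<^sub>v L) F"
  unfolding vec_tendsto_def
proof (intro allI impI)
  fix i assume i: "i < m"
  have "(M s *\<^sub>v f s) $ i = (\<Sum>j<n. M s $$ (i, j) * f s $ j)" for s
    using assms(1)[of s] assms(5)[of s] i by (simp add: scalar_prod_def atLeast0LessThan)
  moreover have "(N *\<^sub>v L) $ i = (\<Sum>j<n. N $$ (i, j) * L $ j)"
    using assms(2,6) i by (simp add: scalar_prod_def atLeast0LessThan)
  ultimately show "((\<lambda>s. (M s *\<^sub>v f s) $ i) \<longlongrightarrow> (N *\<^sub>v L) $ i) F"
    using assms(3)[OF i] assms(4) by (auto simp: vec_tendsto_def intro!: tendsto_intros)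
qed

lemma vec_tendsto_mult_mat:
  assumes "M \<in> carrier_mat m n" "vec_tendsto n f L F" "\<And>s. f s \<in> carrier_vec n" "L \<in> carrier_vec n"
  shows "vec_tendsto m (\<lambda>s. M *\<^sub>v f s) (M *\<^sub>v L) F"
  by (rule vec_tendsto_mult_mat_fun[where n = n]) (use assms in auto)

lemma vec_tendsto_cong:
  assumes "vec_tendsto n f L F" "eventually (\<lambda>s. f s = g s) F"
  shows "vec_tendsto n g L F"
  unfolding vec_tendsto_def
proof (intro allI impI)
  fix i assume "i < n"
  then have "((\<lambda>s. f s $ i) \<longlongrightarrow> L $ i) F" using assms(1) by (simp add: vec_tendsto_def)
  moreover have "eventually (\<lambda>s. f s $ i = g s $ i) F" using assms(2) by eventually_elim simp
  ultimately show "((\<lambda>s. g s $ i) \<longlongrightarrow> L $ i) F" by (simp add: tendsto_cong)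
qed

lemma vec_tendsto_unique:
  assumes "vec_tendsto n f L F" "vec_tendsto n f M F" "F \<noteq> bot" "L \<in> carrier_vec n" "M \<in> carrier_vec n"
  shows "L = M"
  using assms by (intro eq_vecI) (auto simp: vec_tendsto_def intro: tendsto_unique)

lemma vec_tendsto_filter_mono:
  "vec_tendsto n f L F \<Longrightarrow> filterlim g F H \<Longrightarrow> vec_tendsto n (\<lambda>x. f (g x)) L H"
  by (auto simp: vec_tendsto_def intro: filterlim_compose)

lemma eventually_poly_nonzero_at:
  fixes p :: "complex poly"
  assumes "p \<noteq> 0"
  shows "eventually (\<lambda>s. poly p s \<noteq> 0) (at a)"
proof -
  have "finite {s. poly p s = 0}" using assms by (rule poly_roots_finite)
  then have "open (- ({s. poly p s = 0} - {a}))" by (intro open_Compl finite_imp_closed) auto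
  then have "eventually (\<lambda>x. x \<in> - ({s. poly p s = 0} - {a})) (at a)"
    by (intro eventually_at_in_open') auto
  moreover have "eventually (\<lambda>x. x \<noteq> a) (at a)" by (simp add: eventually_at_filter)
  ultimately show ?thesis by eventually_elim auto
qed

lemma char_poly_nonzero: "A \<in> carrier_mat n n \<Longrightarrow> char_poly A \<noteq> 0"
  using degree_monic_char_poly[of A n] by auto

text \<open>If \<open>t X\<close> has norm at most one half, every solution is bounded by twice the
  right side; so the system is injective and hence solvable. The bound does not depend on
  \<open>t\<close>, which makes solutions tend to 0 together with \<open>b\<close>.\<close>

lemma identity_plus_small_invertible:
  fixes X :: "complex mat"
  assumes X: "X \<in> carrier_mat n n"
  shows "\<exists>d>0. \<forall>t b. cmod t < d \<longrightarrow> b \<in> carrier_vec n \<longrightarrow>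
    (\<exists>y\<in>carrier_vec n. y + t \<cdot>\<^sub>v (X *\<^sub>v y) = b \<and> (\<Sum>i<n. cmod (y $ i)) \<le> 2 * (\<Sum>i<n. cmod (b $ i)))"
proof -
  \<comment> \<open>The sum of all moduli bounds \<open>X\<close> as an operator for the sum norm;
    the summand 1 keeps the divisor in the threshold \<open>1 / (2 * c)\<close> positive.\<close>
  define c where "c = 1 + (\<Sum>i<n. \<Sum>j<n. cmod (X $$ (i, j)))"
  have c1: "c \<ge> 1" unfolding c_def by (simp add: sum_nonneg)
  have bound: "(\<Sum>i<n. cmod (y $ i)) \<le> 2 * (\<Sum>i<n. cmod (b $ i))"
    if t: "cmod t < 1 / (2 * c)" and y: "y \<in> carrier_vec n" and eq: "y + t \<cdot>\<^sub>v (X *\<^sub>v y) = b" for t y b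
  proof -
    define S where "S = (\<Sum>i<n. cmod (y $ i))"
    have S0: "S \<ge> 0" by (simp add: S_def sum_nonneg)
    have ent: "cmod (y $ i) \<le> cmod (b $ i) + cmod t * (\<Sum>j<n. cmod (X $$ (i, j)) * S)" if i: "i < n" for i
    proof -
      have "y $ i = b $ i - t * (\<Sum>j<n. X $$ (i, j) * y $ j)"
        using arg_cong[OF eq, of "\<lambda>v. v $ i"] i X y by (simp add: scalar_prod_def atLeast0LessThan algebra_simps)
      then have "cmod (y $ i) \<le> cmod (b $ i) + cmod (t * (\<Sum>j<n. X $$ (i, j) * y $ j))"
        by (metis norm_triangle_ineq4)
      also have "cmod (t * (\<Sum>j<n. X $$ (i, j) * y $ j)) \<le> cmod t * (\<Sum>j<n. cmod (X $$ (i, j)) * S)"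
        unfolding norm_mult
        by (intro mult_left_mono order_trans[OF norm_sum] sum_mono)
           (auto simp: norm_mult S_def intro!: mult_left_mono member_le_sum)
      finally show ?thesis by simp
    qed
    have "S \<le> (\<Sum>i<n. cmod (b $ i) + cmod t * (\<Sum>j<n. cmod (X $$ (i, j)) * S))"
      unfolding S_def by (rule sum_mono) (use ent in \<open>auto simp: S_def\<close>)
    also have "\<dots> = (\<Sum>i<n. cmod (b $ i)) + cmod t * (c - 1) * S"
      by (simp add: sum.distrib c_def mult.assoc flip: sum_distrib_left sum_distrib_right)
    also have "cmod t * (c - 1) * S \<le> (1/2) * S"
    proof (rule mult_right_mono)
      have "cmod t * (c - 1) \<le> cmod t * c" by (simp add: mult_left_mono)
      also have "\<dots> \<le> 1 / (2 * c) * c" using t c1 by (intro mult_right_mono) auto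
      also have "\<dots> = 1 / 2" using c1 by simp
      finally show "cmod t * (c - 1) \<le> 1 / 2" .
    qed (rule S0)
    finally show ?thesis by (simp add: S_def)
  qed
  have ex: "\<exists>y\<in>carrier_vec n. y + t \<cdot>\<^sub>v (X *\<^sub>v y) = b" if t: "cmod t < 1 / (2 * c)" and b: "b \<in> carrier_vec n" for t b
  proof -
    let ?M = "1\<^sub>m n + t \<cdot>\<^sub>m X"
    have M: "?M \<in> carrier_mat n n" using X by simp
    have Mv: "?M *\<^sub>v y = y + t \<cdot>\<^sub>v (X *\<^sub>v y)" if "y \<in> carrier_vec n" for y
    proof -
      have "?M *\<^sub>v y = 1\<^sub>m n *\<^sub>v y + (t \<cdot>\<^sub>m X) *\<^sub>v y" using X that by (intro add_mult_distrib_mat_vec[of _ n n]) auto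
      also have "(t \<cdot>\<^sub>m X) *\<^sub>v y = t \<cdot>\<^sub>v (X *\<^sub>v y)" using X that by (intro eq_vecI) auto
      finally show ?thesis using that by simp
    qed
    have "det ?M \<noteq> 0"
    proof
      assume "det ?M = 0"
      then obtain v where v: "v \<in> carrier_vec n" "v \<noteq> 0\<^sub>v n" "?M *\<^sub>v v = 0\<^sub>v n"
        using det_0_iff_vec_prod_zero_field[OF M] by blast
      from bound[OF t v(1), of "0\<^sub>v n"] v have "(\<Sum>i<n. cmod (v $ i)) \<le> 0" by (simp add: Mv)
      moreover have "(\<Sum>i<n. cmod (v $ i)) \<ge> 0" by (simp add: sum_nonneg)
      ultimately have "(\<Sum>i<n. cmod (v $ i)) = 0" by linarith
      then have "\<forall>i<n. v $ i = 0" by (simp add: sum_nonneg_eq_0_iff)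
      then have "v = 0\<^sub>v n" using v(1) by (intro eq_vecI) auto
      then show False using v(2) by contradiction
    qed
    note inv = matinv[OF M this]
    have "?M *\<^sub>v (matinv ?M *\<^sub>v b) = (?M * matinv ?M) *\<^sub>v b"
      using M inv(1) b by (intro assoc_mult_mat_vec[symmetric]) auto
    then have "?M *\<^sub>v (matinv ?M *\<^sub>v b) = b" using inv b by simp
    moreover have "matinv ?M *\<^sub>v b \<in> carrier_vec n" using inv b by simp
    ultimately show ?thesis using Mv by metis
  qed
  have "0 < 1 / (2 * c)" using c1 by simp
  moreover have "\<exists>y\<in>carrier_vec n. y + t \<cdot>\<^sub>v (X *\<^sub>v y) = b \<and> (\<Sum>i<n. cmod (y $ i)) \<le> 2 * (\<Sum>i<n. cmod (b $ i))"
    if "cmod t < 1 / (2 * c)" "b \<in> carrier_vec n" for t b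
    using ex[OF that] bound[OF that(1)] by blast
  ultimately show ?thesis by blast
qed

lemma mat_adjoint_cmat: "mat_adjoint (cmat A) = cmat (transpose_mat A)"
  by (intro eq_matI) auto

lemma smult_one_minus_mult_vec:
  fixes A :: "complex mat"
  assumes "A \<in> carrier_mat n n" "v \<in> carrier_vec n"
  shows "(l \<cdot>\<^sub>m 1\<^sub>m n - A) *\<^sub>v v = l \<cdot>\<^sub>v v - A *\<^sub>v v"
proof -
  have "(l \<cdot>\<^sub>m 1\<^sub>m n - A) *\<^sub>v v = (l \<cdot>\<^sub>m 1\<^sub>m n) *\<^sub>v v - A *\<^sub>v v"
    using assms by (intro minus_mult_distrib_mat_vec[of _ n n]) auto
  also have "(l \<cdot>\<^sub>m 1\<^sub>m n) *\<^sub>v v = l \<cdot>\<^sub>v v" using assms by (intro eq_vecI) auto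
  finally show ?thesis .
qed

lemma vec_diff_eq_zero:
  fixes u v :: "complex vec"
  assumes "u \<in> carrier_vec n" "v \<in> carrier_vec n" "u - v = 0\<^sub>v n"
  shows "u = v"
proof (intro eq_vecI)
  fix i assume "i < dim_vec v"
  then show "u $ i = v $ i" using arg_cong[OF assms(3), of "\<lambda>w. w $ i"] assms(1,2) by simp
qed (use assms in auto)

text \<open>Controllability makes \<open>[l I - A, B]\<close> right invertible, by \<open>M\<^sup>* (M M\<^sup>* + B B\<^sup>*)\<^sup>-\<^sup>1\<close> and
  \<open>B\<^sup>* (M M\<^sup>* + B B\<^sup>*)\<^sup>-\<^sup>1\<close> with \<open>M = l I - A\<close>.\<close>

lemma minimal_realization_right_inverse:
  assumes min: "minimal_realization m n A B C D G"
  shows "\<exists>X Y. X \<in> carrier_mat n n \<and> Y \<in> carrier_mat m n \<and>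
    (\<forall>y\<in>carrier_vec n. l \<cdot>\<^sub>v (X *\<^sub>v y) - cmat A *\<^sub>v (X *\<^sub>v y) + cmat B *\<^sub>v (Y *\<^sub>v y) = y)"
proof -
  have c: "A \<in> carrier_mat n n" "B \<in> carrier_mat n m"
    using min by (auto simp: minimal_realization_def realization_def)
  have cA: "cmat A \<in> carrier_mat n n" and cB: "cmat B \<in> carrier_mat n m" using c by auto
  define M where "M = l \<cdot>\<^sub>m 1\<^sub>m n - cmat A"
  have M: "M \<in> carrier_mat n n" using cA unfolding M_def by (intro minus_carrier_mat)
  note aM = mat_adjoint_carrier[OF M] and aB = mat_adjoint_carrier[OF cB]
  define H where "H = M * mat_adjoint M + cmat B * mat_adjoint (cmat B)"
  have H: "H \<in> carrier_mat n n" using M aM cB aB by (auto simp: H_def)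
  have Hv: "H *\<^sub>v z = M *\<^sub>v (mat_adjoint M *\<^sub>v z) + cmat B *\<^sub>v (mat_adjoint (cmat B) *\<^sub>v z)"
    if z: "z \<in> carrier_vec n" for z
  proof -
    have "H *\<^sub>v z = (M * mat_adjoint M) *\<^sub>v z + (cmat B * mat_adjoint (cmat B)) *\<^sub>v z"
      unfolding H_def using M aM cB aB z by (intro add_mult_distrib_mat_vec[of _ n n]) auto
    then show ?thesis
      using assoc_mult_mat_vec[OF M aM z] assoc_mult_mat_vec[OF cB aB z] by simp
  qed
  have "det H \<noteq> 0"
  proof
    assume "det H = 0"
    then obtain z where z: "z \<in> carrier_vec n" "z \<noteq> 0\<^sub>v n" "H *\<^sub>v z = 0\<^sub>v n"
      using det_0_iff_vec_prod_zero_field[OF H] by blast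
    let ?p = "mat_adjoint M *\<^sub>v z" and ?q = "mat_adjoint (cmat B) *\<^sub>v z"
    have pq: "?p \<in> carrier_vec n" "?q \<in> carrier_vec m" using aM aB z by auto
    \<comment> \<open>The form of \<open>H\<close> at \<open>z\<close> is the sum of the squared
      norms of \<open>M\<^sup>* z\<close> and \<open>B\<^sup>* z\<close>, so both vanish. Then
      \<open>z\<close> is an eigenvector of the transpose of \<open>A\<close> for
      \<open>cnj l\<close> and contradicts controllability.\<close>
    have "(H *\<^sub>v z) \<bullet>c z = (M *\<^sub>v ?p) \<bullet>c z + (cmat B *\<^sub>v ?q) \<bullet>c z"
      unfolding Hv[OF z(1)] using M cB pq z by (intro cinner_add_left[of _ n]) auto
    also have "\<dots> = ?p \<bullet>c ?p + ?q \<bullet>c ?q"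
      using cinner_mult_adjoint[OF M pq(1) z(1)] cinner_mult_adjoint[OF cB pq(2) z(1)] by simp
    finally have "?p \<bullet>c ?p + ?q \<bullet>c ?q = 0" using z by simp
    from arg_cong[OF this, of Re] have s0: "Re (?p \<bullet>c ?p) + Re (?q \<bullet>c ?q) = 0" by simp
    have p0: "?p = 0\<^sub>v n" and q0: "?q = 0\<^sub>v m"
      using s0 cinner_self_ge_0[of ?p] cinner_self_ge_0[of ?q]
        cinner_self_eq_0[OF pq(1)] cinner_self_eq_0[OF pq(2)] by linarith+
    have "mat_adjoint M = cnj l \<cdot>\<^sub>m 1\<^sub>m n - cmat (transpose_mat A)"
      using c by (intro eq_matI) (auto simp: M_def)
    then have "cnj l \<cdot>\<^sub>v z - cmat (transpose_mat A) *\<^sub>v z = 0\<^sub>v n"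
      using p0 z c by (simp add: smult_one_minus_mult_vec)
    then have "cmat (transpose_mat A) *\<^sub>v z = cnj l \<cdot>\<^sub>v z"
      by (rule vec_diff_eq_zero[symmetric, rotated 2]) (simp_all add: z(1) c(1) mult_mat_vec_carrier[of _ n n])
    then have "z = 0\<^sub>v n"
      using minimal_realization_controllable[OF min z(1)] q0 by (simp add: mat_adjoint_cmat)
    with z show False by simp
  qed
  note inv = matinv[OF H this]
  have "l \<cdot>\<^sub>v ((mat_adjoint M * matinv H) *\<^sub>v y) - cmat A *\<^sub>v ((mat_adjoint M * matinv H) *\<^sub>v y) +
      cmat B *\<^sub>v ((mat_adjoint (cmat B) * matinv H) *\<^sub>v y) = y" if y: "y \<in> carrier_vec n" for y
  proof -
    let ?z = "matinv H *\<^sub>v y"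
    have z: "?z \<in> carrier_vec n" using inv y by simp
    have p: "mat_adjoint M *\<^sub>v ?z \<in> carrier_vec n" using aM z by simp
    have "H *\<^sub>v ?z = y" using inv y assoc_mult_mat_vec[OF H inv(1) y] by simp
    then show ?thesis
      using Hv[OF z] smult_one_minus_mult_vec[OF cA p, of l]
        assoc_mult_mat_vec[OF aM inv(1) y] assoc_mult_mat_vec[OF aB inv(1) y] by (simp flip: M_def)
  qed
  moreover have "mat_adjoint M * matinv H \<in> carrier_mat n n" "mat_adjoint (cmat B) * matinv H \<in> carrier_mat m n"
    using aM aB inv by auto
  ultimately show ?thesis by blast
qed

text \<open>If \<open>l\<close> is an eigenvalue of \<open>A\<close>, a state can in general not be
  continued to nearby points with its input held fixed. Adjusting the input as well is possible
  because \<open>[l I - A, B]\<close> has a right inverse, given by \<open>X0\<close> and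
  \<open>Y0\<close>.\<close>

lemma minimal_realization_state_approx:
  assumes min: "minimal_realization m n A B C D G"
    and x: "x \<in> carrier_vec n" and w: "w \<in> carrier_vec m"
    and eq: "l \<cdot>\<^sub>v x = cmat A *\<^sub>v x + cmat B *\<^sub>v w"
  shows "\<exists>X W. (\<forall>s. X s \<in> carrier_vec n) \<and> (\<forall>s. W s \<in> carrier_vec m) \<and>
    vec_tendsto n X x (at l) \<and> vec_tendsto m W w (at l) \<and>
    eventually (\<lambda>s. s \<cdot>\<^sub>v X s = cmat A *\<^sub>v X s + cmat B *\<^sub>v W s) (at l)"
proof -
  have c: "A \<in> carrier_mat n n" "B \<in> carrier_mat n m"
    using min by (auto simp: minimal_realization_def realization_def)
  have cA: "cmat A \<in> carrier_mat n n" and cB: "cmat B \<in> carrier_mat n m" using c by auto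
  obtain X0 Y0 where X0: "X0 \<in> carrier_mat n n" and Y0: "Y0 \<in> carrier_mat m n"
    and inv: "\<And>y. y \<in> carrier_vec n \<Longrightarrow>
      l \<cdot>\<^sub>v (X0 *\<^sub>v y) - cmat A *\<^sub>v (X0 *\<^sub>v y) + cmat B *\<^sub>v (Y0 *\<^sub>v y) = y"
    using minimal_realization_right_inverse[OF min, of l] by blast
  obtain d where d: "d > 0" "\<And>t b. cmod t < d \<Longrightarrow> b \<in> carrier_vec n \<Longrightarrow>
    \<exists>y\<in>carrier_vec n. y + t \<cdot>\<^sub>v (X0 *\<^sub>v y) = b \<and> (\<Sum>i<n. cmod (y $ i)) \<le> 2 * (\<Sum>i<n. cmod (b $ i))"
    using identity_plus_small_invertible[OF X0] by blast
  \<comment> \<open>With state \<open>x - X0 y\<close> and input \<open>w + Y0 y\<close> the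
    residual of the state equation at \<open>s\<close> is
    \<open>(s - l) x - (y + (s - l) X0 y)\<close>, and \<open>y\<close> is chosen to make it 0. Away
    from \<open>l\<close> any value will do.\<close>
  have "\<exists>y. y \<in> carrier_vec n \<and> (cmod (s - l) < d \<longrightarrow> y + (s - l) \<cdot>\<^sub>v (X0 *\<^sub>v y) = (s - l) \<cdot>\<^sub>v x \<and>
      (\<Sum>i<n. cmod (y $ i)) \<le> 2 * (\<Sum>i<n. cmod (((s - l) \<cdot>\<^sub>v x) $ i)))" for s
    using d(2)[of "s - l" "(s - l) \<cdot>\<^sub>v x"] x by (cases "cmod (s - l) < d") (auto intro: exI[of _ "0\<^sub>v n"])
  then obtain y where y: "\<And>s. y s \<in> carrier_vec n"
    "\<And>s. cmod (s - l) < d \<Longrightarrow> y s + (s - l) \<cdot>\<^sub>v (X0 *\<^sub>v y s) = (s - l) \<cdot>\<^sub>v x"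
    "\<And>s. cmod (s - l) < d \<Longrightarrow> (\<Sum>i<n. cmod (y s $ i)) \<le> 2 * (\<Sum>i<n. cmod (((s - l) \<cdot>\<^sub>v x) $ i))"
    by metis
  have near: "eventually (\<lambda>s. cmod (s - l) < d) (at l)"
    using d(1) by (auto simp: eventually_at dist_norm)
  have y0: "vec_tendsto n y (0\<^sub>v n) (at l)"
    unfolding vec_tendsto_def
  proof (intro allI impI)
    fix i assume i: "i < n"
    have "((\<lambda>s. y s $ i) \<longlongrightarrow> 0) (at l)"
    proof (rule Lim_null_comparison)
      show "eventually (\<lambda>s. cmod (y s $ i) \<le> 2 * (\<Sum>i<n. cmod ((s - l) * x $ i))) (at l)"
        using near
      proof eventually_elim
        case (elim s)
        have "cmod (y s $ i) \<le> (\<Sum>i<n. cmod (y s $ i))" by (rule member_le_sum) (use i in auto)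
        also have "\<dots> \<le> 2 * (\<Sum>i<n. cmod (((s - l) \<cdot>\<^sub>v x) $ i))" by (rule y(3)[OF elim])
        finally show ?case using x by simp
      qed
      have "((\<lambda>s. 2 * (\<Sum>i<n. cmod ((s - l) * x $ i))) \<longlongrightarrow> 2 * (\<Sum>i<n. cmod ((l - l) * x $ i))) (at l)"
        by (intro tendsto_intros)
      then show "((\<lambda>s. 2 * (\<Sum>i<n. cmod ((s - l) * x $ i))) \<longlongrightarrow> 0) (at l)" by simp
    qed
    then show "((\<lambda>s. y s $ i) \<longlongrightarrow> 0\<^sub>v n $ i) (at l)" using i by simp
  qed
  define X where "X = (\<lambda>s. x - X0 *\<^sub>v y s)"
  define W where "W = (\<lambda>s. w + Y0 *\<^sub>v y s)"
  have Xc: "X s \<in> carrier_vec n" and Wc: "W s \<in> carrier_vec m" for s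
    using x w X0 Y0 y(1)[of s] by (auto simp: X_def W_def)
  have "vec_tendsto n (\<lambda>s. X0 *\<^sub>v y s) (X0 *\<^sub>v 0\<^sub>v n) (at l)" "vec_tendsto m (\<lambda>s. Y0 *\<^sub>v y s) (Y0 *\<^sub>v 0\<^sub>v n) (at l)"
    by (rule vec_tendsto_mult_mat[OF X0 y0 y(1)], simp) (rule vec_tendsto_mult_mat[OF Y0 y0 y(1)], simp)
  then have "vec_tendsto n X (x - X0 *\<^sub>v 0\<^sub>v n) (at l)" "vec_tendsto m W (w + Y0 *\<^sub>v 0\<^sub>v n) (at l)"
    unfolding X_def W_def using X0 Y0 y(1)
    by (auto intro!: vec_tendsto_diff vec_tendsto_add vec_tendsto_const)
  moreover have "X0 *\<^sub>v 0\<^sub>v n = 0\<^sub>v n" "Y0 *\<^sub>v 0\<^sub>v n = 0\<^sub>v m" using X0 Y0 by (auto intro!: eq_vecI)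
  ultimately have lim: "vec_tendsto n X x (at l)" "vec_tendsto m W w (at l)" using x w by auto
  have "eventually (\<lambda>s. s \<cdot>\<^sub>v X s = cmat A *\<^sub>v X s + cmat B *\<^sub>v W s) (at l)"
    using near
  proof eventually_elim
    case (elim s)
    let ?u = "X0 *\<^sub>v y s" and ?v = "Y0 *\<^sub>v y s"
    have u: "?u \<in> carrier_vec n" and v: "?v \<in> carrier_vec m" using X0 Y0 y(1) by auto
    have AX: "cmat A *\<^sub>v X s = cmat A *\<^sub>v x - cmat A *\<^sub>v ?u"
      unfolding X_def using cA x u by (rule mult_minus_distrib_mat_vec)
    have BW: "cmat B *\<^sub>v W s = cmat B *\<^sub>v w + cmat B *\<^sub>v ?v"
      unfolding W_def using cB w v by (rule mult_add_distrib_mat_vec)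
    note dims = carrier_vecD[OF x] carrier_vecD[OF u] carrier_vecD[OF Xc] carrier_vecD[OF y(1)] carrier_matD[OF c(1)] carrier_matD[OF c(2)]
    show ?case
    proof (intro eq_vecI)
      fix i assume "i < dim_vec (cmat A *\<^sub>v X s + cmat B *\<^sub>v W s)"
      then have i: "i < n" using c by simp
      have 1: "l * x $ i = (cmat A *\<^sub>v x) $ i + (cmat B *\<^sub>v w) $ i"
        using arg_cong[OF eq, of "\<lambda>v. v $ i"] i dims by (simp del: index_mult_mat_vec)
      have 2: "l * ?u $ i - (cmat A *\<^sub>v ?u) $ i + (cmat B *\<^sub>v ?v) $ i = y s $ i"
        using arg_cong[OF inv[OF y(1)], of "\<lambda>v. v $ i" s] i dims by (simp del: index_mult_mat_vec)
      have 3: "y s $ i + (s - l) * ?u $ i = (s - l) * x $ i"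
        using arg_cong[OF y(2)[OF elim], of "\<lambda>v. v $ i"] i dims by (simp del: index_mult_mat_vec)
      have "s * (x $ i - ?u $ i) = (cmat A *\<^sub>v x) $ i - (cmat A *\<^sub>v ?u) $ i + ((cmat B *\<^sub>v w) $ i + (cmat B *\<^sub>v ?v) $ i)"
      proof -
        have "s * x $ i - s * ?u $ i = l * x $ i + y s $ i - l * ?u $ i" using 3 by (simp add: algebra_simps)
        then show ?thesis unfolding 1 2[symmetric] by (simp add: algebra_simps del: index_mult_mat_vec)
      qed
      then show "(s \<cdot>\<^sub>v X s) $ i = (cmat A *\<^sub>v X s + cmat B *\<^sub>v W s) $ i"
        unfolding AX BW using i dims by (simp add: X_def del: index_mult_mat_vec)
    qed (use Xc dims in auto)
  qed
  with Xc Wc lim show ?thesis by blast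
qed

text \<open>Gives the relation \<open>u = G(l) w\<close> a meaning at a pole \<open>l\<close>: it
  holds in the limit along inputs that vary with \<open>s\<close>.\<close>

lemma minimal_transfer_approx:
  assumes min: "minimal_realization m n A B C D G"
    and x: "x \<in> carrier_vec n" and w: "w \<in> carrier_vec m"
    and eq: "l \<cdot>\<^sub>v x = cmat A *\<^sub>v x + cmat B *\<^sub>v w"
  shows "\<exists>W. (\<forall>s. W s \<in> carrier_vec m) \<and> vec_tendsto m W w (at l) \<and>
    vec_tendsto m (\<lambda>s. tf_eval G s *\<^sub>v W s) (cmat C *\<^sub>v x + cmat D *\<^sub>v w) (at l)"
proof -
  have R: "realization m n A B C D G" using min by (simp add: minimal_realization_def)
  then have c: "A \<in> carrier_mat n n" "cmat C \<in> carrier_mat m n" "cmat D \<in> carrier_mat m m"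
    by (auto simp: realization_def)
  obtain X W where XW: "\<And>s. X s \<in> carrier_vec n" "\<And>s. W s \<in> carrier_vec m"
    "vec_tendsto n X x (at l)" "vec_tendsto m W w (at l)"
    "eventually (\<lambda>s. s \<cdot>\<^sub>v X s = cmat A *\<^sub>v X s + cmat B *\<^sub>v W s) (at l)"
    using minimal_realization_state_approx[OF min x w eq] by blast
  have "eventually (\<lambda>s. poly (char_poly (cmat A)) s \<noteq> 0) (at l)"
    using char_poly_nonzero[of "cmat A" n] c by (intro eventually_poly_nonzero_at) auto
  with XW(5) have ev: "eventually (\<lambda>s. cmat C *\<^sub>v X s + cmat D *\<^sub>v W s = tf_eval G s *\<^sub>v W s) (at l)"
    by eventually_elim (use tf_eval_realization(2)[OF R _ XW(1,2)] in simp)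
  have "vec_tendsto m (\<lambda>s. cmat C *\<^sub>v X s + cmat D *\<^sub>v W s) (cmat C *\<^sub>v x + cmat D *\<^sub>v w) (at l)"
    using XW x w c by (intro vec_tendsto_add vec_tendsto_mult_mat) auto
  from vec_tendsto_cong[OF this ev] show ?thesis using XW(2,4) by blast
qed

lemma tendsto_rat_eval:
  assumes "rat_regular g a"
  shows "((\<lambda>s. rat_eval g s) \<longlongrightarrow> rat_eval g a) (at a)"
  using assms unfolding rat_eval_def rat_regular_def by (intro tendsto_intros) auto

lemma tendsto_tf_eval:
  assumes "\<not> tf_pole G a" "i < dim_row G" "j < dim_col G"
  shows "((\<lambda>s. tf_eval G s $$ (i, j)) \<longlongrightarrow> tf_eval G a $$ (i, j)) (at a)"
  using assms by (auto simp: tf_pole_iff_not_regular mat_regular_def tf_eval_alt intro: tendsto_rat_eval)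

text \<open>Start from an eigenvector \<open>v\<close> with zero input, so that the approximating
  inputs tend to 0. Were \<open>G\<close> regular at \<open>l\<close>, the outputs would tend to 0
  as well; but they tend to \<open>C v\<close>, which observability keeps from being 0.\<close>

lemma minimal_eigenvalue_imp_pole:
  assumes min: "minimal_realization m n A B C D G" and ev: "poly (char_poly (cmat A)) l = 0"
  shows "tf_pole G l"
proof (rule ccontr)
  assume np: "\<not> tf_pole G l"
  have R: "realization m n A B C D G" using min by (simp add: minimal_realization_def)
  then have c: "A \<in> carrier_mat n n" "B \<in> carrier_mat n m" "C \<in> carrier_mat m n" "D \<in> carrier_mat m m"
    by (auto simp: realization_def)
  have G: "G \<in> carrier_mat m m"
    using R rat_const_carrier[OF c(4)] by (auto simp: realization_def)
  have "eigenvalue (cmat A) l" using eigenvalue_root_char_poly[of "cmat A" n] c ev by simp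
  then obtain v where v: "v \<in> carrier_vec n" "v \<noteq> 0\<^sub>v n" "cmat A *\<^sub>v v = l \<cdot>\<^sub>v v"
    using c by (auto simp: eigenvalue_def eigenvector_def)
  have z: "cmat B *\<^sub>v 0\<^sub>v m = 0\<^sub>v n" "cmat D *\<^sub>v 0\<^sub>v m = 0\<^sub>v m" using c by (auto intro!: eq_vecI)
  have "l \<cdot>\<^sub>v v = cmat A *\<^sub>v v + cmat B *\<^sub>v 0\<^sub>v m" using v z by simp
  then obtain W where W: "\<And>s. W s \<in> carrier_vec m" "vec_tendsto m W (0\<^sub>v m) (at l)"
    "vec_tendsto m (\<lambda>s. tf_eval G s *\<^sub>v W s) (cmat C *\<^sub>v v + cmat D *\<^sub>v 0\<^sub>v m) (at l)"
    using minimal_transfer_approx[OF min v(1), of "0\<^sub>v m"] by auto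
  have "vec_tendsto m (\<lambda>s. tf_eval G s *\<^sub>v W s) (tf_eval G l *\<^sub>v 0\<^sub>v m) (at l)"
    using G W(1,2) tendsto_tf_eval[OF np]
    by (intro vec_tendsto_mult_mat_fun[where n = m]) (auto simp: tf_eval_def)
  moreover have "tf_eval G l *\<^sub>v 0\<^sub>v m = 0\<^sub>v m" using G by (auto simp: tf_eval_def intro!: eq_vecI)
  ultimately have "cmat C *\<^sub>v v + cmat D *\<^sub>v 0\<^sub>v m = 0\<^sub>v m"
    using vec_tendsto_unique[OF W(3), of "0\<^sub>v m"] v c by simp
  then have "cmat C *\<^sub>v v = 0\<^sub>v m" using z c v by simp
  then show False using minimal_realization_observable[OF min v(1) v(3)] v(2) by simp
qed

section \<open>Behaviour on the imaginary axis and at the origin\<close>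

lemma tf_eval_carrier: "G \<in> carrier_mat m n \<Longrightarrow> tf_eval G s \<in> carrier_mat m n"
  by (simp add: tf_eval_def)

lemma poly_of_real_cnj: "poly (map_poly complex_of_real p) (cnj s) = cnj (poly (map_poly complex_of_real p) s)"
  by (simp add: poly_cnj_real coeff_map_poly)

lemma rat_eval_cnj: "rat_eval g (cnj s) = cnj (rat_eval g s)" "rat_regular g (cnj s) \<longleftrightarrow> rat_regular g s"
  by (simp_all add: rat_eval_def rat_regular_def cnumer_def cdenom_def poly_of_real_cnj)

lemma tf_pole_cnj: "tf_pole G (cnj s) \<longleftrightarrow> tf_pole G s"
  by (simp add: tf_pole_iff_not_regular mat_regular_def rat_eval_cnj)

lemma tf_eval_cnj: "tf_eval G (cnj s) = map_mat cnj (tf_eval G s)"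
  by (intro eq_matI) (auto simp: tf_eval_alt rat_eval_cnj)

lemma cnj_mat_form:
  assumes "M \<in> carrier_mat m m" "v \<in> carrier_vec m"
  shows "(map_mat cnj M *\<^sub>v v) \<bullet>c v = cnj ((M *\<^sub>v conjugate v) \<bullet>c conjugate v)"
  using assms by (simp add: cinner_sum scalar_prod_def atLeast0LessThan)

lemma skew_part_form:
  assumes M: "M \<in> carrier_mat m m" and v: "v \<in> carrier_vec m"
  shows "Re (((\<i> \<cdot>\<^sub>m (M - mat_adjoint M)) *\<^sub>v v) \<bullet>c v) = - 2 * Im ((M *\<^sub>v v) \<bullet>c v)"
proof -
  note aM = mat_adjoint_carrier[OF M]
  have Mv: "M *\<^sub>v v \<in> carrier_vec m" "mat_adjoint M *\<^sub>v v \<in> carrier_vec m" using M aM v by auto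
  have "(\<i> \<cdot>\<^sub>m (M - mat_adjoint M)) *\<^sub>v v = \<i> \<cdot>\<^sub>v ((M - mat_adjoint M) *\<^sub>v v)"
    using minus_carrier_mat[OF aM, of M] v by (intro eq_vecI) auto
  also have "(M - mat_adjoint M) *\<^sub>v v = M *\<^sub>v v - mat_adjoint M *\<^sub>v v"
    using M aM v by (intro minus_mult_distrib_mat_vec[of _ m m]) auto
  finally have "((\<i> \<cdot>\<^sub>m (M - mat_adjoint M)) *\<^sub>v v) \<bullet>c v = \<i> * ((M *\<^sub>v v) \<bullet>c v - (mat_adjoint M *\<^sub>v v) \<bullet>c v)"
    using Mv v by (simp add: cinner_smult_left[of _ m] cinner_diff_left[of _ m])
  also have "(mat_adjoint M *\<^sub>v v) \<bullet>c v = cnj ((M *\<^sub>v v) \<bullet>c v)"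
    using cinner_mult_adjoint[OF aM v v] cinner_commute[of v m "M *\<^sub>v v"] Mv v by simp
  finally show ?thesis by simp
qed

lemma complex_of_real_pos: "0 < complex_of_real x \<longleftrightarrow> 0 < x"
  by (simp add: less_complex_def)

text \<open>Both halves of the imaginary axis in one inequality. The defining property concerns
  positive frequencies; since \<open>G\<close> has real coefficients, conjugation carries it to
  negative ones and reverses the sign of the imaginary part, which the factor
  \<open>\<omega>\<close> absorbs.\<close>

definition axis_nonneg :: "nat \<Rightarrow> tfm \<Rightarrow> bool" where
  "axis_nonneg m G \<longleftrightarrow> (\<forall>\<omega> v. \<omega> \<noteq> 0 \<longrightarrow> \<not> tf_pole G (\<i> * complex_of_real \<omega>) \<longrightarrow> v \<in> carrier_vec m \<longrightarrow>
    \<omega> * Im ((tf_eval G (\<i> * complex_of_real \<omega>) *\<^sub>v v) \<bullet>c v) \<le> 0)"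

lemma axis_nonnegI:
  assumes G: "G \<in> carrier_mat m m"
    and nn: "\<And>\<omega>. \<omega> > 0 \<Longrightarrow> \<not> tf_pole G (\<i> * complex_of_real \<omega>) \<Longrightarrow>
        pos_semidef (\<i> \<cdot>\<^sub>m (tf_eval G (\<i> * complex_of_real \<omega>) - mat_adjoint (tf_eval G (\<i> * complex_of_real \<omega>))))"
  shows "axis_nonneg m G"
proof -
  have pos: "Im ((tf_eval G (\<i> * complex_of_real \<omega>) *\<^sub>v v) \<bullet>c v) \<le> 0"
    if "\<omega> > 0" "\<not> tf_pole G (\<i> * complex_of_real \<omega>)" "v \<in> carrier_vec m" for \<omega> v
    using nn[OF that(1,2)] skew_part_form[OF tf_eval_carrier[OF G] that(3), of "\<i> * complex_of_real \<omega>"] that(3) G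
    by (auto simp: pos_semidef_def tf_eval_def)
  show ?thesis
    unfolding axis_nonneg_def
  proof (intro allI impI)
    fix \<omega> :: real and v :: "complex vec"
    assume w: "\<omega> \<noteq> 0" and np: "\<not> tf_pole G (\<i> * complex_of_real \<omega>)" and v: "v \<in> carrier_vec m"
    show "\<omega> * Im ((tf_eval G (\<i> * complex_of_real \<omega>) *\<^sub>v v) \<bullet>c v) \<le> 0"
    proof (cases "\<omega> > 0")
      case True
      then show ?thesis using pos[OF True np v] by (simp add: mult_nonneg_nonpos)
    next
      case False
      then have n: "- \<omega> > 0" using w by simp
      have cn: "\<i> * complex_of_real (- \<omega>) = cnj (\<i> * complex_of_real \<omega>)" by simp
      have np': "\<not> tf_pole G (\<i> * complex_of_real (- \<omega>))" unfolding cn tf_pole_cnj by (rule np)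
      have "tf_eval G (\<i> * complex_of_real (- \<omega>)) = map_mat cnj (tf_eval G (\<i> * complex_of_real \<omega>))" unfolding cn tf_eval_cnj ..
      then have "Im ((map_mat cnj (tf_eval G (\<i> * complex_of_real \<omega>)) *\<^sub>v conjugate v) \<bullet>c conjugate v) \<le> 0"
        using pos[OF n np', of "conjugate v"] v by simp
      then have "Im ((tf_eval G (\<i> * complex_of_real \<omega>) *\<^sub>v v) \<bullet>c v) \<ge> 0"
        using cnj_mat_form[OF tf_eval_carrier[OF G], of "conjugate v"] v by simp
      then show ?thesis using n by (simp add: mult_nonpos_nonneg)
    qed
  qed
qed

lemma negative_imaginary_axis_nonneg: "negative_imaginary m G \<Longrightarrow> axis_nonneg m G"
  by (rule axis_nonnegI) (auto simp: negative_imaginary_def complex_of_real_pos)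

lemma pos_def_imp_pos_semidef: "pos_def A \<Longrightarrow> pos_semidef A"
proof -
  assume A: "pos_def A"
  have "0 \<le> Re ((A *\<^sub>v v) \<bullet>c v)" if v: "v \<in> carrier_vec (dim_row A)" for v
  proof (cases "v = 0\<^sub>v (dim_row A)")
    case True
    have "A *\<^sub>v 0\<^sub>v (dim_row A) \<in> carrier_vec (dim_row A)" by (intro carrier_vecI) simp
    then show ?thesis by (simp add: True)
  next
    case False
    then show ?thesis using A v by (auto simp: pos_def_def intro: less_imp_le)
  qed
  then show ?thesis using A by (auto simp: pos_semidef_def pos_def_def)
qed

lemma strictly_negative_imaginary_axis_nonneg: "strictly_negative_imaginary m G \<Longrightarrow> axis_nonneg m G"
  by (rule axis_nonnegI) (auto simp: strictly_negative_imaginary_def complex_of_real_pos intro: pos_def_imp_pos_semidef)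

lemma strictly_negative_imaginary_strict:
  assumes "strictly_negative_imaginary m G" "\<omega> > 0" "v \<in> carrier_vec m" "v \<noteq> 0\<^sub>v m"
  shows "Im ((tf_eval G (\<i> * complex_of_real \<omega>) *\<^sub>v v) \<bullet>c v) < 0"
proof -
  have G: "G \<in> carrier_mat m m" and
    "pos_def (\<i> \<cdot>\<^sub>m (tf_eval G (\<i> * complex_of_real \<omega>) - mat_adjoint (tf_eval G (\<i> * complex_of_real \<omega>))))"
    using assms(1,2) by (auto simp: strictly_negative_imaginary_def complex_of_real_pos)
  then have "0 < Re (((\<i> \<cdot>\<^sub>m (tf_eval G (\<i> * complex_of_real \<omega>) - mat_adjoint (tf_eval G (\<i> * complex_of_real \<omega>)))) *\<^sub>v v) \<bullet>c v)"
    using assms(3,4) by (auto simp: pos_def_def tf_eval_def)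
  then show ?thesis using skew_part_form[OF tf_eval_carrier[OF G] assms(3), of "\<i> * complex_of_real \<omega>"] by simp
qed

lemma filterlim_imaginary_axis:
  "filterlim (\<lambda>\<omega>. \<i> * complex_of_real \<omega>) (at (\<i> * complex_of_real a)) (at a within S)"
proof (rule filterlim_atI)
  show "((\<lambda>\<omega>. \<i> * complex_of_real \<omega>) \<longlongrightarrow> \<i> * complex_of_real a) (at a within S)"
    by (intro tendsto_intros)
  show "\<forall>\<^sub>F x in at a within S. \<i> * complex_of_real x \<noteq> \<i> * complex_of_real a"
    by (auto simp: eventually_at_filter)
qed

text \<open>The imaginary part of the form has opposite signs on the two halves of the imaginary axis.\<close>

lemma hermitian_limit_at_0:
  assumes L: "L \<in> carrier_mat m m" and f: "\<And>s. f s \<in> carrier_mat m m"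
    and lim: "\<And>i j. i < m \<Longrightarrow> j < m \<Longrightarrow> ((\<lambda>s. f s $$ (i, j)) \<longlongrightarrow> L $$ (i, j)) (at 0)"
    and sgn: "\<And>v. v \<in> carrier_vec m \<Longrightarrow>
      eventually (\<lambda>\<omega>. \<omega> * Im ((f (\<i> * complex_of_real \<omega>) *\<^sub>v v) \<bullet>c v) \<le> 0) (at 0)"
  shows "hermitian_mat L"
proof (rule hermitian_matI_real_form[OF L])
  fix v :: "complex vec" assume v: "v \<in> carrier_vec m"
  have 0: "\<i> * complex_of_real 0 = 0" by simp
  have "vec_tendsto m (\<lambda>s. f s *\<^sub>v v) (L *\<^sub>v v) (at 0)"
    using L f lim v by (intro vec_tendsto_mult_mat_fun[where n = m] vec_tendsto_const) auto
  then have "((\<lambda>s. (f s *\<^sub>v v) \<bullet>c v) \<longlongrightarrow> (L *\<^sub>v v) \<bullet>c v) (at 0)"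
    using v by (intro tendsto_cinner[where n = m] vec_tendsto_const) auto
  then have *: "((\<lambda>\<omega>. Im ((f (\<i> * complex_of_real \<omega>) *\<^sub>v v) \<bullet>c v)) \<longlongrightarrow> Im ((L *\<^sub>v v) \<bullet>c v)) (at 0 within S)" for S
    using filterlim_compose[OF _ filterlim_imaginary_axis[of 0 S, unfolded 0]] by (intro tendsto_Im) blast
  have sg: "eventually (\<lambda>\<omega>. \<omega> * Im ((f (\<i> * complex_of_real \<omega>) *\<^sub>v v) \<bullet>c v) \<le> 0) (at 0 within S)" for S
    using sgn[OF v] by (rule filter_leD[OF at_le, rotated]) simp
  have "Im ((L *\<^sub>v v) \<bullet>c v) \<le> 0"
  proof (rule tendsto_upperbound[OF *[of "{0<..}"]])
    show "eventually (\<lambda>\<omega>. Im ((f (\<i> * complex_of_real \<omega>) *\<^sub>v v) \<bullet>c v) \<le> 0) (at_right 0)"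
      using sg eventually_at_right_less[of "0::real"] by eventually_elim (auto simp: mult_le_0_iff)
  qed simp
  moreover have "Im ((L *\<^sub>v v) \<bullet>c v) \<ge> 0"
  proof (rule tendsto_lowerbound[OF *[of "{..<0}"]])
    have "eventually (\<lambda>\<omega>::real. \<omega> < 0) (at_left 0)" by (auto simp: eventually_at_filter)
    then show "eventually (\<lambda>\<omega>. 0 \<le> Im ((f (\<i> * complex_of_real \<omega>) *\<^sub>v v) \<bullet>c v)) (at_left 0)"
      using sg[of "{..<0}"] by eventually_elim (auto simp: mult_le_0_iff)
  qed simp
  ultimately show "Im ((L *\<^sub>v v) \<bullet>c v) = 0" by simp
qed

section \<open>Laurent expansion at the origin\<close>

lemma rational_limit_reduce:
  fixes P Q :: "complex poly"
  assumes "Q \<noteq> 0" "((\<lambda>s. poly P s / poly Q s) \<longlongrightarrow> L) (at a)"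
  shows "\<exists>p q. poly q a \<noteq> 0 \<and> eventually (\<lambda>s. poly P s / poly Q s = poly p s / poly q s) (at a)"
  using assms
proof (induction "degree Q" arbitrary: P Q)
  case 0
  then obtain c where "Q = [:c:]" by (metis degree_eq_zeroE)
  with 0 show ?case by (intro exI[of _ P] exI[of _ Q]) auto
next
  case (Suc n Q P)
  show ?case
  proof (cases "poly Q a = 0")
    case False
    then show ?thesis by (intro exI[of _ P] exI[of _ Q]) auto
  next
    case True
    have ev: "eventually (\<lambda>s. poly Q s \<noteq> 0) (at a)" using Suc.prems(1) by (rule eventually_poly_nonzero_at)
    \<comment> \<open>A finite limit at a root of \<open>Q\<close> forces \<open>P\<close> to vanish
      there too, so a common linear factor cancels.\<close>
    have "((\<lambda>s. poly P s / poly Q s * poly Q s) \<longlongrightarrow> L * poly Q a) (at a)"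
      using Suc.prems(2) by (intro tendsto_intros)
    moreover have "eventually (\<lambda>s. poly P s / poly Q s * poly Q s = poly P s) (at a)"
      using ev by eventually_elim simp
    ultimately have "((\<lambda>s. poly P s) \<longlongrightarrow> 0) (at a)" using True by (simp add: tendsto_cong)
    moreover have "((\<lambda>s. poly P s) \<longlongrightarrow> poly P a) (at a)" by (intro tendsto_intros)
    ultimately have "poly P a = 0" using LIM_unique by blast
    then obtain P1 Q1 where *: "P = [:-a, 1:] * P1" "Q = [:-a, 1:] * Q1"
      using True by (metis dvdE poly_eq_0_iff_dvd)
    have Q1: "Q1 \<noteq> 0" using Suc.prems(1) * by auto
    have "degree Q = Suc (degree Q1)" unfolding *(2) using Q1 by (subst degree_mult_eq) auto
    then have d: "n = degree Q1" using Suc.hyps(2) by simp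
    have evq: "eventually (\<lambda>s. poly P s / poly Q s = poly P1 s / poly Q1 s) (at a)"
      using ev
    proof eventually_elim
      case (elim s)
      have "poly P s = (s - a) * poly P1 s" "poly Q s = (s - a) * poly Q1 s" by (simp_all add: * algebra_simps)
      then show ?case using elim by simp
    qed
    then have "((\<lambda>s. poly P1 s / poly Q1 s) \<longlongrightarrow> L) (at a)" using Suc.prems(2) by (simp add: tendsto_cong)
    from Suc.hyps(1)[OF d Q1 this] obtain p q where pq: "poly q a \<noteq> 0"
      "eventually (\<lambda>s. poly P1 s / poly Q1 s = poly p s / poly q s) (at a)" by blast
    from evq pq(2) have "eventually (\<lambda>s. poly P s / poly Q s = poly p s / poly q s) (at a)"
      by eventually_elim simp
    with pq(1) show ?thesis by blast
  qed
qed

lemma rational_difference_quotient: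
  fixes p q :: "complex poly"
  assumes q: "poly q a \<noteq> 0"
  shows "\<exists>p1. eventually (\<lambda>s. (poly p s / poly q s - poly p a / poly q a) / (s - a) = poly p1 s / poly q s) (at a)"
proof -
  define c where "c = poly p a / poly q a"
  have "poly (p - Polynomial.smult c q) a = 0" using q by (simp add: c_def)
  then obtain p1 where p1: "p - Polynomial.smult c q = [:-a, 1:] * p1" by (metis dvdE poly_eq_0_iff_dvd)
  have "q \<noteq> 0" using q by auto
  then have "eventually (\<lambda>s. poly q s \<noteq> 0) (at a)" by (rule eventually_poly_nonzero_at)
  moreover have "eventually (\<lambda>s. s \<noteq> a) (at a)" by (simp add: eventually_at_filter)
  ultimately have "eventually (\<lambda>s. (poly p s / poly q s - c) / (s - a) = poly p1 s / poly q s) (at a)"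
  proof eventually_elim
    case (elim s)
    have "poly p s - c * poly q s = (s - a) * poly p1 s"
      using arg_cong[OF p1, of "\<lambda>r. poly r s"] by (simp add: algebra_simps)
    moreover have "poly p s / poly q s - c = (poly p s - c * poly q s) / poly q s"
      using elim by (simp add: diff_divide_distrib)
    ultimately show ?case using elim by simp
  qed
  then show ?thesis unfolding c_def by blast
qed

text \<open>The product \<open>s\<^sup>2 g\<close> has a removable singularity at 0, and two
  successive difference quotients produce the next two coefficients. So the limits behind
  \<open>G1\<close> and \<open>G0\<close> exist and \<open>Lim\<close> returns them.\<close>

lemma rational_laurent_limits:
  assumes lim: "((\<lambda>s. s\<^sup>2 * rat_eval g s) \<longlongrightarrow> g2) (at 0)"
  shows "\<exists>g1 g0. ((\<lambda>s. s * (rat_eval g s - g2 / s\<^sup>2)) \<longlongrightarrow> g1) (at 0) \<and>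
    ((\<lambda>s. rat_eval g s - g2 / s\<^sup>2 - g1 / s) \<longlongrightarrow> g0) (at 0)"
proof -
  have nz: "eventually (\<lambda>s::complex. s \<noteq> 0) (at 0)" by (simp add: eventually_at_filter)
  have cd: "cdenom g \<noteq> 0" by (simp add: cdenom_def)
  have rep: "s\<^sup>2 * rat_eval g s = poly ([:0, 0, 1:] * cnumer g) s / poly (cdenom g) s" for s
    by (simp add: rat_eval_def power2_eq_square)
  obtain p q where pq: "poly q 0 \<noteq> 0"
    "eventually (\<lambda>s. s\<^sup>2 * rat_eval g s = poly p s / poly q s) (at 0)"
    using rational_limit_reduce[OF cd lim[unfolded rep]] unfolding rep by blast
  have cont: "((\<lambda>s. poly r s / poly q s) \<longlongrightarrow> poly r 0 / poly q 0) (at 0)" for r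
    using pq(1) by (intro tendsto_intros)
  have g2: "g2 = poly p 0 / poly q 0"
    using tendsto_unique[OF _ lim, of "poly p 0 / poly q 0"] cont[of p] pq(2) by (simp add: tendsto_cong)
  obtain p1 where p1: "eventually (\<lambda>s. (poly p s / poly q s - g2) / (s - 0) = poly p1 s / poly q s) (at 0)"
    using rational_difference_quotient[OF pq(1), of p] by (auto simp: g2)
  define g1 where "g1 = poly p1 0 / poly q 0"
  obtain p2 where p2: "eventually (\<lambda>s. (poly p1 s / poly q s - g1) / (s - 0) = poly p2 s / poly q s) (at 0)"
    using rational_difference_quotient[OF pq(1), of p1] by (auto simp: g1_def)
  have e1: "eventually (\<lambda>s. poly p1 s / poly q s = s * (rat_eval g s - g2 / s\<^sup>2)) (at 0)"
    using p1 pq(2) nz by eventually_elim (auto simp: field_simps power2_eq_square)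
  have e0: "eventually (\<lambda>s. poly p2 s / poly q s = rat_eval g s - g2 / s\<^sup>2 - g1 / s) (at 0)"
    using p2 e1 nz
  proof eventually_elim
    case (elim s)
    have "poly p2 s / poly q s = (s * (rat_eval g s - g2 / s\<^sup>2) - g1) / s" using elim by simp
    also have "\<dots> = rat_eval g s - g2 / s\<^sup>2 - g1 / s" using elim(3) by (simp add: diff_divide_distrib)
    finally show ?case .
  qed
  have "((\<lambda>s. s * (rat_eval g s - g2 / s\<^sup>2)) \<longlongrightarrow> g1) (at 0)"
    using cont[of p1] tendsto_cong[OF e1] by (simp add: g1_def)
  moreover have "((\<lambda>s. rat_eval g s - g2 / s\<^sup>2 - g1 / s) \<longlongrightarrow> poly p2 0 / poly q 0) (at 0)"
    using cont[of p2] tendsto_cong[OF e0] by simp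
  ultimately show ?thesis by blast
qed

lemma negative_imaginary_expansion_at_0:
  assumes ni: "negative_imaginary m G" and g1: "G1 m G = 0\<^sub>m m m" and g2: "G2 m G \<noteq> 0\<^sub>m m m"
  shows "pos_semidef (G2 m G)" "G2 m G \<in> carrier_mat m m" "G0 m G \<in> carrier_mat m m"
    "\<And>i j. i < m \<Longrightarrow> j < m \<Longrightarrow>
      ((\<lambda>s. (tf_eval G s - (1 / s\<^sup>2) \<cdot>\<^sub>m G2 m G) $$ (i, j)) \<longlongrightarrow> G0 m G $$ (i, j)) (at 0)"
proof -
  have G: "G \<in> carrier_mat m m" using ni by (simp add: negative_imaginary_def)
  show G2: "G2 m G \<in> carrier_mat m m" and "G0 m G \<in> carrier_mat m m"
    by (simp_all add: G2_def G0_def mat_Lim_def)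
  \<comment> \<open>Without a pole at 0 the limit \<open>G2\<close> would vanish. Hence the clause
    of negative imaginariness about the origin applies.\<close>
  have "tf_pole G 0"
  proof (rule ccontr)
    assume np: "\<not> tf_pole G 0"
    have "G2 m G $$ (i, j) = 0" if ij: "i < m" "j < m" for i j
    proof -
      have "((\<lambda>s. s\<^sup>2 * tf_eval G s $$ (i, j)) \<longlongrightarrow> 0\<^sup>2 * tf_eval G 0 $$ (i, j)) (at 0)"
        using ij G by (intro tendsto_intros tendsto_tf_eval[OF np]) auto
      then have "Lim (at 0) (\<lambda>s. (s\<^sup>2 \<cdot>\<^sub>m tf_eval G s) $$ (i, j)) = 0"
        using ij G by (intro tendsto_Lim) (auto simp: tf_eval_def)
      then show ?thesis using ij by (simp add: G2_def mat_Lim_def)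
    qed
    then have "G2 m G = 0\<^sub>m m m" using G2 by (intro eq_matI) auto
    with g2 show False by simp
  qed
  then obtain K where K: "mat_tendsto m (\<lambda>s. s\<^sup>2 \<cdot>\<^sub>m tf_eval G s) K (at 0)" "pos_semidef K"
    using ni by (auto simp: negative_imaginary_def)
  have Kij: "((\<lambda>s. s\<^sup>2 * rat_eval (G $$ (i, j)) s) \<longlongrightarrow> K $$ (i, j)) (at 0)" if "i < m" "j < m" for i j
    using K(1) that G by (simp add: mat_tendsto_def tf_eval_alt)
  have "G2 m G = K"
  proof (rule eq_matI)
    fix i j assume "i < dim_row K" "j < dim_col K"
    then have ij: "i < m" "j < m" using K(1) by (auto simp: mat_tendsto_def)
    have "Lim (at 0) (\<lambda>s. (s\<^sup>2 \<cdot>\<^sub>m tf_eval G s) $$ (i, j)) = K $$ (i, j)"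
      using Kij[OF ij] ij G by (intro tendsto_Lim) (auto simp: tf_eval_alt)
    then show "G2 m G $$ (i, j) = K $$ (i, j)" using ij by (simp add: G2_def mat_Lim_def)
  qed (use K(1) G2 in \<open>auto simp: mat_tendsto_def\<close>)
  then show "pos_semidef (G2 m G)" using K by simp
  fix i j assume ij: "i < m" "j < m"
  let ?g = "G $$ (i, j)" and ?g2 = "G2 m G $$ (i, j)"
  obtain a b where a: "((\<lambda>s. s * (rat_eval ?g s - ?g2 / s\<^sup>2)) \<longlongrightarrow> a) (at 0)"
    and b: "((\<lambda>s. rat_eval ?g s - ?g2 / s\<^sup>2 - a / s) \<longlongrightarrow> b) (at 0)"
    using rational_laurent_limits[OF Kij[OF ij]] unfolding \<open>G2 m G = K\<close> by blast
  \<comment> \<open>The value of \<open>Lim\<close> in the definition of \<open>G1\<close> is the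
    Laurent coefficient \<open>a\<close>, so \<open>G1 = 0\<close> removes the simple pole term of
    the entry.\<close>
  have "Lim (at 0) (\<lambda>s. (s \<cdot>\<^sub>m (tf_eval G s - (1 / s\<^sup>2) \<cdot>\<^sub>m G2 m G)) $$ (i, j)) = a"
    using a ij G G2 by (intro tendsto_Lim) (auto simp: tf_eval_alt)
  then have "a = G1 m G $$ (i, j)" using ij by (simp add: G1_def mat_Lim_def)
  then have a0: "a = 0" using g1 ij by simp
  have b': "((\<lambda>s. (tf_eval G s - (1 / s\<^sup>2) \<cdot>\<^sub>m G2 m G) $$ (i, j)) \<longlongrightarrow> b) (at 0)"
    using b ij G G2 by (simp add: a0 tf_eval_alt)
  moreover have "(tf_eval G s - (1 / s\<^sup>2) \<cdot>\<^sub>m G2 m G - (1 / s) \<cdot>\<^sub>m G1 m G) $$ (i, j) =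
      (tf_eval G s - (1 / s\<^sup>2) \<cdot>\<^sub>m G2 m G) $$ (i, j)" for s
    using ij G G2 by (simp add: g1 tf_eval_alt)
  ultimately have "Lim (at 0) (\<lambda>s. (tf_eval G s - (1 / s\<^sup>2) \<cdot>\<^sub>m G2 m G - (1 / s) \<cdot>\<^sub>m G1 m G) $$ (i, j)) = b"
    by (intro tendsto_Lim) simp_all
  then have "b = G0 m G $$ (i, j)" using ij by (simp add: G0_def mat_Lim_def)
  then show "((\<lambda>s. (tf_eval G s - (1 / s\<^sup>2) \<cdot>\<^sub>m G2 m G) $$ (i, j)) \<longlongrightarrow> G0 m G $$ (i, j)) (at 0)"
    using b' by simp
qed

lemma transfer_form_rational:
  assumes R: "realization m n A B C D G" and a: "a \<in> carrier_vec m" and b: "b \<in> carrier_vec m"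
  shows "\<exists>P. (P = 0 \<or> degree P < n) \<and> (\<forall>s. poly (char_poly (cmat A)) s \<noteq> 0 \<longrightarrow>
      (tf_eval G s *\<^sub>v b) \<bullet>c a = poly P s / poly (char_poly (cmat A)) s + (cmat D *\<^sub>v b) \<bullet>c a)"
proof -
  have c: "cmat A \<in> carrier_mat n n" "cmat B \<in> carrier_mat n m" "cmat C \<in> carrier_mat m n" "cmat D \<in> carrier_mat m m"
    using R by (auto simp: realization_def)
  note aC = mat_adjoint_carrier[OF c(3)]
  have Bb: "cmat B *\<^sub>v b \<in> carrier_vec n" and Ca: "mat_adjoint (cmat C) *\<^sub>v a \<in> carrier_vec n"
    using c a b aC by auto
  let ?chi = "char_poly (cmat A)"
  obtain P where P: "P = 0 \<or> degree P < n"
    "\<And>s x. poly ?chi s \<noteq> 0 \<Longrightarrow> x \<in> carrier_vec n \<Longrightarrow> s \<cdot>\<^sub>v x = cmat A *\<^sub>v x + cmat B *\<^sub>v b \<Longrightarrow>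
      x \<bullet>c (mat_adjoint (cmat C) *\<^sub>v a) = poly P s / poly ?chi s"
    using resolvent_form_numerator[OF c(1) Bb Ca] by blast
  have "(tf_eval G s *\<^sub>v b) \<bullet>c a = poly P s / poly ?chi s + (cmat D *\<^sub>v b) \<bullet>c a" if s: "poly ?chi s \<noteq> 0" for s
  proof -
    obtain x where x: "x \<in> carrier_vec n" "s \<cdot>\<^sub>v x = cmat A *\<^sub>v x + cmat B *\<^sub>v b"
      using resolvent_exists[OF c(1) s Bb] by blast
    have "tf_eval G s *\<^sub>v b = cmat C *\<^sub>v x + cmat D *\<^sub>v b"
      by (rule tf_eval_realization(2)[OF R s x(1) b x(2)])
    then have "(tf_eval G s *\<^sub>v b) \<bullet>c a = x \<bullet>c (mat_adjoint (cmat C) *\<^sub>v a) + (cmat D *\<^sub>v b) \<bullet>c a"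
      using c x(1) a b cinner_mult_adjoint[OF c(3) x(1) a] by (simp add: cinner_add_left[of _ m])
    then show ?thesis using P(2)[OF s x] by simp
  qed
  with P(1) show ?thesis by blast
qed

text \<open>The functions fed into the half plane principle are assembled from these numerators. The
  stricter bound for \<open>D = 0\<close> leaves room for a factor \<open>s\<^sup>2\<close> over the
  denominator \<open>s \<chi>\<close>, where \<open>\<chi>\<close> is the characteristic
  polynomial.\<close>

lemma transfer_form_numerator:
  assumes R: "realization m n A B C D G" and a: "a \<in> carrier_vec m" and b: "b \<in> carrier_vec m"
  shows "\<exists>P. degree P \<le> n \<and> (D = 0\<^sub>m m m \<longrightarrow> P = 0 \<or> degree P < n) \<and>
    (\<forall>s. poly (char_poly (cmat A)) s \<noteq> 0 \<longrightarrow>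
      (tf_eval G s *\<^sub>v b) \<bullet>c a = poly P s / poly (char_poly (cmat A)) s)"
proof -
  let ?chi = "char_poly (cmat A)"
  define d where "d = (cmat D *\<^sub>v b) \<bullet>c a"
  obtain P where P: "P = 0 \<or> degree P < n"
    "\<And>s. poly ?chi s \<noteq> 0 \<Longrightarrow> (tf_eval G s *\<^sub>v b) \<bullet>c a = poly P s / poly ?chi s + d"
    using transfer_form_rational[OF R a b] unfolding d_def by blast
  define N where "N = P + Polynomial.smult d ?chi"
  have "cmat A \<in> carrier_mat n n" using R by (auto simp: realization_def)
  then have "degree ?chi = n" using degree_monic_char_poly by blast
  then have "degree N \<le> n"
    unfolding N_def using P(1) by (intro degree_add_le) (auto intro: order_trans[OF degree_smult_le])
  moreover have "N = 0 \<or> degree N < n" if "D = 0\<^sub>m m m"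
  proof -
    have "cmat D *\<^sub>v b = 0\<^sub>v m" using b unfolding that by (intro eq_vecI) (auto simp: scalar_prod_def)
    then have "d = 0" using a by (simp add: d_def)
    then show ?thesis using P(1) by (simp add: N_def)
  qed
  moreover have "(tf_eval G s *\<^sub>v b) \<bullet>c a = poly N s / poly ?chi s" if "poly ?chi s \<noteq> 0" for s
    using P(2)[OF that] that by (simp add: N_def add_divide_distrib)
  ultimately show ?thesis by blast
qed

text \<open>Each entry of \<open>G\<close> is a strictly proper fraction plus the entry of
  \<open>D\<close>, which is therefore its limit at infinity.\<close>

lemma strictly_proper_feedthrough:
  assumes R: "realization m n A B C D G" and sp: "strictly_proper m G"
  shows "D = 0\<^sub>m m m"
proof -
  have D: "D \<in> carrier_mat m m" and cA: "cmat A \<in> carrier_mat n n" using R by (auto simp: realization_def)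
  have G: "G \<in> carrier_mat m m" using R rat_const_carrier[OF D] by (auto simp: realization_def)
  let ?chi = "char_poly (cmat A)"
  have dchi: "degree ?chi = n" using degree_monic_char_poly[OF cA] by simp
  have chi0: "?chi \<noteq> 0" by (rule char_poly_nonzero[OF cA])
  have "bounded {s. poly ?chi s = 0}" using poly_roots_finite[OF chi0] by (rule finite_imp_bounded)
  then obtain b where b: "\<And>s. poly ?chi s = 0 \<Longrightarrow> norm s \<le> b" by (auto simp: bounded_iff)
  have ev: "eventually (\<lambda>s. poly ?chi s \<noteq> 0) at_infinity"
    by (rule eventually_at_infinityI[of "b + 1"]) (use b in force)
  have unit: "(M *\<^sub>v unit_vec m j) \<bullet>c unit_vec m i = M $$ (i, j)"
    if "M \<in> carrier_mat m m" "i < m" "j < m" for M :: "complex mat" and i j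
  proof -
    have "(M *\<^sub>v unit_vec m j) \<bullet>c unit_vec m i = (\<Sum>k<m. if k = i then M $$ (k, j) else 0)"
      unfolding cinner_sum using that by (intro sum.cong) (auto simp: scalar_prod_right_unit)
    then show ?thesis using that by simp
  qed
  have "D $$ (i, j) = 0" if ij: "i < m" "j < m" for i j
  proof -
    obtain P where P: "P = 0 \<or> degree P < n" "\<And>s. poly ?chi s \<noteq> 0 \<Longrightarrow>
        (tf_eval G s *\<^sub>v unit_vec m j) \<bullet>c unit_vec m i = poly P s / poly ?chi s + (cmat D *\<^sub>v unit_vec m j) \<bullet>c unit_vec m i"
      using transfer_form_rational[OF R, of "unit_vec m i" "unit_vec m j"] by auto
    have "((\<lambda>s. poly P s / poly ?chi s) \<longlongrightarrow> coeff P n / lead_coeff ?chi) at_infinity"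
      using poly_quotient_tendsto_at_infinity[OF chi0, of P] P(1) dchi by auto
    moreover have "coeff P n = 0" using P(1) by (auto simp: coeff_eq_0)
    ultimately have "((\<lambda>s. poly P s / poly ?chi s + D $$ (i, j)) \<longlongrightarrow> 0 + complex_of_real (D $$ (i, j))) at_infinity"
      by (intro tendsto_intros) simp
    moreover have "eventually (\<lambda>s. poly P s / poly ?chi s + D $$ (i, j) = tf_eval G s $$ (i, j)) at_infinity"
      using ev
    proof eventually_elim
      case (elim s)
      then show ?case
        using P(2)[OF elim] unit[OF tf_eval_carrier[OF G] ij] unit[of "cmat D" i j] D ij by simp
    qed
    ultimately have "((\<lambda>s. tf_eval G s $$ (i, j)) \<longlongrightarrow> complex_of_real (D $$ (i, j))) at_infinity"
      by (simp add: tendsto_cong)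
    moreover have "((\<lambda>s. tf_eval G s $$ (i, j)) \<longlongrightarrow> 0) at_infinity"
      using sp ij by (simp add: strictly_proper_def mat_tendsto_def)
    ultimately have "complex_of_real (D $$ (i, j)) = 0" by (rule tendsto_unique[rotated]) (rule trivial_limit_at_infinity)
    then show ?thesis by simp
  qed
  then show ?thesis using D by (intro eq_matI) auto
qed

section \<open>Energy inequalities\<close>

lemma Re_divide_nonneg_iff:
  assumes "s \<noteq> 0"
  shows "0 \<le> Re (z / s) \<longleftrightarrow> 0 \<le> Re (cnj s * z)"
proof -
  have "z / s = (cnj s * z) / complex_of_real ((cmod s)\<^sup>2)"
    using complex_div_cnj[of z s] by (simp add: mult.commute)
  then have "Re (z / s) = Re (cnj s * z) / (cmod s)\<^sup>2" by (simp only: Re_divide_of_real)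
  then show ?thesis using assms by (simp add: zero_le_divide_iff)
qed

lemma Re_divide_imaginary: "Re (z / (\<i> * complex_of_real \<omega>)) = Im z / \<omega>"
  by (cases "\<omega> = 0") (simp_all add: Re_divide power2_eq_square)

lemma form_tendsto:
  fixes M :: "'a \<Rightarrow> complex mat"
  assumes "\<And>s. M s \<in> carrier_mat m m" "N \<in> carrier_mat m m"
    and "\<And>i j. i < m \<Longrightarrow> j < m \<Longrightarrow> ((\<lambda>s. M s $$ (i, j)) \<longlongrightarrow> N $$ (i, j)) F"
    and "b \<in> carrier_vec m" "c \<in> carrier_vec m"
  shows "((\<lambda>s. (M s *\<^sub>v b) \<bullet>c c) \<longlongrightarrow> (N *\<^sub>v b) \<bullet>c c) F"
  using assms by (intro tendsto_cinner[where n = m] vec_tendsto_mult_mat_fun[where n = m] vec_tendsto_const) auto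

lemma minimal_eventually_not_pole:
  assumes "minimal_realization m n A B C D G"
  shows "eventually (\<lambda>s. \<not> tf_pole G s) (at a)"
proof -
  have R: "realization m n A B C D G" using assms by (simp add: minimal_realization_def)
  then have "cmat A \<in> carrier_mat n n" by (auto simp: realization_def)
  then have "eventually (\<lambda>s. poly (char_poly (cmat A)) s \<noteq> 0) (at a)"
    by (intro eventually_poly_nonzero_at char_poly_nonzero)
  then show ?thesis
    by eventually_elim (use tf_eval_realization(1)[OF R] in \<open>auto simp: tf_pole_iff_not_regular\<close>)
qed

lemma sni_dc_gain_hermitian:
  assumes "strictly_negative_imaginary m G"
  shows "hermitian_mat (tf_eval G 0)"
proof (rule hermitian_limit_at_0[where f = "tf_eval G" and m = m])
  have G: "G \<in> carrier_mat m m" and np: "\<And>s. Re s \<ge> 0 \<Longrightarrow> \<not> tf_pole G s"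
    using assms by (auto simp: strictly_negative_imaginary_def)
  show "tf_eval G s \<in> carrier_mat m m" "tf_eval G 0 \<in> carrier_mat m m" for s
    using tf_eval_carrier[OF G] by auto
  show "((\<lambda>s. tf_eval G s $$ (i, j)) \<longlongrightarrow> tf_eval G 0 $$ (i, j)) (at 0)" if "i < m" "j < m" for i j
    using that G np[of 0] by (intro tendsto_tf_eval) auto
  show "eventually (\<lambda>\<omega>. \<omega> * Im ((tf_eval G (\<i> * complex_of_real \<omega>) *\<^sub>v v) \<bullet>c v) \<le> 0) (at 0)"
    if "v \<in> carrier_vec m" for v
    using strictly_negative_imaginary_axis_nonneg[OF assms] that np
    by (auto simp: axis_nonneg_def eventually_at_filter)
qed

text \<open>The half plane principle applied to \<open>u\<^sup>* (G(0) - G(s)) u / s\<close>.\<close>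

lemma sni_energy:
  assumes min: "minimal_realization m n A B C D G" and sni: "strictly_negative_imaginary m G"
    and u: "u \<in> carrier_vec m" and s: "Re s > 0"
  shows "Re (s * (u \<bullet>c (tf_eval G s *\<^sub>v u))) \<le> Re s * Re ((tf_eval G 0 *\<^sub>v u) \<bullet>c u)"
proof -
  have G: "G \<in> carrier_mat m m" and np: "\<And>s. Re s \<ge> 0 \<Longrightarrow> \<not> tf_pole G s"
    using sni by (auto simp: strictly_negative_imaginary_def)
  have R: "realization m n A B C D G" using min by (simp add: minimal_realization_def)
  then have cA: "cmat A \<in> carrier_mat n n" by (auto simp: realization_def)
  let ?chi = "char_poly (cmat A)"
  define g where "g = (\<lambda>s. (tf_eval G s *\<^sub>v u) \<bullet>c u)"
  have Gu: "tf_eval G s *\<^sub>v u \<in> carrier_vec m" for s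
    by (rule mult_mat_vec_carrier[OF tf_eval_carrier[OF G] u])
  have chi: "poly ?chi s \<noteq> 0" if "Re s \<ge> 0" for s
    using minimal_eigenvalue_imp_pole[OF min] np[OF that] by blast
  obtain P where P: "degree P \<le> n" "\<And>s. poly ?chi s \<noteq> 0 \<Longrightarrow> g s = poly P s / poly ?chi s"
    using transfer_form_numerator[OF R u u] unfolding g_def by blast
  \<comment> \<open>Because \<open>g 0\<close> is real, \<open>g 0 / s\<close> is purely imaginary
    on the axis and does not disturb the sign there.\<close>
  have g0: "Im (g 0) = 0"
    unfolding g_def by (rule hermitian_mat_Im_0[OF sni_dc_gain_hermitian[OF sni] tf_eval_carrier[OF G] u])
  define N where "N = Polynomial.smult (g 0) ?chi - P"
  define Q where "Q = [:0, 1:] * ?chi"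
  have dchi: "degree ?chi = n" using degree_monic_char_poly[OF cA] by simp
  have Q0: "Q \<noteq> 0" using char_poly_nonzero[OF cA] by (simp add: Q_def)
  have quot: "poly N s / poly Q s = (g 0 - g s) / s" if "Re s \<ge> 0" for s
    using chi[OF that] P(2)[OF chi[OF that]] by (cases "s = 0") (simp_all add: N_def Q_def field_simps)
  have dN: "degree N \<le> degree Q"
  proof -
    have "degree N \<le> n"
      unfolding N_def using P(1) dchi by (intro degree_diff_le) (auto intro: order_trans[OF degree_smult_le])
    then show ?thesis using dchi char_poly_nonzero[OF cA] by (simp add: Q_def)
  qed
  have "0 \<le> Re (poly N s / poly Q s)"
  proof (rule rational_nonneg_right_half_plane[OF Q0 dN, where F = "{0}"])
    show "poly Q s \<noteq> 0" if "0 < Re s" for s using chi[of s] that by (auto simp: Q_def)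
    show "0 \<le> Re (poly N (\<i> * complex_of_real \<omega>) / poly Q (\<i> * complex_of_real \<omega>))"
      if "\<i> * complex_of_real \<omega> \<notin> {0}" for \<omega>
    proof -
      have w: "\<omega> \<noteq> 0" using that by auto
      have "\<omega> * Im (g (\<i> * complex_of_real \<omega>)) \<le> 0"
        using strictly_negative_imaginary_axis_nonneg[OF sni] w u np[of "\<i> * complex_of_real \<omega>"]
        by (auto simp: axis_nonneg_def g_def)
      then have "0 \<le> - Im (g (\<i> * complex_of_real \<omega>)) / \<omega>"
        using w by (auto simp: divide_le_0_iff mult_le_0_iff)
      then show ?thesis by (subst quot) (simp_all only: Re_divide_imaginary, simp_all add: g0)
    qed
    show "\<exists>k\<ge>0. (\<lambda>s. (s - a) * (poly N s / poly Q s)) \<midarrow>a\<rightarrow> complex_of_real k"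
      if a: "Re a = 0" "poly Q a = 0" for a
    proof (intro exI[of _ 0] conjI)
      \<comment> \<open>The only root of \<open>Q\<close> on the axis is the origin; as
        \<open>N\<close> vanishes there too, the singularity is removable and the residue is
        0.\<close>
      have a0: "a = 0" using a chi[of a] by (auto simp: Q_def)
      have "((\<lambda>s. poly N s / poly ?chi s) \<longlongrightarrow> poly N 0 / poly ?chi 0) (at 0)"
        using chi[of 0] by (intro tendsto_intros) auto
      moreover have "poly N 0 = 0" using chi[of 0] P(2)[of 0] by (simp add: N_def)
      moreover have "eventually (\<lambda>s. (s - 0) * (poly N s / poly Q s) = poly N s / poly ?chi s) (at 0)"
        by (auto simp: eventually_at_filter Q_def)
      ultimately show "(\<lambda>s. (s - a) * (poly N s / poly Q s)) \<midarrow>a\<rightarrow> complex_of_real 0"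
        unfolding a0 by (simp add: tendsto_cong)
    qed simp
  qed (use s in auto)
  then have "0 \<le> Re ((g 0 - g s) / s)" using quot[of s] s by simp
  moreover have "s \<noteq> 0" using s by auto
  ultimately have "0 \<le> Re (cnj s * (g 0 - g s))" using Re_divide_nonneg_iff by blast
  then have "Re (cnj s * g s) \<le> Re s * Re (g 0)" using g0 by (simp add: algebra_simps)
  moreover have "Re (s * (u \<bullet>c (tf_eval G s *\<^sub>v u))) = Re (cnj s * g s)"
    unfolding g_def cinner_commute[OF u Gu] by simp
  ultimately show ?thesis by (simp add: g_def)
qed

text \<open>The residue is \<open>- \<i> K\<close> for the semidefinite limit \<open>K\<close> in
  the definition. Its form is written with the factor \<open>\<omega> k\<close> rather than as a
  plain nonnegative number, so that the same statement is correct for negative frequencies.\<close>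

lemma ni_residue_positive_frequency:
  assumes ni: "negative_imaginary m G" and w: "\<omega> > 0" and pole: "tf_pole G (\<i> * complex_of_real \<omega>)"
  shows "\<exists>R\<in>carrier_mat m m.
    (\<forall>i<m. \<forall>j<m. ((\<lambda>s. (s - \<i> * \<omega>) * tf_eval G s $$ (i, j)) \<longlongrightarrow> R $$ (i, j)) (at (\<i> * \<omega>))) \<and>
    (\<forall>v\<in>carrier_vec m. \<exists>k\<ge>0. \<i> * ((R *\<^sub>v v) \<bullet>c v) = complex_of_real (\<omega> * k))"
proof -
  have G: "G \<in> carrier_mat m m" using ni by (simp add: negative_imaginary_def)
  obtain K where K: "mat_tendsto m (\<lambda>s. ((s - \<i> * \<omega>) * \<i>) \<cdot>\<^sub>m tf_eval G s) K (at (\<i> * \<omega>))" "pos_semidef K"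
    using ni w pole by (auto simp: negative_imaginary_def complex_of_real_pos)
  then have Kc: "K \<in> carrier_mat m m" by (simp add: mat_tendsto_def)
  have "((\<lambda>s. (s - \<i> * \<omega>) * tf_eval G s $$ (i, j)) \<longlongrightarrow> ((- \<i>) \<cdot>\<^sub>m K) $$ (i, j)) (at (\<i> * \<omega>))"
    if ij: "i < m" "j < m" for i j
  proof -
    have "((\<lambda>s. (- \<i>) * ((s - \<i> * \<omega>) * \<i> * tf_eval G s $$ (i, j))) \<longlongrightarrow> (- \<i>) * K $$ (i, j)) (at (\<i> * \<omega>))"
      using K(1) ij G by (intro tendsto_mult_left) (simp add: mat_tendsto_def tf_eval_def)
    moreover have "(- \<i>) * ((s - \<i> * \<omega>) * \<i> * x) = (s - \<i> * \<omega>) * x" for s x by (simp add: algebra_simps)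
    ultimately show ?thesis using ij Kc by simp
  qed
  moreover have "\<exists>k\<ge>0. \<i> * ((((- \<i>) \<cdot>\<^sub>m K) *\<^sub>v v) \<bullet>c v) = complex_of_real (\<omega> * k)" if v: "v \<in> carrier_vec m" for v
  proof (intro exI conjI)
    let ?k = "Re ((K *\<^sub>v v) \<bullet>c v) / \<omega>"
    have "0 \<le> Re ((K *\<^sub>v v) \<bullet>c v)" and "hermitian_mat K" using K(2) v Kc by (auto simp: pos_semidef_def)
    then show "?k \<ge> 0" using w by simp
    have "Im ((K *\<^sub>v v) \<bullet>c v) = 0" by (rule hermitian_mat_Im_0[OF \<open>hermitian_mat K\<close> Kc v])
    moreover have "((- \<i>) \<cdot>\<^sub>m K) *\<^sub>v v = (- \<i>) \<cdot>\<^sub>v (K *\<^sub>v v)" using Kc v by (intro eq_vecI) auto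
    ultimately show "\<i> * ((((- \<i>) \<cdot>\<^sub>m K) *\<^sub>v v) \<bullet>c v) = complex_of_real (\<omega> * ?k)"
      using w Kc v by (simp add: cinner_smult_left[of _ m] complex_eq_iff)
  qed
  ultimately show ?thesis using Kc by (intro bexI[of _ "(- \<i>) \<cdot>\<^sub>m K"]) auto
qed

text \<open>For a negative frequency the residue is the entrywise conjugate of the one at the
  opposite frequency, as \<open>G\<close> has real coefficients.\<close>

lemma ni_residue:
  assumes ni: "negative_imaginary m G" and w: "\<omega> \<noteq> 0" and pole: "tf_pole G (\<i> * complex_of_real \<omega>)"
  shows "\<exists>R\<in>carrier_mat m m.
    (\<forall>i<m. \<forall>j<m. ((\<lambda>s. (s - \<i> * \<omega>) * tf_eval G s $$ (i, j)) \<longlongrightarrow> R $$ (i, j)) (at (\<i> * \<omega>))) \<and>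
    (\<forall>v\<in>carrier_vec m. \<exists>k\<ge>0. \<i> * ((R *\<^sub>v v) \<bullet>c v) = complex_of_real (\<omega> * k))"
proof (cases "\<omega> > 0")
  case True
  then show ?thesis using ni_residue_positive_frequency[OF ni _ pole] by blast
next
  case False
  have G: "G \<in> carrier_mat m m" using ni by (simp add: negative_imaginary_def)
  have n: "- \<omega> > 0" using w False by simp
  have cn: "\<i> * complex_of_real (- \<omega>) = cnj (\<i> * \<omega>)" by simp
  have "tf_pole G (\<i> * complex_of_real (- \<omega>))" unfolding cn tf_pole_cnj by (rule pole)
  from ni_residue_positive_frequency[OF ni n this, unfolded cn] obtain R where R: "R \<in> carrier_mat m m"
    "\<And>i j. i < m \<Longrightarrow> j < m \<Longrightarrow>
      ((\<lambda>s. (s - cnj (\<i> * \<omega>)) * tf_eval G s $$ (i, j)) \<longlongrightarrow> R $$ (i, j)) (at (cnj (\<i> * \<omega>)))"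
    "\<And>v. v \<in> carrier_vec m \<Longrightarrow> \<exists>k\<ge>0. \<i> * ((R *\<^sub>v v) \<bullet>c v) = complex_of_real (- \<omega> * k)"
    by blast
  have fl: "filterlim cnj (at (cnj (\<i> * \<omega>))) (at (\<i> * \<omega>))"
  proof (rule filterlim_atI)
    show "(cnj \<longlongrightarrow> cnj (\<i> * \<omega>)) (at (\<i> * \<omega>))" by (rule tendsto_cnj[OF tendsto_ident_at])
    show "\<forall>\<^sub>F x in at (\<i> * \<omega>). cnj x \<noteq> cnj (\<i> * \<omega>)"
      unfolding complex_cnj_cancel_iff by (simp add: eventually_at_filter)
  qed
  have "((\<lambda>s. (s - \<i> * \<omega>) * tf_eval G s $$ (i, j)) \<longlongrightarrow> map_mat cnj R $$ (i, j)) (at (\<i> * \<omega>))"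
    if ij: "i < m" "j < m" for i j
  proof -
    have "((\<lambda>s. cnj ((cnj s - cnj (\<i> * \<omega>)) * tf_eval G (cnj s) $$ (i, j))) \<longlongrightarrow> cnj (R $$ (i, j))) (at (\<i> * \<omega>))"
      by (intro tendsto_cnj filterlim_compose[OF R(2)[OF ij] fl])
    moreover have "cnj ((cnj s - cnj (\<i> * \<omega>)) * tf_eval G (cnj s) $$ (i, j)) = (s - \<i> * \<omega>) * tf_eval G s $$ (i, j)" for s
      using ij tf_eval_carrier[OF G, of s] by (simp add: tf_eval_cnj)
    ultimately have "((\<lambda>s. (s - \<i> * \<omega>) * tf_eval G s $$ (i, j)) \<longlongrightarrow> cnj (R $$ (i, j))) (at (\<i> * \<omega>))"
      by (simp only:)
    then show ?thesis using ij R(1) by simp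
  qed
  moreover have "\<exists>k\<ge>0. \<i> * ((map_mat cnj R *\<^sub>v v) \<bullet>c v) = complex_of_real (\<omega> * k)" if v: "v \<in> carrier_vec m" for v
  proof -
    obtain k where k: "k \<ge> 0" "\<i> * ((R *\<^sub>v conjugate v) \<bullet>c conjugate v) = complex_of_real (- \<omega> * k)"
      using R(3)[of "conjugate v"] v by auto
    have "\<i> * ((map_mat cnj R *\<^sub>v v) \<bullet>c v) = - cnj (\<i> * ((R *\<^sub>v conjugate v) \<bullet>c conjugate v))"
      unfolding cnj_mat_form[OF R(1) v] by simp
    also have "\<dots> = complex_of_real (\<omega> * k)" unfolding k(2) by simp
    finally show ?thesis using k(1) by blast
  qed
  ultimately show ?thesis using R(1) by (intro bexI[of _ "map_mat cnj R"]) auto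
qed

lemma form_expand:
  fixes M :: "complex mat"
  assumes M: "M \<in> carrier_mat m m" and z: "z \<in> carrier_vec m" and p: "p \<in> carrier_vec m"
  shows "(M *\<^sub>v (s \<cdot>\<^sub>v z + p)) \<bullet>c (s \<cdot>\<^sub>v z + p) =
    s * cnj s * ((M *\<^sub>v z) \<bullet>c z) + s * ((M *\<^sub>v z) \<bullet>c p) + cnj s * ((M *\<^sub>v p) \<bullet>c z) + (M *\<^sub>v p) \<bullet>c p"
  using assms by (simp add: mult_add_distrib_mat_vec[of M m m] mult_mat_vec[of M m m]
      cinner_simps[where n = m] algebra_simps)

text \<open>On the imaginary axis \<open>1 / s\<^sup>2\<close> is real, and \<open>G2\<close> is
  Hermitian; so subtracting the double pole leaves the imaginary part of the form, and hence its
  sign, unchanged.\<close>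

lemma negative_imaginary_G0_hermitian:
  assumes min: "minimal_realization m n A B C D G" and ni: "negative_imaginary m G"
    and g1: "G1 m G = 0\<^sub>m m m" and g2: "G2 m G \<noteq> 0\<^sub>m m m"
  shows "hermitian_mat (G0 m G)"
proof (rule hermitian_limit_at_0[where f = "\<lambda>s. tf_eval G s - (1 / s\<^sup>2) \<cdot>\<^sub>m G2 m G" and m = m])
  note ex = negative_imaginary_expansion_at_0[OF ni g1 g2]
  have G: "G \<in> carrier_mat m m" using ni by (simp add: negative_imaginary_def)
  show "G0 m G \<in> carrier_mat m m" by (rule ex)
  show "tf_eval G s - (1 / s\<^sup>2) \<cdot>\<^sub>m G2 m G \<in> carrier_mat m m" for s
    using ex(2) by (intro minus_carrier_mat) auto
  show "((\<lambda>s. (tf_eval G s - (1 / s\<^sup>2) \<cdot>\<^sub>m G2 m G) $$ (i, j)) \<longlongrightarrow> G0 m G $$ (i, j)) (at 0)"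
    if "i < m" "j < m" for i j using ex(4) that by blast
  fix v :: "complex vec" assume v: "v \<in> carrier_vec m"
  have "filterlim (\<lambda>\<omega>. \<i> * complex_of_real \<omega>) (at 0) (at 0)"
    using filterlim_imaginary_axis[of 0 UNIV] by simp
  then have "eventually (\<lambda>\<omega>. \<not> tf_pole G (\<i> * complex_of_real \<omega>)) (at 0)"
    by (rule eventually_compose_filterlim[OF minimal_eventually_not_pole[OF min]])
  moreover have "eventually (\<lambda>\<omega>::real. \<omega> \<noteq> 0) (at 0)" by (simp add: eventually_at_filter)
  ultimately show "eventually (\<lambda>\<omega>. \<omega> * Im (((tf_eval G (\<i> * complex_of_real \<omega>) -
      (1 / (\<i> * complex_of_real \<omega>)\<^sup>2) \<cdot>\<^sub>m G2 m G) *\<^sub>v v) \<bullet>c v) \<le> 0) (at 0)"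
  proof eventually_elim
    case (elim \<omega>)
    let ?M = "tf_eval G (\<i> * complex_of_real \<omega>)" and ?c = "1 / (\<i> * complex_of_real \<omega>)\<^sup>2"
    have M: "?M \<in> carrier_mat m m" by (rule tf_eval_carrier[OF G])
    have "(?M - ?c \<cdot>\<^sub>m G2 m G) *\<^sub>v v = ?M *\<^sub>v v - (?c \<cdot>\<^sub>m G2 m G) *\<^sub>v v"
      using M ex(2) v by (intro minus_mult_distrib_mat_vec[of _ m m]) auto
    also have "(?c \<cdot>\<^sub>m G2 m G) *\<^sub>v v = ?c \<cdot>\<^sub>v (G2 m G *\<^sub>v v)" using ex(2) v by (intro eq_vecI) auto
    finally have "((?M - ?c \<cdot>\<^sub>m G2 m G) *\<^sub>v v) \<bullet>c v = (?M *\<^sub>v v) \<bullet>c v - ?c * ((G2 m G *\<^sub>v v) \<bullet>c v)"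
      using M ex(2) v by (simp add: cinner_diff_left[of _ m] cinner_smult_left[of _ m])
    moreover have "?c = complex_of_real (- 1 / \<omega>\<^sup>2)" by (simp add: power_mult_distrib)
    moreover have "Im ((G2 m G *\<^sub>v v) \<bullet>c v) = 0"
      using hermitian_mat_Im_0[of "G2 m G" m v] ex(1,2) v by (simp add: pos_semidef_def)
    ultimately have "Im (((?M - ?c \<cdot>\<^sub>m G2 m G) *\<^sub>v v) \<bullet>c v) = Im ((?M *\<^sub>v v) \<bullet>c v)" by simp
    then show ?case
      using negative_imaginary_axis_nonneg[OF ni] elim v by (simp add: axis_nonneg_def)
  qed
qed

text \<open>The half plane principle applied to \<open>(s z\<^sup>* - q\<^sup>*) G(s) (s z + q) / s + q\<^sup>* G\<^sub>0 q / s\<close> with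
  \<open>q = l p\<close> and \<open>z = w - p\<close>. On the imaginary axis \<open>s z\<^sup>* - q\<^sup>*\<close> is \<open>- (s z + q)\<^sup>*\<close>, the last term
  makes the pole at the origin simple, and at \<open>s = l\<close> one has \<open>s z + q = l w\<close>.\<close>

lemma ni_energy:
  assumes min: "minimal_realization m n A B C (0\<^sub>m m m) G" and ni: "negative_imaginary m G"
    and g1: "G1 m G = 0\<^sub>m m m" and g2: "G2 m G \<noteq> 0\<^sub>m m m"
    and w: "w \<in> carrier_vec m" and p: "p \<in> carrier_vec m" "G2 m G *\<^sub>v p = 0\<^sub>v m" and l: "Re l > 0"
  shows "Re l * (2 * Re ((tf_eval G l *\<^sub>v w) \<bullet>c p) - Re ((G0 m G *\<^sub>v p) \<bullet>c p))
    \<le> Re (l * ((tf_eval G l *\<^sub>v w) \<bullet>c w))"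
proof -
  note ex = negative_imaginary_expansion_at_0[OF ni g1 g2]
  have G: "G \<in> carrier_mat m m" and np: "\<And>s. Re s > 0 \<Longrightarrow> \<not> tf_pole G s"
    using ni by (auto simp: negative_imaginary_def)
  have R: "realization m n A B C (0\<^sub>m m m) G" using min by (simp add: minimal_realization_def)
  then have cA: "cmat A \<in> carrier_mat n n" by (auto simp: realization_def)
  let ?chi = "char_poly (cmat A)"
  have dchi: "degree ?chi = n" using degree_monic_char_poly[OF cA] by simp
  have chi0: "?chi \<noteq> 0" by (rule char_poly_nonzero[OF cA])
  have chi: "poly ?chi s \<noteq> 0" if "Re s > 0" for s
    using minimal_eigenvalue_imp_pole[OF min] np[OF that] by blast
  define q where "q = l \<cdot>\<^sub>v p"
  define z where "z = w - p"
  have q: "q \<in> carrier_vec m" and z: "z \<in> carrier_vec m" using w p by (auto simp: q_def z_def)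
  define F where "F = (\<lambda>b c s. (tf_eval G s *\<^sub>v b) \<bullet>c c)"
  define c0 where "c0 = (G0 m G *\<^sub>v q) \<bullet>c q"
  define f where "f = (\<lambda>s. s * F z z s + F q z s - F z q s - F q q s / s + c0 / s)"
  have c0: "Im c0 = 0"
    unfolding c0_def by (rule hermitian_mat_Im_0[OF negative_imaginary_G0_hermitian[OF min ni g1 g2] ex(3) q])
  have num: "\<exists>P. (P = 0 \<or> degree P < n) \<and> (\<forall>s. poly ?chi s \<noteq> 0 \<longrightarrow> F b c s = poly P s / poly ?chi s)"
    if "b \<in> carrier_vec m" "c \<in> carrier_vec m" for b c
    using transfer_form_numerator[OF R that(2,1)] unfolding F_def by blast
  obtain P1 where P1: "P1 = 0 \<or> degree P1 < n" "\<And>s. poly ?chi s \<noteq> 0 \<Longrightarrow> F z z s = poly P1 s / poly ?chi s"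
    using num[OF z z] by blast
  obtain P2 where P2: "P2 = 0 \<or> degree P2 < n" "\<And>s. poly ?chi s \<noteq> 0 \<Longrightarrow> F q z s = poly P2 s / poly ?chi s"
    using num[OF q z] by blast
  obtain P3 where P3: "P3 = 0 \<or> degree P3 < n" "\<And>s. poly ?chi s \<noteq> 0 \<Longrightarrow> F z q s = poly P3 s / poly ?chi s"
    using num[OF z q] by blast
  obtain P4 where P4: "P4 = 0 \<or> degree P4 < n" "\<And>s. poly ?chi s \<noteq> 0 \<Longrightarrow> F q q s = poly P4 s / poly ?chi s"
    using num[OF q q] by blast
  define N where "N = [:0, 0, 1:] * P1 + [:0, 1:] * (P2 - P3) - P4 + Polynomial.smult c0 ?chi"
  define Q where "Q = [:0, 1:] * ?chi"
  have Q0: "Q \<noteq> 0" using chi0 by (simp add: Q_def)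
  have dN: "degree N \<le> degree Q"
  proof -
    have "degree P1 \<le> n - 1" "degree P2 \<le> n - 1" "degree P3 \<le> n - 1" "degree P4 \<le> n - 1"
      using P1(1) P2(1) P3(1) P4(1) by auto
    moreover have "n = 0 \<Longrightarrow> P1 = 0" using P1(1) by auto
    ultimately have "degree ([:0, 0, 1:] * P1) \<le> Suc n" "degree ([:0, 1:] * (P2 - P3)) \<le> Suc n" "degree P4 \<le> Suc n"
      using degree_mult_le[of "[:0, 0, 1:]" P1] degree_mult_le[of "[:0, 1:]" "P2 - P3"] degree_diff_le_max[of P2 P3]
      by (cases n; auto)+
    then have "degree N \<le> Suc n"
      unfolding N_def using dchi
      by (intro degree_add_le degree_diff_le) (auto intro: order_trans[OF degree_smult_le])
    then show ?thesis using dchi chi0 by (simp add: Q_def)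
  qed
  have quot: "poly N s / poly Q s = f s" if "poly ?chi s \<noteq> 0" "s \<noteq> 0" for s
  proof -
    have "poly N s = s * s * poly P1 s + s * (poly P2 s - poly P3 s) - poly P4 s + c0 * poly ?chi s"
      by (simp add: N_def algebra_simps)
    moreover have "(s * s * a + s * (b - c) - d + e * x) / (s * x) = s * (a / x) + b / x - c / x - d / x / s + e / s"
      if "x \<noteq> 0" for a b c d e x using that \<open>s \<noteq> 0\<close>
      by (simp add: add_divide_distrib diff_divide_distrib right_diff_distrib mult.commute)
    note this[OF that(1)]
    ultimately show ?thesis
      unfolding f_def P1(2)[OF that(1)] P2(2)[OF that(1)] P3(2)[OF that(1)] P4(2)[OF that(1)] by (simp add: Q_def)
  qed
  \<comment> \<open>Used twice: with the value of \<open>G\<close> for the sign on the axis, and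
    with the residue of \<open>G\<close> for the residue of \<open>f\<close>.\<close>
  have axis: "- (((M *\<^sub>v (\<i> * \<omega> \<cdot>\<^sub>v z + q)) \<bullet>c (\<i> * \<omega> \<cdot>\<^sub>v z + q)) / (\<i> * \<omega>)) =
      \<i> * \<omega> * ((M *\<^sub>v z) \<bullet>c z) + (M *\<^sub>v q) \<bullet>c z - (M *\<^sub>v z) \<bullet>c q - (M *\<^sub>v q) \<bullet>c q / (\<i> * \<omega>)"
    if M: "M \<in> carrier_mat m m" and w: "\<omega> \<noteq> 0" for M and \<omega> :: real
  proof -
    have "- ((s * t * a + s * b + t * c + d) / s) = s * a + c - b - d / s"
      if "s \<noteq> 0" "t = - s" for s t a b c d :: complex
      using that(1) unfolding that(2) by (simp add: add_divide_distrib)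
    note lem = this
    show ?thesis unfolding form_expand[OF M z q] by (rule lem) (use w in auto)
  qed
  have "0 \<le> Re (poly N l / poly Q l)"
  proof (rule rational_nonneg_right_half_plane[OF Q0 dN, where F = "{0} \<union> {s. poly ?chi s = 0}"])
    show "poly Q s \<noteq> 0" if "0 < Re s" for s using chi[of s] that by (auto simp: Q_def)
    show "finite ({0} \<union> {s. poly ?chi s = 0})" using poly_roots_finite[OF chi0] by simp
    show "0 \<le> Re (poly N (\<i> * complex_of_real \<omega>) / poly Q (\<i> * complex_of_real \<omega>))"
      if "\<i> * complex_of_real \<omega> \<notin> {0} \<union> {s. poly ?chi s = 0}" for \<omega>
    proof -
      let ?s = "\<i> * complex_of_real \<omega>" and ?v = "\<i> * complex_of_real \<omega> \<cdot>\<^sub>v z + q"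
      have w: "\<omega> \<noteq> 0" and s: "poly ?chi ?s \<noteq> 0" using that by auto
      have "\<not> tf_pole G ?s"
        using tf_eval_realization(1)[OF R s] by (simp add: tf_pole_iff_not_regular)
      then have "\<omega> * Im ((tf_eval G ?s *\<^sub>v ?v) \<bullet>c ?v) \<le> 0"
        using negative_imaginary_axis_nonneg[OF ni] w z q by (simp add: axis_nonneg_def)
      then have *: "0 \<le> - Im ((tf_eval G ?s *\<^sub>v ?v) \<bullet>c ?v) / \<omega>"
        using w by (auto simp: divide_le_0_iff mult_le_0_iff)
      have "f ?s = - (((tf_eval G ?s *\<^sub>v ?v) \<bullet>c ?v) / ?s) + c0 / ?s"
        unfolding axis[OF tf_eval_carrier[OF G] w] f_def F_def by simp
      then have "f ?s = (c0 - (tf_eval G ?s *\<^sub>v ?v) \<bullet>c ?v) / ?s" by (simp add: diff_divide_distrib)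
      then have "Re (f ?s) = Im (c0 - (tf_eval G ?s *\<^sub>v ?v) \<bullet>c ?v) / \<omega>" by (simp only: Re_divide_imaginary)
      then show ?thesis using * quot[OF s] w c0 by simp
    qed
    show "\<exists>k\<ge>0. (\<lambda>s. (s - a) * (poly N s / poly Q s)) \<midarrow>a\<rightarrow> complex_of_real k"
      if a: "Re a = 0" "poly Q a = 0" for a
    proof -
      have evq: "eventually (\<lambda>s. poly N s / poly Q s = f s \<and> s \<noteq> 0 \<and> s \<noteq> a) (at a)"
        using eventually_poly_nonzero_at[OF Q0, of a]
      proof -
        have "eventually (\<lambda>s. s \<noteq> a) (at a)" by (simp add: eventually_at_filter)
        with eventually_poly_nonzero_at[OF Q0, of a] show ?thesis
          by eventually_elim (use quot in \<open>auto simp: Q_def\<close>)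
      qed
      have "\<exists>k\<ge>0. ((\<lambda>s. (s - a) * f s) \<longlongrightarrow> complex_of_real k) (at a)"
      proof (cases "a = 0")
        case True
        let ?H = "\<lambda>s. tf_eval G s - (1 / s\<^sup>2) \<cdot>\<^sub>m G2 m G"
        have Hc: "?H s \<in> carrier_mat m m" for s using ex(2) by (intro minus_carrier_mat) auto
        define h where "h = (\<lambda>b c s. (?H s *\<^sub>v b) \<bullet>c c)"
        have h: "(h b c \<longlongrightarrow> (G0 m G *\<^sub>v b) \<bullet>c c) (at 0)" if "b \<in> carrier_vec m" "c \<in> carrier_vec m" for b c
          unfolding h_def by (rule form_tendsto[OF Hc ex(3) ex(4) that])
        have Fh: "F b c s = h b c s + (1 / s\<^sup>2) * ((G2 m G *\<^sub>v b) \<bullet>c c)"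
          if b: "b \<in> carrier_vec m" and c: "c \<in> carrier_vec m" for b c s
        proof -
          have "?H s *\<^sub>v b = tf_eval G s *\<^sub>v b - ((1 / s\<^sup>2) \<cdot>\<^sub>m G2 m G) *\<^sub>v b"
            using tf_eval_carrier[OF G, of s] ex(2) b by (intro minus_mult_distrib_mat_vec[of _ m m]) auto
          also have "((1 / s\<^sup>2) \<cdot>\<^sub>m G2 m G) *\<^sub>v b = (1 / s\<^sup>2) \<cdot>\<^sub>v (G2 m G *\<^sub>v b)"
            using ex(2) b by (intro eq_vecI) auto
          finally show ?thesis
            unfolding F_def h_def using tf_eval_carrier[OF G, of s] ex(2) b c
            by (simp add: cinner_diff_left[of _ m] cinner_smult_left[of _ m])
        qed
        have G2q: "G2 m G *\<^sub>v q = 0\<^sub>v m"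
        proof -
          have "l \<cdot>\<^sub>v 0\<^sub>v m = (0\<^sub>v m :: complex vec)" by (intro eq_vecI) auto
          then show ?thesis using p ex(2) by (simp add: q_def mult_mat_vec[of _ m m])
        qed
        have herm: "hermitian_mat (G2 m G)" using ex(1) by (simp add: pos_semidef_def)
        have zero: "(G2 m G *\<^sub>v q) \<bullet>c z = 0" "(G2 m G *\<^sub>v q) \<bullet>c q = 0" "(G2 m G *\<^sub>v z) \<bullet>c q = 0"
          using hermitian_mat_cinner[OF herm ex(2) z q] G2q z q by simp_all
        define k where "k = Re ((G2 m G *\<^sub>v z) \<bullet>c z)"
        have k: "k \<ge> 0" "(G2 m G *\<^sub>v z) \<bullet>c z = complex_of_real k"
          using ex(1,2) z hermitian_mat_Im_0[OF herm ex(2) z]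
          by (auto simp: k_def pos_semidef_def complex_eq_iff)
        \<comment> \<open>By \<open>G\<^sub>2 q = 0\<close> the double pole acts only on the pair
          \<open>z\<close>, \<open>z\<close>, where the factor \<open>s\<close> makes it a simple
          pole with residue \<open>k\<close>. The limit of \<open>h q q\<close> is
          \<open>c0\<close>, and the two cancel.\<close>
        have "((\<lambda>s. s\<^sup>2 * h z z s + complex_of_real k + s * h q z s - s * h z q s - h q q s + c0) \<longlongrightarrow>
            0\<^sup>2 * ((G0 m G *\<^sub>v z) \<bullet>c z) + complex_of_real k + 0 * ((G0 m G *\<^sub>v q) \<bullet>c z)
            - 0 * ((G0 m G *\<^sub>v z) \<bullet>c q) - c0 + c0) (at 0)"
          unfolding c0_def by (intro tendsto_intros h z q)
        moreover have "eventually (\<lambda>s. s\<^sup>2 * h z z s + complex_of_real k + s * h q z s - s * h z q s - h q q s + c0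
            = (s - a) * f s) (at 0)"
          using evq unfolding True
        proof eventually_elim
          case (elim s)
          have alg: "s\<^sup>2 * a + k + s * b - s * c - d + e = s * (s * (a + (1 / s\<^sup>2) * k) + b - c - d / s + e / s)"
            for a b c d e k using elim by (simp add: distrib_left right_diff_distrib power2_eq_square)
          show ?case
            unfolding f_def Fh[OF z z] Fh[OF q z] Fh[OF z q] Fh[OF q q] zero k(2) alg by simp
        qed
        ultimately show ?thesis using k(1) by (auto simp: True tendsto_cong)
      next
        case False
        define \<omega> where "\<omega> = Im a"
        have a': "a = \<i> * complex_of_real \<omega>" using a(1) by (simp add: \<omega>_def complex_eq_iff)
        have w: "\<omega> \<noteq> 0" using False a' by auto
        have "poly ?chi a = 0" using a(2) False by (auto simp: Q_def)
        then have pole: "tf_pole G (\<i> * complex_of_real \<omega>)" using minimal_eigenvalue_imp_pole[OF min] a' by simp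
        from ni_residue[OF ni w pole] obtain R where R: "R \<in> carrier_mat m m"
          "\<And>i j. i < m \<Longrightarrow> j < m \<Longrightarrow> ((\<lambda>s. (s - a) * tf_eval G s $$ (i, j)) \<longlongrightarrow> R $$ (i, j)) (at a)"
          "\<And>v. v \<in> carrier_vec m \<Longrightarrow> \<exists>k\<ge>0. \<i> * ((R *\<^sub>v v) \<bullet>c v) = complex_of_real (\<omega> * k)"
          unfolding a' by blast
        have lim: "((\<lambda>s. (s - a) * F b c s) \<longlongrightarrow> (R *\<^sub>v b) \<bullet>c c) (at a)"
          if b: "b \<in> carrier_vec m" and c: "c \<in> carrier_vec m" for b c
        proof -
          have "((s - a) \<cdot>\<^sub>m tf_eval G s) $$ (i, j) = (s - a) * tf_eval G s $$ (i, j)"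
            if "i < m" "j < m" for s i j using tf_eval_carrier[OF G, of s] that by simp
          then have "((\<lambda>s. (((s - a) \<cdot>\<^sub>m tf_eval G s) *\<^sub>v b) \<bullet>c c) \<longlongrightarrow> (R *\<^sub>v b) \<bullet>c c) (at a)"
            using R(1,2) tf_eval_carrier[OF G] b c by (intro form_tendsto) auto
          moreover have "((s - a) \<cdot>\<^sub>m tf_eval G s) *\<^sub>v b = (s - a) \<cdot>\<^sub>v (tf_eval G s *\<^sub>v b)" for s
            using tf_eval_carrier[OF G, of s] b by (intro eq_vecI) auto
          ultimately show ?thesis
            unfolding F_def using mult_mat_vec_carrier[OF tf_eval_carrier[OF G] b] c
            by (simp add: cinner_smult_left[of _ m])
        qed
        let ?v = "\<i> * complex_of_real \<omega> \<cdot>\<^sub>v z + q"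
        obtain k where k: "k \<ge> 0" "\<i> * ((R *\<^sub>v ?v) \<bullet>c ?v) = complex_of_real (\<omega> * k)" using R(3)[of ?v] z q by auto
        \<comment> \<open>The term \<open>c0 / s\<close> is regular at \<open>a \<noteq> 0\<close>,
          so the residue of \<open>f\<close> comes from \<open>G\<close> alone and is evaluated by
          \<open>axis\<close>.\<close>
        have "((\<lambda>s. s * ((s - a) * F z z s) + (s - a) * F q z s - (s - a) * F z q s - (s - a) * F q q s / s + (s - a) * c0 / s)
          \<longlongrightarrow> a * ((R *\<^sub>v z) \<bullet>c z) + (R *\<^sub>v q) \<bullet>c z - (R *\<^sub>v z) \<bullet>c q - (R *\<^sub>v q) \<bullet>c q / a + (a - a) * c0 / a) (at a)"
          using False by (intro tendsto_intros lim z q) auto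
        moreover have "a * ((R *\<^sub>v z) \<bullet>c z) + (R *\<^sub>v q) \<bullet>c z - (R *\<^sub>v z) \<bullet>c q - (R *\<^sub>v q) \<bullet>c q / a + (a - a) * c0 / a
            = - (((R *\<^sub>v ?v) \<bullet>c ?v) / (\<i> * \<omega>))"
          unfolding axis[OF R(1) w] a' by simp
        moreover have "- (((R *\<^sub>v ?v) \<bullet>c ?v) / (\<i> * \<omega>)) = \<i> * ((R *\<^sub>v ?v) \<bullet>c ?v) / \<omega>"
          using w by (simp add: field_simps)
        moreover have "\<dots> = complex_of_real k" unfolding k(2) using w by simp
        moreover have "(\<lambda>s. s * ((s - a) * F z z s) + (s - a) * F q z s - (s - a) * F z q s - (s - a) * F q q s / s + (s - a) * c0 / s)
            = (\<lambda>s. (s - a) * f s)"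
          by (simp add: fun_eq_iff f_def algebra_simps)
        ultimately show ?thesis using k(1) by auto
      qed
      moreover have "eventually (\<lambda>s. (s - a) * f s = (s - a) * (poly N s / poly Q s)) (at a)"
        using evq by eventually_elim simp
      ultimately show ?thesis by (simp add: tendsto_cong)
    qed
  qed (use l in auto)
  moreover have "l \<noteq> 0" using l by auto
  ultimately have "0 \<le> Re (f l)" using quot[OF chi[OF l]] by simp
  \<comment> \<open>With \<open>q = l p\<close> and \<open>w = z + p\<close> the terms combine
    through \<open>l + cnj l = 2 Re l\<close>.\<close>
  moreover have "f l = l * ((tf_eval G l *\<^sub>v w) \<bullet>c w) - 2 * Re l * ((tf_eval G l *\<^sub>v w) \<bullet>c p) + cnj l * ((G0 m G *\<^sub>v p) \<bullet>c p)"
  proof -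
    let ?M = "tf_eval G l"
    have M: "?M \<in> carrier_mat m m" by (rule tf_eval_carrier[OF G])
    have l0: "l \<noteq> 0" using l by auto
    have w': "w = z + p" using w p by (intro eq_vecI) (auto simp: z_def)
    have "2 * complex_of_real (Re l) = l + cnj l" by (simp add: complex_eq_iff)
    then show ?thesis
      unfolding f_def F_def c0_def w' q_def using M ex(3) z p l0
      by (simp add: mult_add_distrib_mat_vec[of _ m m] mult_mat_vec[of _ m m]
        cinner_simps[where n = m] algebra_simps)
  qed
  moreover have "Im ((G0 m G *\<^sub>v p) \<bullet>c p) = 0"
    by (rule hermitian_mat_Im_0[OF negative_imaginary_G0_hermitian[OF min ni g1 g2] ex(3) p(1)])
  ultimately show ?thesis by (simp add: algebra_simps)
qed

section \<open>The feedback loop\<close>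

lemma append_vec_decompose:
  assumes "v \<in> carrier_vec (n + k)"
  obtains x y where "x \<in> carrier_vec n" "y \<in> carrier_vec k" "v = x @\<^sub>v y"
proof
  show "vec n (\<lambda>i. v $ i) \<in> carrier_vec n" "vec k (\<lambda>i. v $ (n + i)) \<in> carrier_vec k" by simp_all
  show "v = vec n (\<lambda>i. v $ i) @\<^sub>v vec k (\<lambda>i. v $ (n + i))"
    using assms by (intro eq_vecI) auto
qed

lemma smult_append_vec: "s \<cdot>\<^sub>v (x @\<^sub>v y) = (s \<cdot>\<^sub>v x) @\<^sub>v (s \<cdot>\<^sub>v y)"
  by (intro eq_vecI) auto

lemma closed_loop_matrix_strictly_proper:
  assumes "A \<in> carrier_mat n n" "B \<in> carrier_mat n m" "C \<in> carrier_mat m n"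
    and "A' \<in> carrier_mat n' n'" "B' \<in> carrier_mat n' m" "C' \<in> carrier_mat m n'" "D' \<in> carrier_mat m m"
  shows "closed_loop_matrix m A B C (0\<^sub>m m m) A' B' C' D' =
    four_block_mat (A + B * D' * C) (B * C') (B' * C) A'"
proof -
  have "1\<^sub>m m - 0\<^sub>m m m * D' = (1\<^sub>m m :: real mat)" using assms by (intro eq_matI) auto
  moreover have "matinv (1\<^sub>m m :: real mat) = 1\<^sub>m m"
    using matinv(1,2)[of "1\<^sub>m m :: real mat" m] by simp
  moreover have "B * D' * 1\<^sub>m m * 0\<^sub>m m m * C' = 0\<^sub>m n n'" "B' * 1\<^sub>m m * 0\<^sub>m m m * C' = 0\<^sub>m n' n'"
    using assms by (simp_all add: right_mult_zero_mat[of _ n m] left_mult_zero_mat[of _ m n'])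
  ultimately show ?thesis
    using assms mult_carrier_mat[OF assms(2,6)] mult_carrier_mat[OF assms(2,7)]
    by (simp add: closed_loop_matrix_def Let_def)
qed

lemma closed_loop_mult_vec:
  assumes c: "A \<in> carrier_mat n n" "B \<in> carrier_mat n m" "C \<in> carrier_mat m n"
    "A' \<in> carrier_mat n' n'" "B' \<in> carrier_mat n' m" "C' \<in> carrier_mat m n'" "D' \<in> carrier_mat m m"
    and x: "x \<in> carrier_vec n" and y: "y \<in> carrier_vec n'"
  shows "cmat (closed_loop_matrix m A B C (0\<^sub>m m m) A' B' C' D') *\<^sub>v (x @\<^sub>v y) =
    (cmat A *\<^sub>v x + cmat B *\<^sub>v (cmat C' *\<^sub>v y + cmat D' *\<^sub>v (cmat C *\<^sub>v x))) @\<^sub>v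
    (cmat A' *\<^sub>v y + cmat B' *\<^sub>v (cmat C *\<^sub>v x))"
proof -
  have cc: "cmat A \<in> carrier_mat n n" "cmat B \<in> carrier_mat n m" "cmat C \<in> carrier_mat m n"
    "cmat A' \<in> carrier_mat n' n'" "cmat B' \<in> carrier_mat n' m" "cmat C' \<in> carrier_mat m n'" "cmat D' \<in> carrier_mat m m"
    using c by auto
  have BD: "B * D' \<in> carrier_mat n m" and BDC: "B * D' * C \<in> carrier_mat n n" and BC: "B * C' \<in> carrier_mat n n'"
    and BC': "B' * C \<in> carrier_mat n' n" using c by auto
  have ABDC: "A + B * D' * C \<in> carrier_mat n n" using BDC by simp
  have cadd: "cmat (A + B * D' * C) = cmat A + cmat (B * D' * C)"
    using c(1) carrier_matD[OF BDC] by (intro eq_matI) auto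
  have homs: "cmat (A + B * D' * C) = cmat A + cmat B * cmat D' * cmat C" "cmat (B * C') = cmat B * cmat C'"
    "cmat (B' * C) = cmat B' * cmat C"
    by (rule cadd[unfolded of_real_hom.mat_hom_mult[OF BD c(3)] of_real_hom.mat_hom_mult[OF c(2,7)]],
      rule of_real_hom.mat_hom_mult[OF c(2,6)], rule of_real_hom.mat_hom_mult[OF c(5,3)])
  have cBD: "cmat B * cmat D' * cmat C \<in> carrier_mat n n" "cmat B * cmat D' \<in> carrier_mat n m" using cc by auto
  let ?u = "cmat C *\<^sub>v x" and ?v = "cmat C' *\<^sub>v y"
  have u: "?u \<in> carrier_vec m" and v: "?v \<in> carrier_vec m" using cc x y by auto
  have Du: "cmat D' *\<^sub>v ?u \<in> carrier_vec m" using cc u by auto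
  have 1: "(cmat A + cmat B * cmat D' * cmat C) *\<^sub>v x = cmat A *\<^sub>v x + cmat B *\<^sub>v (cmat D' *\<^sub>v ?u)"
    using add_mult_distrib_mat_vec[OF cc(1) cBD(1) x] assoc_mult_mat_vec[OF cBD(2) cc(3) x]
      assoc_mult_mat_vec[OF cc(2,7) u] by simp
  have 2: "(cmat B * cmat C') *\<^sub>v y = cmat B *\<^sub>v ?v" "(cmat B' * cmat C) *\<^sub>v x = cmat B' *\<^sub>v ?u"
    using assoc_mult_mat_vec[OF cc(2,6) y] assoc_mult_mat_vec[OF cc(5,3) x] by auto
  have 3: "cmat B *\<^sub>v (?v + cmat D' *\<^sub>v ?u) = cmat B *\<^sub>v ?v + cmat B *\<^sub>v (cmat D' *\<^sub>v ?u)"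
    by (rule mult_add_distrib_mat_vec[OF cc(2) v Du])
  have "cmat (closed_loop_matrix m A B C (0\<^sub>m m m) A' B' C' D') =
      four_block_mat (cmat (A + B * D' * C)) (cmat (B * C')) (cmat (B' * C)) (cmat A')"
    unfolding closed_loop_matrix_strictly_proper[OF c] by (rule map_four_block_mat[OF ABDC BC BC' c(4)])
  also have "\<dots> *\<^sub>v (x @\<^sub>v y) = ((cmat A + cmat B * cmat D' * cmat C) *\<^sub>v x + (cmat B * cmat C') *\<^sub>v y) @\<^sub>v
      ((cmat B' * cmat C) *\<^sub>v x + cmat A' *\<^sub>v y)"
    unfolding homs using cc cBD x y by (intro four_block_mat_mult_vec[of _ n n _ n' _ n']) auto
  finally show ?thesis
    unfolding 1 2 3
    using cc x y u v Du comm_add_vec[of "cmat B' *\<^sub>v ?u" n' "cmat A' *\<^sub>v y"]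
      comm_add_vec[of "cmat B *\<^sub>v ?v" n "cmat B *\<^sub>v (cmat D' *\<^sub>v ?u)"]
    by (simp add: assoc_add_vec[of _ n])
qed

lemma strictly_negative_imaginary_strict_both:
  assumes sni: "strictly_negative_imaginary m G" and w: "\<omega> \<noteq> 0" and v: "v \<in> carrier_vec m" "v \<noteq> 0\<^sub>v m"
  shows "\<omega> * Im ((tf_eval G (\<i> * complex_of_real \<omega>) *\<^sub>v v) \<bullet>c v) < 0"
proof (cases "\<omega> > 0")
  case True
  then show ?thesis using strictly_negative_imaginary_strict[OF sni True v] by (simp add: mult_pos_neg)
next
  case False
  then have n: "- \<omega> > 0" using w by simp
  have G: "G \<in> carrier_mat m m" using sni by (simp add: strictly_negative_imaginary_def)
  have cn: "\<i> * complex_of_real (- \<omega>) = cnj (\<i> * \<omega>)" by simp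
  have "conjugate v \<noteq> 0\<^sub>v m" using v by simp
  then have "Im ((map_mat cnj (tf_eval G (\<i> * \<omega>)) *\<^sub>v conjugate v) \<bullet>c conjugate v) < 0"
    using strictly_negative_imaginary_strict[OF sni n, of "conjugate v"] v unfolding cn tf_eval_cnj by simp
  then have "Im ((tf_eval G (\<i> * \<omega>) *\<^sub>v v) \<bullet>c v) > 0"
    using cnj_mat_form[OF tf_eval_carrier[OF G], of "conjugate v"] v by simp
  then show ?thesis using n by (simp add: mult_neg_pos)
qed

lemma uminus_mat_form:
  fixes M :: "complex mat"
  assumes "M \<in> carrier_mat m m" "v \<in> carrier_vec m"
  shows "(- M *\<^sub>v v) \<bullet>c v = - ((M *\<^sub>v v) \<bullet>c v)"
  using assms by (simp add: cinner_sum sum_negf)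

lemma neg_semidef_form_zero_imp_kernel:
  fixes M :: "complex mat"
  assumes M: "hermitian_mat M" "M \<in> carrier_mat m m"
    and nsd: "\<And>x. x \<in> carrier_vec m \<Longrightarrow> Re ((M *\<^sub>v x) \<bullet>c x) \<le> 0"
    and v: "v \<in> carrier_vec m" "Re ((M *\<^sub>v v) \<bullet>c v) = 0"
  shows "M *\<^sub>v v = 0\<^sub>v m"
proof -
  have "- M *\<^sub>v v = 0\<^sub>v m"
  proof (rule semidef_form_zero_imp_kernel)
    show "- M \<in> carrier_mat m m" using M by simp
    show "hermitian_mat (- M)"
      using uminus_mat_form[OF M(2)] hermitian_mat_Im_0[OF M] M(2)
      by (intro hermitian_matI_real_form[of _ m]) auto
    show "0 \<le> Re ((- M *\<^sub>v x) \<bullet>c x)" if "x \<in> carrier_vec m" for x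
      using uminus_mat_form[OF M(2) that] nsd[OF that] by simp
    show "Re ((- M *\<^sub>v v) \<bullet>c v) = 0" using uminus_mat_form[OF M(2) v(1)] v(2) by simp
  qed (rule v(1))
  then have "(- M *\<^sub>v v) $ i = 0" if "i < m" for i using that by simp
  then show ?thesis using M(2) v(1) by (intro eq_vecI) auto
qed

text \<open>One fixed pair of minimal realizations. The conditions that will be shown equivalent to
  stability of the loop matrix do not mention the realizations, so they can be carried from one pair
  to another.\<close>

locale ni_feedback =
  fixes m r n n' :: nat and G Gb :: tfm and A B C A' B' C' D' J :: "real mat"
    and Jc Gb0 K N2 :: "complex mat"
  assumes min: "minimal_realization m n A B C (0\<^sub>m m m) G"
    and min': "minimal_realization m n' A' B' C' D' Gb"
    and sni: "strictly_negative_imaginary m Gb"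
    and ni: "negative_imaginary m G"
    and g1: "G1 m G = 0\<^sub>m m m"
    and g2: "G2 m G \<noteq> 0\<^sub>m m m"
    and J: "J \<in> carrier_mat m r"
    and Jc_def: "Jc = cmat J"
    and G2_J: "G2 m G = Jc * Jc\<^sup>T"
    and Gb0_def: "Gb0 = tf_eval Gb 0"
    and K_def: "K = Jc\<^sup>T * Gb0 * Jc"
    and K_inv: "invertible_mat K"
    and N2_def: "N2 = Gb0 - Gb0 * Jc * matinv K * Jc\<^sup>T * Gb0"
begin

lemma R: "realization m n A B C (0\<^sub>m m m) G" and R': "realization m n' A' B' C' D' Gb"
  using min min' by (auto simp: minimal_realization_def)

lemma real_carriers:
  "A \<in> carrier_mat n n" "B \<in> carrier_mat n m" "C \<in> carrier_mat m n"
  "A' \<in> carrier_mat n' n'" "B' \<in> carrier_mat n' m" "C' \<in> carrier_mat m n'" "D' \<in> carrier_mat m m"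
  using R R' by (auto simp: realization_def)

lemma state_carriers:
  "cmat A \<in> carrier_mat n n" "cmat B \<in> carrier_mat n m" "cmat C \<in> carrier_mat m n"
  "cmat A' \<in> carrier_mat n' n'" "cmat B' \<in> carrier_mat n' m" "cmat C' \<in> carrier_mat m n'" "cmat D' \<in> carrier_mat m m"
  using real_carriers by auto

lemma GG: "G \<in> carrier_mat m m" "Gb \<in> carrier_mat m m"
  using ni sni by (auto simp: negative_imaginary_def strictly_negative_imaginary_def)

lemmas Gc = tf_eval_carrier[OF GG(1)] and Gbc = tf_eval_carrier[OF GG(2)]

lemma Jcc: "Jc \<in> carrier_mat m r" and Jt: "Jc\<^sup>T \<in> carrier_mat r m" and Jadj: "mat_adjoint Jc = Jc\<^sup>T"
  using J by (auto simp: Jc_def intro!: eq_matI)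

lemma Jt_cinner: "v \<in> carrier_vec r \<Longrightarrow> u \<in> carrier_vec m \<Longrightarrow> (Jc *\<^sub>v v) \<bullet>c u = v \<bullet>c (Jc\<^sup>T *\<^sub>v u)"
  using cinner_mult_adjoint[OF Jcc] by (simp add: Jadj)

lemma Jt_cinner': "v \<in> carrier_vec r \<Longrightarrow> u \<in> carrier_vec m \<Longrightarrow> u \<bullet>c (Jc *\<^sub>v v) = (Jc\<^sup>T *\<^sub>v u) \<bullet>c v"
  using cinner_mult_adjoint[OF Jt, of u v] mat_adjoint_adjoint[of Jc] by (simp add: Jadj)

lemma Gb0c: "Gb0 \<in> carrier_mat m m" and Gb0_herm: "hermitian_mat Gb0"
  unfolding Gb0_def using Gbc sni_dc_gain_hermitian[OF sni] by auto

lemma Kc: "K \<in> carrier_mat r r"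
  using Jcc Jt Gb0c by (auto simp: K_def)

lemma K_vec: "v \<in> carrier_vec r \<Longrightarrow> K *\<^sub>v v = Jc\<^sup>T *\<^sub>v (Gb0 *\<^sub>v (Jc *\<^sub>v v))"
  unfolding K_def
  by (subst assoc_mult_mat_vec[OF mult_carrier_mat[OF Jt Gb0c] Jcc], assumption)
     (rule assoc_mult_mat_vec[OF Jt Gb0c], rule mult_mat_vec_carrier[OF Jcc])

lemma K_form: "v \<in> carrier_vec r \<Longrightarrow> (K *\<^sub>v v) \<bullet>c v = (Gb0 *\<^sub>v (Jc *\<^sub>v v)) \<bullet>c (Jc *\<^sub>v v)"
  using Jt_cinner'[of v "Gb0 *\<^sub>v (Jc *\<^sub>v v)"] Jcc Gb0c by (simp add: K_vec)

lemma K_herm: "hermitian_mat K"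
proof (rule hermitian_matI_real_form[OF Kc])
  fix v :: "complex vec" assume "v \<in> carrier_vec r"
  then show "Im ((K *\<^sub>v v) \<bullet>c v) = 0"
    unfolding K_form[OF \<open>v \<in> carrier_vec r\<close>] using Jcc by (intro hermitian_mat_Im_0[OF Gb0_herm Gb0c]) auto
qed

lemmas Kinv = matinv[OF Kc invertible_mat_det[OF Kc K_inv]]

lemma K_inj: "v \<in> carrier_vec r \<Longrightarrow> K *\<^sub>v v = 0\<^sub>v r \<Longrightarrow> v = 0\<^sub>v r"
  using det_0_iff_vec_prod_zero_field[OF Kc] invertible_mat_det[OF Kc K_inv] by blast

lemma mult_zero_vec: "M \<in> carrier_mat a b \<Longrightarrow> M *\<^sub>v 0\<^sub>v b = (0\<^sub>v a :: complex vec)"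
  by (intro eq_vecI) auto

text \<open>A vector killed by \<open>Jc\<close> is killed by \<open>K\<close>, which is
  invertible.\<close>

lemma J_inj: "v \<in> carrier_vec r \<Longrightarrow> Jc *\<^sub>v v = 0\<^sub>v m \<Longrightarrow> v = 0\<^sub>v r"
  by (rule K_inj) (simp_all add: K_vec mult_zero_vec[OF Gb0c] mult_zero_vec[OF Jt])

lemma JtJ_solve: "q \<in> carrier_vec r \<Longrightarrow> \<exists>y\<in>carrier_vec r. Jc\<^sup>T *\<^sub>v (Jc *\<^sub>v y) = q"
proof -
  assume q: "q \<in> carrier_vec r"
  let ?M = "Jc\<^sup>T * Jc"
  have M: "?M \<in> carrier_mat r r" using Jt Jcc by auto
  have "det ?M \<noteq> 0"
  proof
    assume "det ?M = 0"
    then obtain v where v: "v \<in> carrier_vec r" "v \<noteq> 0\<^sub>v r" "?M *\<^sub>v v = 0\<^sub>v r"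
      using det_0_iff_vec_prod_zero_field[OF M] by blast
    have Jv: "Jc *\<^sub>v v \<in> carrier_vec m" using Jcc v by simp
    have "Jc\<^sup>T *\<^sub>v (Jc *\<^sub>v v) = 0\<^sub>v r" using v(3) assoc_mult_mat_vec[OF Jt Jcc v(1)] by simp
    then have "(Jc *\<^sub>v v) \<bullet>c (Jc *\<^sub>v v) = 0" using Jt_cinner[OF v(1) Jv] v(1) by simp
    then have "Jc *\<^sub>v v = 0\<^sub>v m" using Jv by (intro cinner_self_eq_0[of _ m]) simp_all
    then show False using J_inj v by blast
  qed
  note inv = matinv[OF M this]
  have y: "matinv ?M *\<^sub>v q \<in> carrier_vec r" using inv q by simp
  have "Jc\<^sup>T *\<^sub>v (Jc *\<^sub>v (matinv ?M *\<^sub>v q)) = ?M *\<^sub>v (matinv ?M *\<^sub>v q)"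
    using assoc_mult_mat_vec[OF Jt Jcc y] by simp
  also have "\<dots> = q" using assoc_mult_mat_vec[OF M inv(1) q] inv(2) q by simp
  finally show ?thesis using y by blast
qed

text \<open>The normal equations: \<open>q\<close> is chosen with
  \<open>J\<^sup>T (u - J q) = 0\<close>.\<close>

lemma range_kernel_decompose:
  assumes u: "u \<in> carrier_vec m"
  shows "\<exists>q\<in>carrier_vec r. \<exists>p\<in>carrier_vec m. u = Jc *\<^sub>v q + p \<and> Jc\<^sup>T *\<^sub>v p = 0\<^sub>v r"
proof -
  have Jtu: "Jc\<^sup>T *\<^sub>v u \<in> carrier_vec r" using Jt u by simp
  obtain q where q: "q \<in> carrier_vec r" "Jc\<^sup>T *\<^sub>v (Jc *\<^sub>v q) = Jc\<^sup>T *\<^sub>v u" using JtJ_solve[OF Jtu] by blast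
  have Jq: "Jc *\<^sub>v q \<in> carrier_vec m" using Jcc q by simp
  have "Jc\<^sup>T *\<^sub>v (u - Jc *\<^sub>v q) = 0\<^sub>v r"
    using mult_minus_distrib_mat_vec[OF Jt u Jq] q(2) Jtu by simp
  moreover have "u = Jc *\<^sub>v q + (u - Jc *\<^sub>v q)"
    using u carrier_vecD[OF Jq] by (intro eq_vecI) (simp_all del: index_mult_mat_vec)
  ultimately show ?thesis using q(1) Jq u by (intro bexI[of _ q] bexI[of _ "u - Jc *\<^sub>v q"]) auto
qed

lemma G2_vec: "p \<in> carrier_vec m \<Longrightarrow> G2 m G *\<^sub>v p = Jc *\<^sub>v (Jc\<^sup>T *\<^sub>v p)"
  unfolding G2_J by (rule assoc_mult_mat_vec[OF Jcc Jt])

lemmas expansion = negative_imaginary_expansion_at_0[OF ni g1 g2]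
lemmas G0c = expansion(3)
lemmas G0_herm = negative_imaginary_G0_hermitian[OF min ni g1 g2]

lemma energy:
  assumes "w \<in> carrier_vec m" "p \<in> carrier_vec m" "Jc\<^sup>T *\<^sub>v p = 0\<^sub>v r" "Re l > 0"
  shows "Re l * (2 * Re ((tf_eval G l *\<^sub>v w) \<bullet>c p) - Re ((G0 m G *\<^sub>v p) \<bullet>c p))
    \<le> Re (l * ((tf_eval G l *\<^sub>v w) \<bullet>c w))"
  using assms by (intro ni_energy[OF min ni g1 g2]) (simp_all add: G2_vec mult_zero_vec[OF Jcc])

text \<open>The energy bound with zero signal \<open>w\<close> and \<open>l = 1\<close>.\<close>

lemma G0_nonneg:
  assumes "p \<in> carrier_vec m" "Jc\<^sup>T *\<^sub>v p = 0\<^sub>v r"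
  shows "0 \<le> Re ((G0 m G *\<^sub>v p) \<bullet>c p)"
  using energy[of "0\<^sub>v m" p 1] assms by (simp add: mult_zero_vec[OF Gc])

text \<open>The vector \<open>Jc *\<^sub>v oblique u\<close> is the projection of \<open>u\<close>
  onto the range of \<open>J\<close> that is orthogonal for the possibly indefinite form
  \<open>Gb0\<close>; \<open>N2 u\<close> is \<open>Gb0\<close> applied to the complementary
  part.\<close>

definition oblique :: "complex vec \<Rightarrow> complex vec" where
  "oblique u = matinv K *\<^sub>v (Jc\<^sup>T *\<^sub>v (Gb0 *\<^sub>v u))"

lemma N2c: "N2 \<in> carrier_mat m m"
  using Gb0c unfolding N2_def by (intro minus_carrier_mat) (auto intro!: mult_carrier_mat[OF _ Gb0c] mult_carrier_mat[OF _ Jt] mult_carrier_mat[OF _ Kinv(1)] mult_carrier_mat[OF Gb0c Jcc])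

lemma oblique_carrier: "u \<in> carrier_vec m \<Longrightarrow> oblique u \<in> carrier_vec r"
  unfolding oblique_def using Kinv(1) Jt Gb0c by simp

lemma K_oblique: "u \<in> carrier_vec m \<Longrightarrow> K *\<^sub>v oblique u = Jc\<^sup>T *\<^sub>v (Gb0 *\<^sub>v u)"
  unfolding oblique_def
  using assoc_mult_mat_vec[OF Kc Kinv(1), of "Jc\<^sup>T *\<^sub>v (Gb0 *\<^sub>v u)"] Kinv(2) Jt Gb0c by simp

lemma Gb0_N2:
  assumes u: "u \<in> carrier_vec m"
  shows "Gb0 *\<^sub>v u = N2 *\<^sub>v u + Gb0 *\<^sub>v (Jc *\<^sub>v oblique u)"
proof -
  have c: "Gb0 * Jc \<in> carrier_mat m r" "Gb0 * Jc * matinv K \<in> carrier_mat m r" "Gb0 * Jc * matinv K * Jc\<^sup>T \<in> carrier_mat m m"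
    "Gb0 * Jc * matinv K * Jc\<^sup>T * Gb0 \<in> carrier_mat m m"
    using Gb0c Jcc Kinv(1) Jt by auto
  have v: "Gb0 *\<^sub>v u \<in> carrier_vec m" "Jc\<^sup>T *\<^sub>v (Gb0 *\<^sub>v u) \<in> carrier_vec r" using Gb0c Jt u by auto
  have w: "Gb0 *\<^sub>v (Jc *\<^sub>v oblique u) \<in> carrier_vec m" using Gb0c Jcc oblique_carrier[OF u] by simp
  have "N2 *\<^sub>v u = Gb0 *\<^sub>v u - (Gb0 * Jc * matinv K * Jc\<^sup>T * Gb0) *\<^sub>v u"
    unfolding N2_def by (rule minus_mult_distrib_mat_vec[OF Gb0c c(4) u])
  also have "(Gb0 * Jc * matinv K * Jc\<^sup>T * Gb0) *\<^sub>v u = Gb0 *\<^sub>v (Jc *\<^sub>v oblique u)"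
    using assoc_mult_mat_vec[OF c(3) Gb0c u] assoc_mult_mat_vec[OF c(2) Jt v(1)]
      assoc_mult_mat_vec[OF c(1) Kinv(1) v(2)] assoc_mult_mat_vec[OF Gb0c Jcc oblique_carrier[OF u]]
    by (simp add: oblique_def)
  finally have eq: "N2 *\<^sub>v u = Gb0 *\<^sub>v u - Gb0 *\<^sub>v (Jc *\<^sub>v oblique u)" .
  show ?thesis unfolding eq
    using carrier_vecD[OF v(1)] carrier_vecD[OF w] by (intro eq_vecI) (simp_all del: index_mult_mat_vec)
qed

text \<open>Orthogonality of the oblique projection. It makes every \<open>N2 u\<close> admissible
  as \<open>p\<close> in the energy bound.\<close>

lemma Jt_N2:
  assumes u: "u \<in> carrier_vec m"
  shows "Jc\<^sup>T *\<^sub>v (N2 *\<^sub>v u) = 0\<^sub>v r"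
proof -
  have N: "N2 *\<^sub>v u \<in> carrier_vec m" and w: "Gb0 *\<^sub>v (Jc *\<^sub>v oblique u) \<in> carrier_vec m"
    using N2c u Gb0c Jcc oblique_carrier[OF u] by auto
  have JN: "Jc\<^sup>T *\<^sub>v (N2 *\<^sub>v u) \<in> carrier_vec r" and Kr: "K *\<^sub>v oblique u \<in> carrier_vec r"
    using Jt N Kc oblique_carrier[OF u] by auto
  have "K *\<^sub>v oblique u = Jc\<^sup>T *\<^sub>v (N2 *\<^sub>v u + Gb0 *\<^sub>v (Jc *\<^sub>v oblique u))"
    unfolding K_oblique[OF u] using Gb0_N2[OF u] by simp
  also have "\<dots> = Jc\<^sup>T *\<^sub>v (N2 *\<^sub>v u) + K *\<^sub>v oblique u"
    using mult_add_distrib_mat_vec[OF Jt N w] K_vec[OF oblique_carrier[OF u]] by simp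
  finally have eq: "K *\<^sub>v oblique u = Jc\<^sup>T *\<^sub>v (N2 *\<^sub>v u) + K *\<^sub>v oblique u" .
  show ?thesis
  proof (intro eq_vecI)
    fix i assume "i < dim_vec (0\<^sub>v r :: complex vec)"
    then show "(Jc\<^sup>T *\<^sub>v (N2 *\<^sub>v u)) $ i = 0\<^sub>v r $ i"
      using arg_cong[OF eq, of "\<lambda>v. v $ i"] carrier_vecD[OF JN] carrier_vecD[OF Kr] by (simp del: index_mult_mat_vec)
  qed (use carrier_vecD[OF JN] in simp)
qed

text \<open>Pythagoras for the oblique splitting, whose cross terms vanish. The upper energy bound
  thus separates into a part governed by \<open>N2\<close> and a part governed by
  \<open>K\<close>.\<close>

lemma Gb0_form:
  assumes u: "u \<in> carrier_vec m"
  shows "(Gb0 *\<^sub>v u) \<bullet>c u = (N2 *\<^sub>v u) \<bullet>c u + (K *\<^sub>v oblique u) \<bullet>c oblique u"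
proof -
  note o = oblique_carrier[OF u]
  have N: "N2 *\<^sub>v u \<in> carrier_vec m" and Jo: "Jc *\<^sub>v oblique u \<in> carrier_vec m"
    and w: "Gb0 *\<^sub>v (Jc *\<^sub>v oblique u) \<in> carrier_vec m" and v: "Gb0 *\<^sub>v u \<in> carrier_vec m"
    using N2c u Gb0c Jcc o by auto
  have "(Gb0 *\<^sub>v u) \<bullet>c u = (N2 *\<^sub>v u) \<bullet>c u + (Gb0 *\<^sub>v (Jc *\<^sub>v oblique u)) \<bullet>c u"
    using Gb0_N2[OF u] cinner_add_left[OF N w u] by simp
  also have "(Gb0 *\<^sub>v (Jc *\<^sub>v oblique u)) \<bullet>c u = oblique u \<bullet>c (K *\<^sub>v oblique u)"
    using hermitian_mat_cinner[OF Gb0_herm Gb0c Jo u] Jt_cinner[OF o v] K_oblique[OF u] by simp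
  also have "\<dots> = (K *\<^sub>v oblique u) \<bullet>c oblique u"
    using hermitian_mat_cinner[OF K_herm Kc o o] by simp
  finally show ?thesis .
qed

lemma K_neg_def_iff: "neg_def K \<longleftrightarrow> (\<forall>v\<in>carrier_vec r. v \<noteq> 0\<^sub>v r \<longrightarrow> Re ((K *\<^sub>v v) \<bullet>c v) < 0)"
  using K_herm Kc by (auto simp: neg_def_def)

lemma K_nonpos: "neg_def K \<Longrightarrow> v \<in> carrier_vec r \<Longrightarrow> Re ((K *\<^sub>v v) \<bullet>c v) \<le> 0"
  using Kc by (cases "v = 0\<^sub>v r") (auto simp: K_neg_def_iff mult_zero_vec[OF Kc] intro: less_imp_le)

text \<open>The energy \<open>E\<close> is \<open>Re (k w\<^sup>* u) / Re k\<close> for a closed loop eigenvalue \<open>k\<close> in the right half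
  plane, and its limit for \<open>k = 0\<close>.\<close>

lemma energy_balance_imp_zero:
  assumes u: "u \<in> carrier_vec m"
    and lower: "\<And>p. p \<in> carrier_vec m \<Longrightarrow> Jc\<^sup>T *\<^sub>v p = 0\<^sub>v r \<Longrightarrow>
      2 * Re (u \<bullet>c p) - Re ((G0 m G *\<^sub>v p) \<bullet>c p) \<le> E"
    and upper: "E \<le> Re ((Gb0 *\<^sub>v u) \<bullet>c u)" and Gu: "Gb0 *\<^sub>v u = 0\<^sub>v m"
  shows "u = 0\<^sub>v m"
proof -
  have E: "E \<le> 0" using upper Gu u by simp
  obtain q p where qp: "q \<in> carrier_vec r" "p \<in> carrier_vec m" "u = Jc *\<^sub>v q + p" "Jc\<^sup>T *\<^sub>v p = 0\<^sub>v r"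
    using range_kernel_decompose[OF u] by blast
  have Jq: "Jc *\<^sub>v q \<in> carrier_vec m" using Jcc qp by simp
  \<comment> \<open>Since \<open>E \<le> 0\<close>, the lower bound at all real multiples
    \<open>t p\<close> is a quadratic inequality in \<open>t\<close> without constant term.\<close>
  have "- Re (u \<bullet>c p) = 0"
  proof (rule nonneg_quadratic_imp_linear_zero)
    fix t :: real
    let ?p = "complex_of_real t \<cdot>\<^sub>v p"
    have "Jc\<^sup>T *\<^sub>v ?p = 0\<^sub>v r" using qp mult_mat_vec[OF Jt qp(2)] by (intro eq_vecI) auto
    then have "2 * Re (u \<bullet>c ?p) - Re ((G0 m G *\<^sub>v ?p) \<bullet>c ?p) \<le> 0" using lower[of ?p] qp(2) E by simp
    moreover have "(G0 m G *\<^sub>v ?p) \<bullet>c ?p = complex_of_real (t\<^sup>2) * ((G0 m G *\<^sub>v p) \<bullet>c p)"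
      using qp(2) G0c by (simp add: mult_mat_vec[of _ m m] cinner_simps[where n = m] power2_eq_square mult.assoc)
    moreover have "u \<bullet>c ?p = complex_of_real t * (u \<bullet>c p)" using u qp(2) by (simp add: cinner_smult_right[of _ m])
    ultimately show "0 \<le> 2 * t * - Re (u \<bullet>c p) + t\<^sup>2 * Re ((G0 m G *\<^sub>v p) \<bullet>c p)" by simp
  qed
  moreover have "u \<bullet>c p = p \<bullet>c p"
    unfolding qp(3) using cinner_add_left[OF Jq qp(2,2)] Jt_cinner[OF qp(1,2)] qp(1,4) by simp
  ultimately have "p = 0\<^sub>v m" using qp(2) by (intro cinner_self_eq_0[of _ m]) simp_all
  then have uJ: "u = Jc *\<^sub>v q" using qp(3) Jq by simp
  then have "K *\<^sub>v q = 0\<^sub>v r" using Gu K_vec[OF qp(1)] mult_zero_vec[OF Jt] by simp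
  then have "q = 0\<^sub>v r" by (rule K_inj[OF qp(1)])
  then show ?thesis using uJ mult_zero_vec[OF Jcc] by simp
qed

text \<open>A nonnegative value of a negative definite form forces \<open>oblique u = 0\<close>, and
  then \<open>Gb0 u\<close> reduces to \<open>N2 u\<close>.\<close>

lemma Gb0_kernelI:
  assumes u: "u \<in> carrier_vec m" and N: "N2 *\<^sub>v u = 0\<^sub>v m" and K: "neg_def K" "Re ((K *\<^sub>v oblique u) \<bullet>c oblique u) \<ge> 0"
  shows "Gb0 *\<^sub>v u = 0\<^sub>v m"
proof -
  have "oblique u = 0\<^sub>v r" using K oblique_carrier[OF u] by (force simp: K_neg_def_iff)
  then show ?thesis using Gb0_N2[OF u] N by (simp add: mult_zero_vec[OF Jcc] mult_zero_vec[OF Gb0c])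
qed

text \<open>Let \<open>S\<close> be the root of \<open>N2\<close>, \<open>v = S u\<close> and
  \<open>H = S G0 S\<close>. For \<open>p = N2 u\<close> the lower bound is
  \<open>2 |v|\<^sup>2 - v\<^sup>* H v\<close> and the upper bound is \<open>|v|\<^sup>2\<close>
  plus the form of \<open>K\<close>. Hence the form of \<open>I - H\<close> at \<open>v\<close> is
  at most a nonpositive number, which forces \<open>v = 0\<close>.\<close>

lemma energy_balance_pos_semidef:
  assumes N: "pos_semidef N2" and K: "neg_def K"
    and pd: "pos_def (1\<^sub>m m - psd_sqrt N2 * G0 m G * psd_sqrt N2)"
    and u: "u \<in> carrier_vec m"
    and lower: "\<And>p. p \<in> carrier_vec m \<Longrightarrow> Jc\<^sup>T *\<^sub>v p = 0\<^sub>v r \<Longrightarrow>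
      2 * Re (u \<bullet>c p) - Re ((G0 m G *\<^sub>v p) \<bullet>c p) \<le> E"
    and upper: "E \<le> Re ((Gb0 *\<^sub>v u) \<bullet>c u)"
  shows "u = 0\<^sub>v m"
proof (rule energy_balance_imp_zero[OF u lower upper])
  let ?S = "psd_sqrt N2" and ?H = "psd_sqrt N2 * G0 m G * psd_sqrt N2"
  note S = psd_sqrt[OF N2c N]
  have Sh: "hermitian_mat ?S" using S(2) by (simp add: pos_semidef_def)
  have Hc: "?H \<in> carrier_mat m m" using S(1) G0c by auto
  let ?v = "?S *\<^sub>v u" and ?p = "N2 *\<^sub>v u"
  have v: "?v \<in> carrier_vec m" and p: "?p \<in> carrier_vec m" using S(1) N2c u by auto
  have Sv: "?S *\<^sub>v ?v = ?p" using assoc_mult_mat_vec[OF S(1) S(1) u] S(3) by simp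
  have Hv: "?H *\<^sub>v ?v = ?S *\<^sub>v (G0 m G *\<^sub>v ?p)"
    using assoc_mult_mat_vec[OF mult_carrier_mat[OF S(1) G0c] S(1) v] assoc_mult_mat_vec[OF S(1) G0c p] Sv by simp
  have Gp: "G0 m G *\<^sub>v ?p \<in> carrier_vec m" using G0c p by simp
  have "(?H *\<^sub>v ?v) \<bullet>c ?v = (G0 m G *\<^sub>v ?p) \<bullet>c ?p"
    unfolding Hv using hermitian_mat_cinner[OF Sh S(1) Gp v] Sv by simp
  moreover have vv: "?v \<bullet>c ?v = u \<bullet>c ?p" using hermitian_mat_cinner[OF Sh S(1) u v] Sv by simp
  moreover have "(1\<^sub>m m - ?H) *\<^sub>v ?v = ?v - ?H *\<^sub>v ?v"
    using minus_mult_distrib_mat_vec[OF one_carrier_mat Hc v] v by simp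
  ultimately have form: "((1\<^sub>m m - ?H) *\<^sub>v ?v) \<bullet>c ?v = u \<bullet>c ?p - (G0 m G *\<^sub>v ?p) \<bullet>c ?p"
    using cinner_diff_left[OF v mult_mat_vec_carrier[OF Hc v] v] by simp
  have "Re ((N2 *\<^sub>v u) \<bullet>c u) = Re (u \<bullet>c ?p)"
    unfolding cinner_commute[OF p u] by simp
  then have main: "Re (((1\<^sub>m m - ?H) *\<^sub>v ?v) \<bullet>c ?v) \<le> Re ((K *\<^sub>v oblique u) \<bullet>c oblique u)"
    using lower[OF p Jt_N2[OF u]] upper Gb0_form[OF u] unfolding form by simp
  have Kle: "Re ((K *\<^sub>v oblique u) \<bullet>c oblique u) \<le> 0" by (rule K_nonpos[OF K oblique_carrier[OF u]])
  have v0: "?v = 0\<^sub>v m"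
  proof (rule ccontr)
    assume "?v \<noteq> 0\<^sub>v m"
    then have "0 < Re (((1\<^sub>m m - ?H) *\<^sub>v ?v) \<bullet>c ?v)" using pd v Hc by (auto simp: pos_def_def)
    then show False using main Kle by simp
  qed
  then have p0: "?p = 0\<^sub>v m" using Sv mult_zero_vec[OF S(1)] by simp
  have "Re (((1\<^sub>m m - ?H) *\<^sub>v ?v) \<bullet>c ?v) = 0"
    unfolding form p0 using mult_zero_vec[OF G0c] u by simp
  then show "Gb0 *\<^sub>v u = 0\<^sub>v m" using Gb0_kernelI[OF u p0 K] main by simp
qed

text \<open>With \<open>p = 0\<close> the lower bound gives \<open>0 \<le> E\<close>, whereas the
  upper bound is a sum of two nonpositive forms. So both vanish, and a semidefinite form vanishes
  only on its kernel.\<close>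

lemma energy_balance_neg_semidef:
  assumes N: "neg_semidef N2" and K: "neg_def K" and u: "u \<in> carrier_vec m"
    and lower: "\<And>p. p \<in> carrier_vec m \<Longrightarrow> Jc\<^sup>T *\<^sub>v p = 0\<^sub>v r \<Longrightarrow>
      2 * Re (u \<bullet>c p) - Re ((G0 m G *\<^sub>v p) \<bullet>c p) \<le> E"
    and upper: "E \<le> Re ((Gb0 *\<^sub>v u) \<bullet>c u)"
  shows "u = 0\<^sub>v m"
proof (rule energy_balance_imp_zero[OF u lower upper])
  have "0 \<le> E" using lower[of "0\<^sub>v m"] u by (simp add: mult_zero_vec[OF Jt] mult_zero_vec[OF G0c])
  moreover have Nle: "Re ((N2 *\<^sub>v u) \<bullet>c u) \<le> 0" using N u N2c by (auto simp: neg_semidef_def)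
  moreover have Kle: "Re ((K *\<^sub>v oblique u) \<bullet>c oblique u) \<le> 0" by (rule K_nonpos[OF K oblique_carrier[OF u]])
  ultimately have 0: "Re ((N2 *\<^sub>v u) \<bullet>c u) = 0" "Re ((K *\<^sub>v oblique u) \<bullet>c oblique u) = 0"
    using upper Gb0_form[OF u] by auto
  have herm: "hermitian_mat N2" using N by (simp add: neg_semidef_def)
  have "Re ((N2 *\<^sub>v x) \<bullet>c x) \<le> 0" if "x \<in> carrier_vec m" for x
    using N that N2c by (auto simp: neg_semidef_def)
  then have Nu: "N2 *\<^sub>v u = 0\<^sub>v m" by (rule neg_semidef_form_zero_imp_kernel[OF herm N2c _ u 0(1)])
  show "Gb0 *\<^sub>v u = 0\<^sub>v m" by (rule Gb0_kernelI[OF u Nu K]) (simp add: 0)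
qed

end

lemma cinner_append_zero:
  fixes x y a :: "complex vec"
  assumes "x \<in> carrier_vec n" "y \<in> carrier_vec k" "a \<in> carrier_vec n"
  shows "(x @\<^sub>v y) \<bullet>c (a @\<^sub>v 0\<^sub>v k) = x \<bullet>c a"
proof -
  have "conjugate (a @\<^sub>v 0\<^sub>v k) = conjugate a @\<^sub>v (0\<^sub>v k :: complex vec)" by (intro eq_vecI) auto
  then show ?thesis using assms scalar_prod_append[of x n y k "conjugate a" "0\<^sub>v k"] by simp
qed

section \<open>State equations of the loop and sufficiency of the conditions\<close>

context ni_feedback
begin

abbreviation Loop :: "real mat" where
  "Loop \<equiv> closed_loop_matrix m A B C (0\<^sub>m m m) A' B' C' D'"

lemma Loop_carrier: "Loop \<in> carrier_mat (n + n') (n + n')" "cmat Loop \<in> carrier_mat (n + n') (n + n')"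
  using real_carriers by (auto simp: closed_loop_matrix_strictly_proper[OF real_carriers])

lemmas Loop_vec = closed_loop_mult_vec[OF real_carriers]

text \<open>Here \<open>d\<close> is an exogenous signal added to the input of \<open>G\<close>, so
  it drives only the first block of the state.\<close>

lemma loop_equation:
  assumes x: "x \<in> carrier_vec n" and y: "y \<in> carrier_vec n'" and d: "d \<in> carrier_vec m"
  defines "u \<equiv> cmat C *\<^sub>v x"
  shows "s \<cdot>\<^sub>v (x @\<^sub>v y) = cmat Loop *\<^sub>v (x @\<^sub>v y) + ((cmat B *\<^sub>v d) @\<^sub>v 0\<^sub>v n') \<longleftrightarrow>
    s \<cdot>\<^sub>v x = cmat A *\<^sub>v x + cmat B *\<^sub>v (cmat C' *\<^sub>v y + cmat D' *\<^sub>v u + d) \<and>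
    s \<cdot>\<^sub>v y = cmat A' *\<^sub>v y + cmat B' *\<^sub>v u"
proof -
  note c = state_carriers
  have u: "u \<in> carrier_vec m" using c x by (simp add: u_def)
  let ?v = "cmat C' *\<^sub>v y + cmat D' *\<^sub>v u"
  have v: "?v \<in> carrier_vec m" using c y u by simp
  have e: "cmat A *\<^sub>v x \<in> carrier_vec n" "cmat B *\<^sub>v ?v \<in> carrier_vec n" "cmat B *\<^sub>v d \<in> carrier_vec n"
    "cmat A' *\<^sub>v y \<in> carrier_vec n'" "cmat B' *\<^sub>v u \<in> carrier_vec n'"
    using c x y u v d by auto
  have "cmat Loop *\<^sub>v (x @\<^sub>v y) + ((cmat B *\<^sub>v d) @\<^sub>v 0\<^sub>v n') =
      (cmat A *\<^sub>v x + cmat B *\<^sub>v ?v + cmat B *\<^sub>v d) @\<^sub>v (cmat A' *\<^sub>v y + cmat B' *\<^sub>v u + 0\<^sub>v n')"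
    unfolding Loop_vec[OF x y] u_def[symmetric] by (rule append_vec_add[of _ n _ _ n']) (use e in auto)
  also have "cmat A *\<^sub>v x + cmat B *\<^sub>v ?v + cmat B *\<^sub>v d = cmat A *\<^sub>v x + cmat B *\<^sub>v (?v + d)"
    using assoc_add_vec[OF e(1,2,3)] mult_add_distrib_mat_vec[OF c(2) v d] by simp
  also have "cmat A' *\<^sub>v y + cmat B' *\<^sub>v u + 0\<^sub>v n' = cmat A' *\<^sub>v y + cmat B' *\<^sub>v u"
    using e by simp
  finally have rhs: "cmat Loop *\<^sub>v (x @\<^sub>v y) + ((cmat B *\<^sub>v d) @\<^sub>v 0\<^sub>v n') =
      (cmat A *\<^sub>v x + cmat B *\<^sub>v (?v + d)) @\<^sub>v (cmat A' *\<^sub>v y + cmat B' *\<^sub>v u)" .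
  have "cmat A *\<^sub>v x + cmat B *\<^sub>v (?v + d) \<in> carrier_vec n" "s \<cdot>\<^sub>v x \<in> carrier_vec n"
    using e x v d mult_mat_vec_carrier[OF c(2), of "?v + d"] by auto
  then show ?thesis unfolding smult_append_vec rhs by (intro append_vec_eq)
qed

lemma loop_equation_homogeneous:
  assumes x: "x \<in> carrier_vec n" and y: "y \<in> carrier_vec n'"
  defines "u \<equiv> cmat C *\<^sub>v x"
  shows "cmat Loop *\<^sub>v (x @\<^sub>v y) = s \<cdot>\<^sub>v (x @\<^sub>v y) \<longleftrightarrow>
    s \<cdot>\<^sub>v x = cmat A *\<^sub>v x + cmat B *\<^sub>v (cmat C' *\<^sub>v y + cmat D' *\<^sub>v u) \<and>
    s \<cdot>\<^sub>v y = cmat A' *\<^sub>v y + cmat B' *\<^sub>v u"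
proof -
  have u: "u \<in> carrier_vec m" using state_carriers x by (simp add: u_def)
  have "cmat A *\<^sub>v x + cmat B *\<^sub>v (cmat C' *\<^sub>v y + cmat D' *\<^sub>v u) \<in> carrier_vec n"
    using state_carriers x y u by simp
  then show ?thesis
    unfolding Loop_vec[OF x y] smult_append_vec u_def[symmetric]
    using append_vec_eq[of "s \<cdot>\<^sub>v x" n "cmat A *\<^sub>v x + cmat B *\<^sub>v (cmat C' *\<^sub>v y + cmat D' *\<^sub>v u)"] x
    by (metis smult_carrier_vec)
qed

lemma chi'_nonzero: "Re s \<ge> 0 \<Longrightarrow> poly (char_poly (cmat A')) s \<noteq> 0"
  using minimal_eigenvalue_imp_pole[OF min'] sni by (auto simp: strictly_negative_imaginary_def)

lemma chi_nonzero: "Re s > 0 \<Longrightarrow> poly (char_poly (cmat A)) s \<noteq> 0"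
  using minimal_eigenvalue_imp_pole[OF min] ni by (auto simp: negative_imaginary_def)

lemma zero_feedthrough: "w \<in> carrier_vec m \<Longrightarrow> x \<in> carrier_vec n \<Longrightarrow>
    cmat C *\<^sub>v x + cmat (0\<^sub>m m m) *\<^sub>v w = cmat C *\<^sub>v x"
  using state_carriers by (intro eq_vecI) (auto simp: scalar_prod_def)

lemma G_eval:
  assumes "poly (char_poly (cmat A)) s \<noteq> 0" "x \<in> carrier_vec n" "w \<in> carrier_vec m"
    "s \<cdot>\<^sub>v x = cmat A *\<^sub>v x + cmat B *\<^sub>v w"
  shows "tf_eval G s *\<^sub>v w = cmat C *\<^sub>v x"
  using tf_eval_realization(2)[OF R assms] zero_feedthrough[OF assms(3,2)] by simp

lemma Gb_eval:
  assumes "Re s \<ge> 0" "y \<in> carrier_vec n'" "u \<in> carrier_vec m"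
    "s \<cdot>\<^sub>v y = cmat A' *\<^sub>v y + cmat B' *\<^sub>v u"
  shows "tf_eval Gb s *\<^sub>v u = cmat C' *\<^sub>v y + cmat D' *\<^sub>v u"
  by (rule tf_eval_realization(2)[OF R' chi'_nonzero[OF assms(1)] assms(2-4)])

lemma Gb_lim: "Re s \<ge> 0 \<Longrightarrow> i < m \<Longrightarrow> j < m \<Longrightarrow> ((\<lambda>s. tf_eval Gb s $$ (i, j)) \<longlongrightarrow> tf_eval Gb s $$ (i, j)) (at s)"
  using sni GG by (intro tendsto_tf_eval) (auto simp: strictly_negative_imaginary_def)

text \<open>If the output \<open>cmat C *\<^sub>v x\<close> of a mode vanishes, then
  \<open>y\<close> solves the homogeneous state equation off the spectrum of \<open>A'\<close> and
  is 0; thus \<open>x\<close> satisfies the eigenvector equation of \<open>A\<close> with zero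
  output, and observability makes it 0. So it is enough to exclude modes with nonzero
  output.\<close>

lemma hurwitz_LoopI:
  assumes *: "\<And>k x w. Re k \<ge> 0 \<Longrightarrow> x \<in> carrier_vec n \<Longrightarrow> w = tf_eval Gb k *\<^sub>v (cmat C *\<^sub>v x) \<Longrightarrow>
    k \<cdot>\<^sub>v x = cmat A *\<^sub>v x + cmat B *\<^sub>v w \<Longrightarrow> cmat C *\<^sub>v x = 0\<^sub>v m"
  shows "hurwitz Loop"
  unfolding hurwitz_def
proof (intro conjI allI impI)
  show "square_mat Loop" using Loop_carrier(1) by auto
  note c = state_carriers
  fix k assume "eigenvalue (cmat Loop) k"
  then obtain v where v: "v \<in> carrier_vec (n + n')" "v \<noteq> 0\<^sub>v (n + n')" "cmat Loop *\<^sub>v v = k \<cdot>\<^sub>v v"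
    using Loop_carrier by (auto simp: eigenvalue_def eigenvector_def)
  obtain x y where xy: "x \<in> carrier_vec n" "y \<in> carrier_vec n'" "v = x @\<^sub>v y"
    using append_vec_decompose[OF v(1)] by blast
  let ?u = "cmat C *\<^sub>v x"
  have u: "?u \<in> carrier_vec m" using c xy by simp
  have eqs: "k \<cdot>\<^sub>v x = cmat A *\<^sub>v x + cmat B *\<^sub>v (cmat C' *\<^sub>v y + cmat D' *\<^sub>v ?u)"
    "k \<cdot>\<^sub>v y = cmat A' *\<^sub>v y + cmat B' *\<^sub>v ?u"
    using v(3) loop_equation_homogeneous[OF xy(1,2), of k] unfolding xy(3) by auto
  show "Re k < 0"
  proof (rule ccontr)
    assume "\<not> Re k < 0"
    then have k: "Re k \<ge> 0" by simp
    have w: "cmat C' *\<^sub>v y + cmat D' *\<^sub>v ?u = tf_eval Gb k *\<^sub>v ?u"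
      using Gb_eval[OF k xy(2) u eqs(2)] by simp
    have u0: "?u = 0\<^sub>v m" by (rule *[OF k xy(1) w eqs(1)])
    have z: "cmat B' *\<^sub>v 0\<^sub>v m = 0\<^sub>v n'" "cmat B *\<^sub>v 0\<^sub>v m = 0\<^sub>v n" "cmat A' *\<^sub>v 0\<^sub>v n' = 0\<^sub>v n'"
      "tf_eval Gb k *\<^sub>v 0\<^sub>v m = 0\<^sub>v m" "k \<cdot>\<^sub>v 0\<^sub>v n' = 0\<^sub>v n'"
      using c Gbc by (auto intro!: mult_zero_vec)
    have y0: "y = 0\<^sub>v n'"
      using resolvent_unique[OF c(4) chi'_nonzero[OF k] xy(2), of "0\<^sub>v n'" "0\<^sub>v n'"] eqs(2) u0 z by simp
    have "k \<cdot>\<^sub>v x = cmat A *\<^sub>v x + cmat B *\<^sub>v (tf_eval Gb k *\<^sub>v ?u)" using eqs(1) unfolding w .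
    then have "cmat A *\<^sub>v x = k \<cdot>\<^sub>v x" unfolding u0 z using c xy by simp
    then have "x = 0\<^sub>v n" using minimal_realization_observable[OF min xy(1) _ u0] by blast
    then have "v = 0\<^sub>v (n + n')" using y0 unfolding xy(3) by (intro eq_vecI) auto
    with v(2) show False by contradiction
  qed
qed

lemma G_approx:
  assumes "x \<in> carrier_vec n" "w \<in> carrier_vec m" "k \<cdot>\<^sub>v x = cmat A *\<^sub>v x + cmat B *\<^sub>v w"
  shows "\<exists>W. (\<forall>s. W s \<in> carrier_vec m) \<and> vec_tendsto m W w (at k) \<and>
    vec_tendsto m (\<lambda>s. tf_eval G s *\<^sub>v W s) (cmat C *\<^sub>v x) (at k)"
  using minimal_transfer_approx[OF min assms] zero_feedthrough[OF assms(2,1)] by simp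

text \<open>For \<open>G\<close> the imaginary part weighted by \<open>\<omega>\<close> is
  nonpositive along the axis, and this survives the limit even at a pole. For \<open>Gb\<close> it
  is strictly negative if \<open>u \<noteq> 0\<close>. Exchanging the arguments of the inner product
  of \<open>u\<close> and \<open>w\<close> flips the sign, so the two are incompatible.\<close>

lemma imaginary_closed_loop_mode_zero:
  assumes w0: "\<omega> \<noteq> 0" and x: "x \<in> carrier_vec n"
    and w: "w = tf_eval Gb (\<i> * complex_of_real \<omega>) *\<^sub>v (cmat C *\<^sub>v x)"
    and eq: "(\<i> * complex_of_real \<omega>) \<cdot>\<^sub>v x = cmat A *\<^sub>v x + cmat B *\<^sub>v w"
  shows "cmat C *\<^sub>v x = 0\<^sub>v m"
proof (rule ccontr)
  let ?k = "\<i> * complex_of_real \<omega>" and ?u = "cmat C *\<^sub>v x"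
  assume nz: "?u \<noteq> 0\<^sub>v m"
  have u: "?u \<in> carrier_vec m" using state_carriers x by simp
  have wc: "w \<in> carrier_vec m" unfolding w by (rule mult_mat_vec_carrier[OF Gbc u])
  obtain W where W: "\<And>s. W s \<in> carrier_vec m" "vec_tendsto m W w (at ?k)"
    "vec_tendsto m (\<lambda>s. tf_eval G s *\<^sub>v W s) ?u (at ?k)"
    using G_approx[OF x wc eq] by blast
  have "((\<lambda>s. (tf_eval G s *\<^sub>v W s) \<bullet>c W s) \<longlongrightarrow> ?u \<bullet>c w) (at ?k)"
    by (rule tendsto_cinner[OF W(3) W(2) W(1) wc])
  from filterlim_compose[OF this filterlim_imaginary_axis[of \<omega> UNIV]]
  have "((\<lambda>t. t * Im ((tf_eval G (\<i> * complex_of_real t) *\<^sub>v W (\<i> * complex_of_real t)) \<bullet>c W (\<i> * complex_of_real t)))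
    \<longlongrightarrow> \<omega> * Im (?u \<bullet>c w)) (at \<omega>)"
    by (intro tendsto_intros)
  moreover have "eventually (\<lambda>t. t * Im ((tf_eval G (\<i> * complex_of_real t) *\<^sub>v W (\<i> * complex_of_real t)) \<bullet>c
      W (\<i> * complex_of_real t)) \<le> 0) (at \<omega>)"
  proof -
    have "eventually (\<lambda>t. \<not> tf_pole G (\<i> * complex_of_real t)) (at \<omega>)"
      by (rule eventually_compose_filterlim[OF minimal_eventually_not_pole[OF min] filterlim_imaginary_axis])
    moreover have "eventually (\<lambda>t. t \<noteq> 0) (at \<omega>)"
      using w0 by (intro tendsto_imp_eventually_ne[OF tendsto_ident_at]) auto
    ultimately show ?thesis
      by eventually_elim (use negative_imaginary_axis_nonneg[OF ni] W(1) in \<open>auto simp: axis_nonneg_def\<close>)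
  qed
  ultimately have "\<omega> * Im (?u \<bullet>c w) \<le> 0" by (rule tendsto_upperbound) simp
  moreover have "\<omega> * Im (w \<bullet>c ?u) < 0"
    unfolding w by (rule strictly_negative_imaginary_strict_both[OF sni w0 u nz])
  moreover have "Im (?u \<bullet>c w) = - Im (w \<bullet>c ?u)" unfolding cinner_commute[OF u wc] by simp
  ultimately show False by simp
qed

lemma filterlim_of_real_at_right_0: "filterlim complex_of_real (at 0) (at_right 0)"
proof (rule filterlim_atI)
  show "(complex_of_real \<longlongrightarrow> 0) (at_right 0)" using tendsto_of_real[OF tendsto_ident_at, of 0 "{0<..}"] by simp
  show "\<forall>\<^sub>F x in at_right 0. complex_of_real x \<noteq> 0" by (auto simp: eventually_at_filter)
qed

text \<open>For \<open>Re k > 0\<close> both energy inequalities hold at \<open>k\<close> itself. At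
  \<open>k = 0\<close>, a pole of \<open>G\<close>, the lower one is divided by \<open>t\<close> at
  positive real \<open>t\<close> and passed to the limit, and the upper one is an equality because
  \<open>w = Gb0 u\<close>.\<close>

lemma closed_loop_mode_energy:
  assumes k: "Re k > 0 \<or> k = 0" and x: "x \<in> carrier_vec n"
    and w: "w = tf_eval Gb k *\<^sub>v (cmat C *\<^sub>v x)"
    and eq: "k \<cdot>\<^sub>v x = cmat A *\<^sub>v x + cmat B *\<^sub>v w"
  defines "u \<equiv> cmat C *\<^sub>v x"
  shows "\<exists>E. (\<forall>p\<in>carrier_vec m. Jc\<^sup>T *\<^sub>v p = 0\<^sub>v r \<longrightarrow> 2 * Re (u \<bullet>c p) - Re ((G0 m G *\<^sub>v p) \<bullet>c p) \<le> E) \<and>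
    E \<le> Re ((Gb0 *\<^sub>v u) \<bullet>c u)"
proof -
  have u: "u \<in> carrier_vec m" using state_carriers x by (simp add: u_def)
  have wc: "w \<in> carrier_vec m" unfolding w u_def[symmetric] by (rule mult_mat_vec_carrier[OF Gbc u])
  show ?thesis
  proof (cases "k = 0")
    case False
    then have k: "Re k > 0" using k by simp
    have Gw: "tf_eval G k *\<^sub>v w = u" unfolding u_def by (rule G_eval[OF chi_nonzero[OF k] x wc eq])
    let ?E = "Re (k * (u \<bullet>c w)) / Re k"
    have "2 * Re (u \<bullet>c p) - Re ((G0 m G *\<^sub>v p) \<bullet>c p) \<le> ?E" if "p \<in> carrier_vec m" "Jc\<^sup>T *\<^sub>v p = 0\<^sub>v r" for p
      using energy[OF wc that k] k unfolding Gw by (simp add: pos_le_divide_eq mult.commute)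
    moreover have "?E \<le> Re ((Gb0 *\<^sub>v u) \<bullet>c u)"
      using sni_energy[OF min' sni u k] k unfolding w u_def[symmetric] Gb0_def
      by (simp add: pos_divide_le_eq mult.commute)
    ultimately show ?thesis by blast
  next
    case True
    obtain W where W: "\<And>s. W s \<in> carrier_vec m" "vec_tendsto m W w (at k)"
      "vec_tendsto m (\<lambda>s. tf_eval G s *\<^sub>v W s) u (at k)"
      using G_approx[OF x wc eq] unfolding u_def by blast
    define V where "V = (\<lambda>t. W (complex_of_real t))"
    define U where "U = (\<lambda>t. tf_eval G (complex_of_real t) *\<^sub>v V t)"
    have V: "V t \<in> carrier_vec m" for t by (simp add: V_def W)
    have lim: "vec_tendsto m V w (at_right 0)" "vec_tendsto m U u (at_right 0)"
      using vec_tendsto_filter_mono[OF W(2)[unfolded True] filterlim_of_real_at_right_0]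
        vec_tendsto_filter_mono[OF W(3)[unfolded True] filterlim_of_real_at_right_0]
      by (simp_all add: V_def U_def)
    have lower: "2 * Re (u \<bullet>c p) - Re ((G0 m G *\<^sub>v p) \<bullet>c p) \<le> Re (u \<bullet>c w)"
      if p: "p \<in> carrier_vec m" "Jc\<^sup>T *\<^sub>v p = 0\<^sub>v r" for p
    proof (rule tendsto_le)
      show "((\<lambda>t. Re (U t \<bullet>c V t)) \<longlongrightarrow> Re (u \<bullet>c w)) (at_right 0)"
        by (intro tendsto_intros tendsto_cinner[OF lim(2,1) V wc])
      show "((\<lambda>t. 2 * Re (U t \<bullet>c p) - Re ((G0 m G *\<^sub>v p) \<bullet>c p)) \<longlongrightarrow>
          2 * Re (u \<bullet>c p) - Re ((G0 m G *\<^sub>v p) \<bullet>c p)) (at_right 0)"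
        by (intro tendsto_intros tendsto_cinner[OF lim(2) vec_tendsto_const]) (use p in auto)
      show "eventually (\<lambda>t. 2 * Re (U t \<bullet>c p) - Re ((G0 m G *\<^sub>v p) \<bullet>c p) \<le> Re (U t \<bullet>c V t)) (at_right 0)"
        using eventually_at_right_less[of "0::real"]
      proof eventually_elim
        case (elim t)
        have "t * (2 * Re (U t \<bullet>c p) - Re ((G0 m G *\<^sub>v p) \<bullet>c p)) \<le> t * Re (U t \<bullet>c V t)"
          using energy[OF V p, of "complex_of_real t" t] elim by (simp add: U_def)
        then show ?case using elim by (rule mult_left_le_imp_le)
      qed
    qed simp
    have "w = Gb0 *\<^sub>v u" unfolding w u_def Gb0_def True ..
    then have "Re (u \<bullet>c w) = Re ((Gb0 *\<^sub>v u) \<bullet>c u)" using cinner_commute[OF u wc] by simp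
    with lower show ?thesis by (intro exI[of _ "Re (u \<bullet>c w)"]) auto
  qed
qed

lemma hurwitz_Loop_sufficient:
  assumes *: "\<And>u E. u \<in> carrier_vec m \<Longrightarrow>
    (\<And>p. p \<in> carrier_vec m \<Longrightarrow> Jc\<^sup>T *\<^sub>v p = 0\<^sub>v r \<Longrightarrow> 2 * Re (u \<bullet>c p) - Re ((G0 m G *\<^sub>v p) \<bullet>c p) \<le> E) \<Longrightarrow>
    E \<le> Re ((Gb0 *\<^sub>v u) \<bullet>c u) \<Longrightarrow> u = 0\<^sub>v m"
  shows "hurwitz Loop"
proof (rule hurwitz_LoopI)
  fix k x w
  assume k: "Re k \<ge> 0" and x: "x \<in> carrier_vec n" and w: "w = tf_eval Gb k *\<^sub>v (cmat C *\<^sub>v x)"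
    and eq: "k \<cdot>\<^sub>v x = cmat A *\<^sub>v x + cmat B *\<^sub>v w"
  show "cmat C *\<^sub>v x = 0\<^sub>v m"
  \<comment> \<open>The remaining points of the closed right half plane are nonzero and imaginary,
    where strictness of \<open>Gb\<close> decides.\<close>
  proof (cases "Re k > 0 \<or> k = 0")
    case True
    have "cmat C *\<^sub>v x \<in> carrier_vec m" using state_carriers x by simp
    then show ?thesis using * closed_loop_mode_energy[OF True x w eq] by blast
  next
    case False
    then have "k = \<i> * complex_of_real (Im k)" "Im k \<noteq> 0" using k by (auto simp: complex_eq_iff)
    then show ?thesis using imaginary_closed_loop_mode_zero[of "Im k" x w] x w eq by metis
  qed
qed

end

section \<open>Passivity of a stable loop and its limit at the origin\<close>

context ni_feedback
begin

lemma Loop_char_poly_nonzero: "hurwitz Loop \<Longrightarrow> Re s \<ge> 0 \<Longrightarrow> poly (char_poly (cmat Loop)) s \<noteq> 0"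
  using eigenvalue_root_char_poly[OF Loop_carrier(2), of s] by (force simp: hurwitz_def)

lemma loop_signals:
  assumes x: "x \<in> carrier_vec n" and y: "y \<in> carrier_vec n'" and d: "d \<in> carrier_vec m"
    and s: "Re s \<ge> 0" "poly (char_poly (cmat A)) s \<noteq> 0"
    and eq: "s \<cdot>\<^sub>v (x @\<^sub>v y) = cmat Loop *\<^sub>v (x @\<^sub>v y) + ((cmat B *\<^sub>v d) @\<^sub>v 0\<^sub>v n')"
  defines "u \<equiv> cmat C *\<^sub>v x"
  shows "u = tf_eval G s *\<^sub>v (tf_eval Gb s *\<^sub>v u + d)"
proof -
  have u: "u \<in> carrier_vec m" using state_carriers x by (simp add: u_def)
  note eqs = eq[unfolded loop_equation[OF x y d] u_def[symmetric]]
  have Gbu: "tf_eval Gb s *\<^sub>v u = cmat C' *\<^sub>v y + cmat D' *\<^sub>v u"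
    using Gb_eval[OF s(1) y u] eqs by simp
  have "tf_eval Gb s *\<^sub>v u + d \<in> carrier_vec m" using mult_mat_vec_carrier[OF Gbc u] d by simp
  moreover have "s \<cdot>\<^sub>v x = cmat A *\<^sub>v x + cmat B *\<^sub>v (tf_eval Gb s *\<^sub>v u + d)"
    unfolding Gbu using eqs by simp
  ultimately have "tf_eval G s *\<^sub>v (tf_eval Gb s *\<^sub>v u + d) = cmat C *\<^sub>v x" by (rule G_eval[OF s(2) x])
  then show ?thesis by (simp add: u_def)
qed

text \<open>Prescribing the input \<open>w\<close> of \<open>G\<close> and reading off
  \<open>d\<close> avoids inverting \<open>I - G Gb\<close>: every \<open>w\<close> occurs for a
  suitable exogenous signal.\<close>

lemma loop_state_exists:
  assumes w: "w \<in> carrier_vec m" and s: "Re s \<ge> 0" "poly (char_poly (cmat A)) s \<noteq> 0"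
  defines "u \<equiv> tf_eval G s *\<^sub>v w"
  defines "d \<equiv> w - tf_eval Gb s *\<^sub>v u"
  shows "\<exists>x\<in>carrier_vec n. \<exists>y\<in>carrier_vec n'. u = cmat C *\<^sub>v x \<and>
    s \<cdot>\<^sub>v (x @\<^sub>v y) = cmat Loop *\<^sub>v (x @\<^sub>v y) + ((cmat B *\<^sub>v d) @\<^sub>v 0\<^sub>v n')"
proof -
  note c = state_carriers
  have "cmat B *\<^sub>v w \<in> carrier_vec n" using c w by simp
  then obtain x where x: "x \<in> carrier_vec n" "s \<cdot>\<^sub>v x = cmat A *\<^sub>v x + cmat B *\<^sub>v w"
    using resolvent_exists[OF c(1) s(2)] by blast
  have ux: "u = cmat C *\<^sub>v x" unfolding u_def by (rule G_eval[OF s(2) x(1) w x(2)])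
  have u: "u \<in> carrier_vec m" using c x by (simp add: ux)
  then have "cmat B' *\<^sub>v u \<in> carrier_vec n'" using c by simp
  then obtain y where y: "y \<in> carrier_vec n'" "s \<cdot>\<^sub>v y = cmat A' *\<^sub>v y + cmat B' *\<^sub>v u"
    using resolvent_exists[OF c(4) chi'_nonzero[OF s(1)]] by blast
  have Gbu: "tf_eval Gb s *\<^sub>v u = cmat C' *\<^sub>v y + cmat D' *\<^sub>v u" by (rule Gb_eval[OF s(1) y(1) u y(2)])
  have v: "tf_eval Gb s *\<^sub>v u \<in> carrier_vec m" by (rule mult_mat_vec_carrier[OF Gbc u])
  have d: "d \<in> carrier_vec m" using w v by (simp add: d_def)
  have "tf_eval Gb s *\<^sub>v u + d = w"
    using carrier_vecD[OF v] carrier_vecD[OF w] unfolding d_def by (intro eq_vecI) (simp_all del: index_mult_mat_vec)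
  then have "s \<cdot>\<^sub>v (x @\<^sub>v y) = cmat Loop *\<^sub>v (x @\<^sub>v y) + ((cmat B *\<^sub>v d) @\<^sub>v 0\<^sub>v n')"
    unfolding loop_equation[OF x(1) y(1) d] ux[symmetric] using x(2) y(2) Gbu by simp
  then show ?thesis using x(1) y(1) ux by blast
qed

text \<open>For a stable loop \<open>s Z(s)\<close>, where \<open>Z\<close> maps \<open>d\<close> to \<open>u\<close>, is positive real: on the imaginary
  axis \<open>Re (s d\<^sup>* u)\<close> is the sum of the nonnegative contributions of \<open>G\<close> and of the feedback.\<close>

lemma loop_passive:
  assumes hur: "hurwitz Loop" and w: "w \<in> carrier_vec m" and l: "Re l > 0"
  defines "u \<equiv> tf_eval G l *\<^sub>v w"
  shows "0 \<le> Re (l * (u \<bullet>c (w - tf_eval Gb l *\<^sub>v u)))"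
proof -
  note c = state_carriers
  let ?chi = "char_poly (cmat A)" and ?L = "char_poly (cmat Loop)"
  \<comment> \<open>The signal is frozen at its value for \<open>l\<close>, so that its inner
    product with the response is a rational function of \<open>s\<close>.\<close>
  define d where "d = w - tf_eval Gb l *\<^sub>v u"
  have u: "u \<in> carrier_vec m" unfolding u_def by (rule mult_mat_vec_carrier[OF Gc w])
  have d: "d \<in> carrier_vec m" unfolding d_def using w mult_mat_vec_carrier[OF Gbc u] by simp
  let ?b = "(cmat B *\<^sub>v d) @\<^sub>v 0\<^sub>v n'" and ?c = "(mat_adjoint (cmat C) *\<^sub>v d) @\<^sub>v 0\<^sub>v n'"
  have Cd: "mat_adjoint (cmat C) *\<^sub>v d \<in> carrier_vec n" by (rule mult_mat_vec_carrier[OF mat_adjoint_carrier[OF c(3)] d])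
  have bc: "?b \<in> carrier_vec (n + n')" "?c \<in> carrier_vec (n + n')" using c d Cd by auto
  \<comment> \<open>The quotient \<open>P / ?L\<close> is \<open>d\<^sup>* u\<close> as a function
    of \<open>s\<close>. It is strictly proper, so the factor \<open>s\<close> keeps it proper, and
    stability of the loop removes all its poles from the closed half plane.\<close>
  obtain P where P: "P = 0 \<or> degree P < n + n'"
    "\<And>s X. poly ?L s \<noteq> 0 \<Longrightarrow> X \<in> carrier_vec (n + n') \<Longrightarrow> s \<cdot>\<^sub>v X = cmat Loop *\<^sub>v X + ?b \<Longrightarrow>
      X \<bullet>c ?c = poly P s / poly ?L s"
    using resolvent_form_numerator[OF Loop_carrier(2) bc] by blast
  have out: "(cmat C *\<^sub>v x) \<bullet>c d = poly P s / poly ?L s"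
    if "Re s \<ge> 0" "x \<in> carrier_vec n" "y \<in> carrier_vec n'" "s \<cdot>\<^sub>v (x @\<^sub>v y) = cmat Loop *\<^sub>v (x @\<^sub>v y) + ?b" for s x y
    using P(2)[OF Loop_char_poly_nonzero[OF hur that(1)] _ that(4)] that(2,3)
      cinner_append_zero[OF that(2,3) Cd] cinner_mult_adjoint[OF c(3) that(2) d] by simp
  have dL: "degree ?L = n + n'" using degree_monic_char_poly[OF Loop_carrier(2)] by simp
  have chi0: "?chi \<noteq> 0" by (rule char_poly_nonzero[OF c(1)])
  have val: "poly ([:0, 1:] * P) s / poly ?L s = s * (poly P s / poly ?L s)" for s by simp
  have "0 \<le> Re (poly ([:0, 1:] * P) l / poly ?L l)"
  \<comment> \<open>The response is regular on the whole axis, but the sign argument evaluates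
    \<open>G\<close>. The origin and the eigenvalues of \<open>A\<close>, where this may fail, are
    left to continuity.\<close>
  proof (rule rational_nonneg_right_half_plane_no_imaginary_pole[where F = "{0} \<union> {s. poly ?chi s = 0}"])
    show "?L \<noteq> 0" by (rule char_poly_nonzero[OF Loop_carrier(2)])
    show "degree ([:0, 1:] * P) \<le> degree ?L" using P(1) dL degree_mult_le[of "[:0, 1:]" P] by auto
    show "poly ?L s \<noteq> 0" if "Re s \<ge> 0" for s by (rule Loop_char_poly_nonzero[OF hur that])
    show "finite ({0} \<union> {s. poly ?chi s = 0})" using poly_roots_finite[OF chi0] by simp
    show "Re l \<ge> 0" using l by simp
    fix \<omega> assume "\<i> * complex_of_real \<omega> \<notin> {0} \<union> {s. poly ?chi s = 0}"
    then have w0: "\<omega> \<noteq> 0" and chi: "poly ?chi (\<i> * complex_of_real \<omega>) \<noteq> 0" by auto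
    let ?s = "\<i> * complex_of_real \<omega>"
    have s0: "Re ?s \<ge> 0" by simp
    obtain X where X: "X \<in> carrier_vec (n + n')" "?s \<cdot>\<^sub>v X = cmat Loop *\<^sub>v X + ?b"
      using resolvent_exists[OF Loop_carrier(2) Loop_char_poly_nonzero[OF hur s0] bc(1)] by blast
    obtain x y where xy: "x \<in> carrier_vec n" "y \<in> carrier_vec n'" "X = x @\<^sub>v y" using append_vec_decompose[OF X(1)] by blast
    let ?u = "cmat C *\<^sub>v x" and ?v = "tf_eval Gb ?s *\<^sub>v (cmat C *\<^sub>v x)"
    have u: "?u \<in> carrier_vec m" using c xy by simp
    have v: "?v \<in> carrier_vec m" by (rule mult_mat_vec_carrier[OF Gbc u])
    have vd: "?v + d \<in> carrier_vec m" using v d by simp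
    have uG: "tf_eval G ?s *\<^sub>v (?v + d) = ?u"
      using loop_signals[OF xy(1,2) d s0 chi] X(2) unfolding xy(3) by simp
    have "\<not> tf_pole G ?s" using tf_eval_realization(1)[OF R chi] by (simp add: tf_pole_iff_not_regular)
    then have 1: "\<omega> * Im (?u \<bullet>c (?v + d)) \<le> 0"
      using negative_imaginary_axis_nonneg[OF ni] w0 vd uG unfolding axis_nonneg_def by metis
    have "\<not> tf_pole Gb ?s" using sni by (simp add: strictly_negative_imaginary_def)
    then have 2: "\<omega> * Im (?v \<bullet>c ?u) \<le> 0"
      using strictly_negative_imaginary_axis_nonneg[OF sni] w0 u by (simp add: axis_nonneg_def)
    have "?u \<bullet>c (?v + d) = ?u \<bullet>c ?v + ?u \<bullet>c d" by (rule cinner_add_right[OF v d u])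
    moreover have "Im (?u \<bullet>c ?v) = - Im (?v \<bullet>c ?u)" unfolding cinner_commute[OF u v] by simp
    ultimately have "\<omega> * Im (?u \<bullet>c d) \<le> 0" using 1 2 by (simp add: algebra_simps)
    moreover have "?u \<bullet>c d = poly P ?s / poly ?L ?s" using out[OF s0 xy(1,2)] X(2) xy(3) by simp
    ultimately have "\<omega> * Im (poly P ?s / poly ?L ?s) \<le> 0" by simp
    moreover have "Re (\<i> * complex_of_real \<omega> * z) = - (\<omega> * Im z)" for z by simp
    note this[of "poly P ?s / poly ?L ?s"]
    ultimately show "0 \<le> Re (poly ([:0, 1:] * P) ?s / poly ?L ?s)" unfolding val by linarith
  qed
  moreover obtain x y where xy: "x \<in> carrier_vec n" "y \<in> carrier_vec n'" "u = cmat C *\<^sub>v x"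
    "l \<cdot>\<^sub>v (x @\<^sub>v y) = cmat Loop *\<^sub>v (x @\<^sub>v y) + ?b"
    using loop_state_exists[OF w _ chi_nonzero[OF l]] l unfolding d_def u_def by auto
  moreover have "u \<bullet>c d = poly P l / poly ?L l" using out[OF _ xy(1,2,4)] l xy(3) by simp
  ultimately show ?thesis unfolding val d_def[symmetric] by simp
qed

text \<open>A stable loop matrix does not have the eigenvalue 0. With its inverse \<open>M\<close>
  the state equation reads \<open>X - s M X = - M b\<close>, which is uniformly solvable for small
  \<open>s\<close>. Hence near the origin small excitations cause small states.\<close>

lemma loop_response_bound:
  assumes hur: "hurwitz Loop"
  shows "\<exists>M\<in>carrier_mat (n + n') (n + n'). \<exists>e>0. \<forall>s X b. cmod s < e \<longrightarrow> Re s \<ge> 0 \<longrightarrow>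
    X \<in> carrier_vec (n + n') \<longrightarrow> b \<in> carrier_vec (n + n') \<longrightarrow> s \<cdot>\<^sub>v X = cmat Loop *\<^sub>v X + b \<longrightarrow>
    (\<Sum>i<n + n'. cmod (X $ i)) \<le> 2 * (\<Sum>i<n + n'. cmod ((M *\<^sub>v b) $ i))"
proof -
  let ?N = "n + n'" and ?A = "cmat Loop"
  note A = Loop_carrier(2)
  have "det ?A \<noteq> 0"
  proof
    assume "det ?A = 0"
    then obtain v where "v \<in> carrier_vec ?N" "v \<noteq> 0\<^sub>v ?N" "?A *\<^sub>v v = 0\<^sub>v ?N"
      using det_0_iff_vec_prod_zero_field[OF A] by blast
    moreover from this have "?A *\<^sub>v v = 0 \<cdot>\<^sub>v v" by (intro eq_vecI) auto
    ultimately have "eigenvalue ?A 0" using A by (auto simp: eigenvalue_def eigenvector_def)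
    then show False using hur by (auto simp: hurwitz_def)
  qed
  note inv = matinv[OF A this]
  let ?M = "matinv ?A"
  obtain e where e: "e > 0" "\<And>t b. cmod t < e \<Longrightarrow> b \<in> carrier_vec ?N \<Longrightarrow>
      \<exists>y\<in>carrier_vec ?N. y + t \<cdot>\<^sub>v (?M *\<^sub>v y) = b \<and> (\<Sum>i<?N. cmod (y $ i)) \<le> 2 * (\<Sum>i<?N. cmod (b $ i))"
    using identity_plus_small_invertible[OF inv(1)] by blast
  have "(\<Sum>i<?N. cmod (X $ i)) \<le> 2 * (\<Sum>i<?N. cmod ((?M *\<^sub>v b) $ i))"
    if s: "cmod s < e" "Re s \<ge> 0" and X: "X \<in> carrier_vec ?N" and b: "b \<in> carrier_vec ?N"
      and eq: "s \<cdot>\<^sub>v X = ?A *\<^sub>v X + b" for s X b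
  proof -
    have Mb: "?M *\<^sub>v b \<in> carrier_vec ?N" using inv b by simp
    have "- (?M *\<^sub>v b) \<in> carrier_vec ?N" "cmod (- s) < e" using Mb s by auto
    from e(2)[OF this(2,1)] obtain y where y: "y \<in> carrier_vec ?N"
      "y + (- s) \<cdot>\<^sub>v (?M *\<^sub>v y) = - (?M *\<^sub>v b)"
      "(\<Sum>i<?N. cmod (y $ i)) \<le> 2 * (\<Sum>i<?N. cmod ((- (?M *\<^sub>v b)) $ i))" by blast
    have My: "?M *\<^sub>v y \<in> carrier_vec ?N" using inv y by simp
    have cancel: "?A *\<^sub>v (?M *\<^sub>v v) = v" if "v \<in> carrier_vec ?N" for v
      using assoc_mult_mat_vec[OF A inv(1) that] inv(2) that by simp
    have "?A *\<^sub>v (y + (- s) \<cdot>\<^sub>v (?M *\<^sub>v y)) = ?A *\<^sub>v y + (- s) \<cdot>\<^sub>v y"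
      using mult_add_distrib_mat_vec[OF A y(1), of "(- s) \<cdot>\<^sub>v (?M *\<^sub>v y)"] mult_mat_vec[OF A My, of "- s"] My cancel[OF y(1)]
      by simp
    moreover have "?A *\<^sub>v (- (?M *\<^sub>v b)) = - b"
    proof -
      have m1: "- v = (- 1) \<cdot>\<^sub>v v" for v :: "complex vec" by (intro eq_vecI) auto
      show ?thesis unfolding m1 using mult_mat_vec[OF A Mb, of "- 1"] cancel[OF b] by simp
    qed
    ultimately have star: "?A *\<^sub>v y + (- s) \<cdot>\<^sub>v y = - b" using y(2) by simp
    have "s \<cdot>\<^sub>v y = ?A *\<^sub>v y + b"
    proof (intro eq_vecI)
      fix i assume "i < dim_vec (?A *\<^sub>v y + b)"
      then have i: "i < ?N" using b by simp
      show "(s \<cdot>\<^sub>v y) $ i = (?A *\<^sub>v y + b) $ i"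
        using arg_cong[OF star, of "\<lambda>v. v $ i"] i y(1) b A by (simp add: algebra_simps del: index_mult_mat_vec)
    qed (use y b A in auto)
    then have "X = y" using resolvent_unique[OF A Loop_char_poly_nonzero[OF hur s(2)] X y(1) eq _ b] by simp
    moreover have "(\<Sum>i<?N. cmod ((- (?M *\<^sub>v b)) $ i)) = (\<Sum>i<?N. cmod ((?M *\<^sub>v b) $ i))"
      using carrier_vecD[OF Mb] by (intro sum.cong) (auto simp del: index_mult_mat_vec)
    ultimately show ?thesis using y(3) by simp
  qed
  with e(1) inv(1) show ?thesis by blast
qed

text \<open>Evaluate the passivity inequality at \<open>w(t) = p + t\<^sup>2 a\<close> with \<open>J\<^sup>T a = q\<close> and let \<open>t\<close> decrease to
  \<open>0\<close>: the double pole contributes \<open>G\<^sub>2 a = J q\<close> to the limit of \<open>u(t) = G(t) w(t)\<close>.\<close>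

lemma loop_limit:
  assumes hur: "hurwitz Loop" and p: "p \<in> carrier_vec m" "Jc\<^sup>T *\<^sub>v p = 0\<^sub>v r" and q: "q \<in> carrier_vec r"
  defines "u \<equiv> Jc *\<^sub>v q + G0 m G *\<^sub>v p"
  defines "d \<equiv> p - Gb0 *\<^sub>v u"
  shows "0 \<le> Re (u \<bullet>c d)" and "d = 0\<^sub>v m \<Longrightarrow> u = 0\<^sub>v m"
proof -
  note c = state_carriers
  obtain y0 where y0: "y0 \<in> carrier_vec r" "Jc\<^sup>T *\<^sub>v (Jc *\<^sub>v y0) = q" using JtJ_solve[OF q] by blast
  define a where "a = Jc *\<^sub>v y0"
  have a: "a \<in> carrier_vec m" and Ja: "Jc\<^sup>T *\<^sub>v a = q" using Jcc y0 by (auto simp: a_def)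
  have Jq: "Jc *\<^sub>v q \<in> carrier_vec m" using Jcc q by simp
  have u: "u \<in> carrier_vec m" using Jq G0c p by (simp add: u_def)
  have Gu: "Gb0 *\<^sub>v u \<in> carrier_vec m" using Gb0c u by simp
  have d: "d \<in> carrier_vec m" using p Gu by (simp add: d_def)
  define w where "w = (\<lambda>t::real. p + complex_of_real (t\<^sup>2) \<cdot>\<^sub>v a)"
  define U where "U = (\<lambda>t::real. tf_eval G (complex_of_real t) *\<^sub>v w t)"
  define V where "V = (\<lambda>t::real. tf_eval Gb (complex_of_real t) *\<^sub>v U t)"
  define E where "E = (\<lambda>t. w t - V t)"
  have wc: "w t \<in> carrier_vec m" for t using p a by (simp add: w_def)
  have Uc: "U t \<in> carrier_vec m" for t unfolding U_def by (rule mult_mat_vec_carrier[OF Gc wc])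
  have Vc: "V t \<in> carrier_vec m" for t unfolding V_def by (rule mult_mat_vec_carrier[OF Gbc Uc])
  have Ec: "E t \<in> carrier_vec m" for t unfolding E_def using wc Vc by simp
  have pos: "eventually (\<lambda>t::real. 0 < t) (at_right 0)" by (rule eventually_at_right_less)
  have limw: "vec_tendsto m w p (at_right 0)"
  proof -
    have "vec_tendsto m (\<lambda>t. complex_of_real (t\<^sup>2) \<cdot>\<^sub>v a) (complex_of_real (0\<^sup>2) \<cdot>\<^sub>v a) (at_right 0)"
      by (intro vec_tendsto_smult vec_tendsto_const tendsto_intros a)
    then have "vec_tendsto m w (p + complex_of_real (0\<^sup>2) \<cdot>\<^sub>v a) (at_right 0)"
      unfolding w_def using a by (intro vec_tendsto_add vec_tendsto_const) auto
    moreover have "p + complex_of_real (0\<^sup>2) \<cdot>\<^sub>v a = p" using p a by (intro eq_vecI) auto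
    ultimately show ?thesis by simp
  qed
  have limU: "vec_tendsto m U u (at_right 0)"
  proof -
    let ?H = "\<lambda>t::real. tf_eval G (complex_of_real t) - (1 / (complex_of_real t)\<^sup>2) \<cdot>\<^sub>m G2 m G"
    have Hc: "?H t \<in> carrier_mat m m" for t using expansion(2) by (intro minus_carrier_mat) auto
    have "vec_tendsto m (\<lambda>t. ?H t *\<^sub>v w t) (G0 m G *\<^sub>v p) (at_right 0)"
      by (rule vec_tendsto_mult_mat_fun[OF Hc G0c _ limw wc p(1)])
         (rule filterlim_compose[OF expansion(4) filterlim_of_real_at_right_0])
    then have "vec_tendsto m (\<lambda>t. Jc *\<^sub>v q + ?H t *\<^sub>v w t) u (at_right 0)"
      unfolding u_def using mult_mat_vec_carrier[OF Hc wc] G0c p by (intro vec_tendsto_add vec_tendsto_const) auto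
    moreover have "eventually (\<lambda>t. Jc *\<^sub>v q + ?H t *\<^sub>v w t = U t) (at_right 0)"
      using pos
    proof eventually_elim
      case (elim t)
      let ?g = "1 / (complex_of_real t)\<^sup>2"
      have Jw: "Jc\<^sup>T *\<^sub>v w t = complex_of_real (t\<^sup>2) \<cdot>\<^sub>v q"
        unfolding w_def using mult_add_distrib_mat_vec[OF Jt p(1), of "complex_of_real (t\<^sup>2) \<cdot>\<^sub>v a"]
          mult_mat_vec[OF Jt a, of "complex_of_real (t\<^sup>2)"] a p(2) Ja q by simp
      have "?g \<cdot>\<^sub>v (G2 m G *\<^sub>v w t) = ?g \<cdot>\<^sub>v (complex_of_real (t\<^sup>2) \<cdot>\<^sub>v (Jc *\<^sub>v q))"
        unfolding G2_vec[OF wc] Jw using mult_mat_vec[OF Jcc q] by simp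
      also have "\<dots> = Jc *\<^sub>v q" using elim by (simp add: smult_smult_assoc)
      finally have *: "?g \<cdot>\<^sub>v (G2 m G *\<^sub>v w t) = Jc *\<^sub>v q" .
      have "?H t *\<^sub>v w t = U t - (?g \<cdot>\<^sub>m G2 m G) *\<^sub>v w t"
        unfolding U_def using expansion(2) by (intro minus_mult_distrib_mat_vec[OF Gc _ wc]) simp
      also have "(?g \<cdot>\<^sub>m G2 m G) *\<^sub>v w t = ?g \<cdot>\<^sub>v (G2 m G *\<^sub>v w t)" using expansion(2) wc[of t] by (intro eq_vecI) auto
      finally have "?H t *\<^sub>v w t = U t - Jc *\<^sub>v q" unfolding * .
      then show ?case using carrier_vecD[OF Uc] carrier_vecD[OF Jq] by (intro eq_vecI) (simp_all del: index_mult_mat_vec)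
    qed
    ultimately show ?thesis by (rule vec_tendsto_cong)
  qed
  have "vec_tendsto m V (Gb0 *\<^sub>v u) (at_right 0)"
    unfolding V_def Gb0_def
    by (rule vec_tendsto_mult_mat_fun[OF Gbc Gbc _ limU Uc u])
       (rule filterlim_compose[OF Gb_lim filterlim_of_real_at_right_0], auto)
  then have limE: "vec_tendsto m E d (at_right 0)"
    unfolding E_def d_def by (intro vec_tendsto_diff limw Vc Gu)
  show "0 \<le> Re (u \<bullet>c d)"
  proof (rule tendsto_lowerbound)
    show "((\<lambda>t. Re (U t \<bullet>c E t)) \<longlongrightarrow> Re (u \<bullet>c d)) (at_right 0)"
      by (intro tendsto_Re tendsto_cinner[OF limU limE Ec d])
    show "eventually (\<lambda>t. 0 \<le> Re (U t \<bullet>c E t)) (at_right 0)"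
      using pos
    proof eventually_elim
      case (elim t)
      have "0 \<le> t * Re (U t \<bullet>c E t)"
        using loop_passive[OF hur wc, of "complex_of_real t" t] elim by (simp add: U_def V_def E_def)
      then show ?case using elim by (simp add: zero_le_mult_iff)
    qed
  qed simp
  \<comment> \<open>The excitation \<open>E t\<close> now tends to 0. By the uniform response bound
    so do the loop states, and with them the output \<open>U t\<close>, whose limit is
    \<open>u\<close>.\<close>
  assume d0: "d = 0\<^sub>v m"
  obtain M e where M: "M \<in> carrier_mat (n + n') (n + n')" and e: "e > 0"
    and bound: "\<And>s X b. cmod s < e \<Longrightarrow> Re s \<ge> 0 \<Longrightarrow> X \<in> carrier_vec (n + n') \<Longrightarrow> b \<in> carrier_vec (n + n') \<Longrightarrow>
      s \<cdot>\<^sub>v X = cmat Loop *\<^sub>v X + b \<Longrightarrow> (\<Sum>i<n + n'. cmod (X $ i)) \<le> 2 * (\<Sum>i<n + n'. cmod ((M *\<^sub>v b) $ i))"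
    using loop_response_bound[OF hur] by blast
  define b where "b = (\<lambda>t. (cmat B *\<^sub>v E t) @\<^sub>v 0\<^sub>v n')"
  have BE: "cmat B *\<^sub>v E t \<in> carrier_vec n" for t by (rule mult_mat_vec_carrier[OF c(2) Ec])
  have bc: "b t \<in> carrier_vec (n + n')" for t using BE[of t] by (simp add: b_def)
  have limBE: "vec_tendsto n (\<lambda>t. cmat B *\<^sub>v E t) (0\<^sub>v n) (at_right 0)"
    using vec_tendsto_mult_mat[OF c(2) limE Ec d] mult_zero_vec[OF c(2)] by (simp add: d0)
  have bi: "b t $ i = (if i < n then (cmat B *\<^sub>v E t) $ i else 0)" if "i < n + n'" for t i
    unfolding b_def using that carrier_vecD[OF BE[of t]] by (simp del: index_mult_mat_vec)
  have limb: "vec_tendsto (n + n') b (0\<^sub>v (n + n')) (at_right 0)"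
    unfolding vec_tendsto_def
  proof (intro allI impI)
    fix i assume i: "i < n + n'"
    show "((\<lambda>s. b s $ i) \<longlongrightarrow> 0\<^sub>v (n + n') $ i) (at_right 0)"
    proof (cases "i < n")
      case True
      then have "((\<lambda>s. (cmat B *\<^sub>v E s) $ i) \<longlongrightarrow> 0) (at_right 0)" using limBE by (simp add: vec_tendsto_def)
      then show ?thesis using True i by (simp add: bi[OF i] del: index_mult_mat_vec)
    next
      case False
      then show ?thesis using i by (simp add: bi[OF i])
    qed
  qed
  have limM: "vec_tendsto (n + n') (\<lambda>t. M *\<^sub>v b t) (0\<^sub>v (n + n')) (at_right 0)"
    using vec_tendsto_mult_mat[OF M limb bc] mult_zero_vec[OF M] by simp
  define S where "S = (\<lambda>t. \<Sum>i<n + n'. cmod ((M *\<^sub>v b t) $ i))"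
  have "(S \<longlongrightarrow> (\<Sum>i<n + n'. cmod (0\<^sub>v (n + n') $ i))) (at_right 0)"
    unfolding S_def using limM by (intro tendsto_sum tendsto_norm) (auto simp: vec_tendsto_def)
  then have limS: "(S \<longlongrightarrow> 0) (at_right 0)" by simp
  have small: "eventually (\<lambda>t::real. t < e) (at_right 0)"
    using e by (auto simp: eventually_at_right[of 0 1])
  have "vec_tendsto m U (0\<^sub>v m) (at_right 0)"
    unfolding vec_tendsto_def
  proof (intro allI impI)
    fix i assume i: "i < m"
    let ?k = "\<Sum>j<n. cmod (cmat C $$ (i, j))"
    have "((\<lambda>t. U t $ i) \<longlongrightarrow> 0) (at_right 0)"
    proof (rule Lim_null_comparison)
      have "((\<lambda>t. ?k * (2 * S t)) \<longlongrightarrow> ?k * (2 * 0)) (at_right 0)" by (intro tendsto_intros limS)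
      then show "((\<lambda>t. ?k * (2 * S t)) \<longlongrightarrow> 0) (at_right 0)" by simp
      show "eventually (\<lambda>t. cmod (U t $ i) \<le> ?k * (2 * S t)) (at_right 0)"
        using pos small
      proof eventually_elim
        case (elim t)
        let ?s = "complex_of_real t"
        have s: "Re ?s > 0" "Re ?s \<ge> 0" "cmod ?s < e" using elim by auto
        obtain x y where xy: "x \<in> carrier_vec n" "y \<in> carrier_vec n'" "U t = cmat C *\<^sub>v x"
          "?s \<cdot>\<^sub>v (x @\<^sub>v y) = cmat Loop *\<^sub>v (x @\<^sub>v y) + b t"
          using loop_state_exists[OF wc s(2) chi_nonzero[OF s(1)], of t] unfolding b_def E_def V_def U_def by blast
        have X: "x @\<^sub>v y \<in> carrier_vec (n + n')" using xy by simp
        have le: "cmod (x $ j) \<le> 2 * S t" if j: "j < n" for j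
        proof -
          have "cmod (x $ j) = cmod ((x @\<^sub>v y) $ j)" using xy(1) j by simp
          also have "\<dots> \<le> (\<Sum>i<n + n'. cmod ((x @\<^sub>v y) $ i))" by (rule member_le_sum) (use j in auto)
          also have "\<dots> \<le> 2 * S t" unfolding S_def by (rule bound[OF s(3,2) X bc xy(4)])
          finally show ?thesis .
        qed
        have "U t $ i = (\<Sum>j<n. cmat C $$ (i, j) * x $ j)"
          unfolding xy(3) using c(3) xy(1) i by (simp add: scalar_prod_def atLeast0LessThan)
        then have "cmod (U t $ i) \<le> (\<Sum>j<n. cmod (cmat C $$ (i, j) * x $ j))" by (simp only: norm_sum)
        also have "\<dots> \<le> (\<Sum>j<n. cmod (cmat C $$ (i, j)) * (2 * S t))"
          using le by (intro sum_mono) (simp only: norm_mult mult_left_mono norm_ge_zero lessThan_iff)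
        also have "\<dots> = ?k * (2 * S t)" by (simp only: sum_distrib_right)
        finally show ?case .
      qed
    qed
    then show "((\<lambda>t. U t $ i) \<longlongrightarrow> 0\<^sub>v m $ i) (at_right 0)" using i by simp
  qed
  then show "u = 0\<^sub>v m" using vec_tendsto_unique[OF limU _ _ u] by simp
qed

end

section \<open>Necessity of the conditions, and the two equivalences\<close>

context ni_feedback
begin

text \<open>With \<open>p = 0\<close> the passivity limit says that the form of \<open>- K\<close>
  is nonnegative at every \<open>q\<close>; strictness comes from invertibility of
  \<open>K\<close>.\<close>

lemma necessary_neg_def:
  assumes hur: "hurwitz Loop"
  shows "neg_def K"
proof -
  have le: "Re ((K *\<^sub>v q) \<bullet>c q) \<le> 0" if q: "q \<in> carrier_vec r" for q
  proof -
    have Jq: "Jc *\<^sub>v q \<in> carrier_vec m" using Jcc q by simp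
    have g: "Gb0 *\<^sub>v (Jc *\<^sub>v q) \<in> carrier_vec m" using Gb0c Jq by simp
    have u: "Jc *\<^sub>v q + G0 m G *\<^sub>v 0\<^sub>v m = Jc *\<^sub>v q" using mult_zero_vec[OF G0c] Jq by simp
    have "0 \<le> Re ((Jc *\<^sub>v q) \<bullet>c (0\<^sub>v m - Gb0 *\<^sub>v (Jc *\<^sub>v q)))"
      using loop_limit(1)[OF hur zero_carrier_vec mult_zero_vec[OF Jt] q] unfolding u .
    also have "(Jc *\<^sub>v q) \<bullet>c (0\<^sub>v m - Gb0 *\<^sub>v (Jc *\<^sub>v q)) = - ((Jc *\<^sub>v q) \<bullet>c (Gb0 *\<^sub>v (Jc *\<^sub>v q)))"
      using cinner_diff_right[OF zero_carrier_vec g Jq] Jq by simp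
    also have "(Jc *\<^sub>v q) \<bullet>c (Gb0 *\<^sub>v (Jc *\<^sub>v q)) = (K *\<^sub>v q) \<bullet>c q"
      using hermitian_mat_cinner[OF Gb0_herm Gb0c Jq Jq] K_form[OF q] by simp
    finally show ?thesis by simp
  qed
  show ?thesis
    unfolding K_neg_def_iff
  proof (intro ballI impI)
    fix v :: "complex vec" assume v: "v \<in> carrier_vec r" "v \<noteq> 0\<^sub>v r"
    then have "Re ((K *\<^sub>v v) \<bullet>c v) \<noteq> 0"
      using neg_semidef_form_zero_imp_kernel[OF K_herm Kc le v(1)] K_inj by blast
    then show "Re ((K *\<^sub>v v) \<bullet>c v) < 0" using le[OF v(1)] by simp
  qed
qed

text \<open>For the root \<open>S\<close> one has
  \<open>|S J q|\<^sup>2 = (J q)\<^sup>* M J q = 0\<close>; as \<open>S\<close> is Hermitian, the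
  second claim is the adjoint of the first.\<close>

lemma root_kernel:
  assumes M: "M \<in> carrier_mat m m" "pos_semidef M" and JM: "\<And>u. u \<in> carrier_vec m \<Longrightarrow> Jc\<^sup>T *\<^sub>v (M *\<^sub>v u) = 0\<^sub>v r"
  shows "q \<in> carrier_vec r \<Longrightarrow> psd_sqrt M *\<^sub>v (Jc *\<^sub>v q) = 0\<^sub>v m"
    and "v \<in> carrier_vec m \<Longrightarrow> Jc\<^sup>T *\<^sub>v (psd_sqrt M *\<^sub>v v) = 0\<^sub>v r"
proof -
  note S = psd_sqrt[OF M]
  have Sh: "hermitian_mat (psd_sqrt M)" using S(2) by (simp add: pos_semidef_def)
  show SJ: "psd_sqrt M *\<^sub>v (Jc *\<^sub>v q) = 0\<^sub>v m" if q: "q \<in> carrier_vec r" for q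
  proof (rule cinner_self_eq_0)
    have Jq: "Jc *\<^sub>v q \<in> carrier_vec m" using Jcc q by simp
    then show s: "psd_sqrt M *\<^sub>v (Jc *\<^sub>v q) \<in> carrier_vec m" using S(1) by simp
    have "(psd_sqrt M *\<^sub>v (Jc *\<^sub>v q)) \<bullet>c (psd_sqrt M *\<^sub>v (Jc *\<^sub>v q)) = (Jc *\<^sub>v q) \<bullet>c (M *\<^sub>v (Jc *\<^sub>v q))"
      using hermitian_mat_cinner[OF Sh S(1) Jq s] assoc_mult_mat_vec[OF S(1) S(1) Jq] S(3) by simp
    also have "\<dots> = 0" using Jt_cinner[OF q, of "M *\<^sub>v (Jc *\<^sub>v q)"] JM[OF Jq] M(1) Jq q by simp
    finally show "Re ((psd_sqrt M *\<^sub>v (Jc *\<^sub>v q)) \<bullet>c (psd_sqrt M *\<^sub>v (Jc *\<^sub>v q))) \<le> 0" by simp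
  qed
  show "Jc\<^sup>T *\<^sub>v (psd_sqrt M *\<^sub>v v) = 0\<^sub>v r" if v: "v \<in> carrier_vec m" for v
  proof (rule cinner_self_eq_0)
    have s: "psd_sqrt M *\<^sub>v v \<in> carrier_vec m" using S(1) v by simp
    then show q: "Jc\<^sup>T *\<^sub>v (psd_sqrt M *\<^sub>v v) \<in> carrier_vec r" using Jt by simp
    let ?q = "Jc\<^sup>T *\<^sub>v (psd_sqrt M *\<^sub>v v)"
    have "?q \<bullet>c ?q = (psd_sqrt M *\<^sub>v v) \<bullet>c (Jc *\<^sub>v ?q)" using Jt_cinner'[OF q s] by simp
    also have "\<dots> = v \<bullet>c (psd_sqrt M *\<^sub>v (Jc *\<^sub>v ?q))"
      using q Jcc by (intro hermitian_mat_cinner[OF Sh S(1) v]) simp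
    also have "\<dots> = 0" using SJ[OF q] v by simp
    finally show "Re (?q \<bullet>c ?q) \<le> 0" by simp
  qed
qed

lemma sandwich_vec:
  assumes "S \<in> carrier_mat m m" "v \<in> carrier_vec m"
  shows "(S * G0 m G * S) *\<^sub>v v = S *\<^sub>v (G0 m G *\<^sub>v (S *\<^sub>v v))"
  using assoc_mult_mat_vec[OF mult_carrier_mat[OF assms(1) G0c] assms] assms
    assoc_mult_mat_vec[OF assms(1) G0c, of "S *\<^sub>v v"] by simp

lemma sandwich_form:
  assumes "S \<in> carrier_mat m m" "hermitian_mat S" "v \<in> carrier_vec m"
  shows "((S * G0 m G * S) *\<^sub>v v) \<bullet>c v = (G0 m G *\<^sub>v (S *\<^sub>v v)) \<bullet>c (S *\<^sub>v v)"
  unfolding sandwich_vec[OF assms(1,3)] using assms G0c by (intro hermitian_mat_cinner[of _ m]) simp_all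

text \<open>Write \<open>H = S G0 S\<close>. The passivity limit for \<open>p = S v\<close> shows
  that the inner product of \<open>H v\<close> and \<open>v - H v\<close> has nonnegative real part;
  adding \<open>|v - H v|\<^sup>2\<close> makes \<open>I - H\<close> semidefinite. A null vector
  satisfies \<open>H v = v\<close>, so its signal \<open>d\<close> is 0, and the second part of
  \<open>loop_limit\<close> gives \<open>v = 0\<close>.\<close>

lemma necessary_pos_def:
  assumes hur: "hurwitz Loop" and N: "pos_semidef N2"
  shows "pos_def (1\<^sub>m m - psd_sqrt N2 * G0 m G * psd_sqrt N2)"
proof -
  let ?S = "psd_sqrt N2" and ?H = "psd_sqrt N2 * G0 m G * psd_sqrt N2"
  note S = psd_sqrt[OF N2c N]
  have Sh: "hermitian_mat ?S" using S(2) by (simp add: pos_semidef_def)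
  have SJ1: "?S *\<^sub>v (Jc *\<^sub>v q) = 0\<^sub>v m" if "q \<in> carrier_vec r" for q
    by (rule root_kernel(1)[OF N2c N _ that]) (rule Jt_N2)
  have SJ2: "Jc\<^sup>T *\<^sub>v (?S *\<^sub>v v) = 0\<^sub>v r" if "v \<in> carrier_vec m" for v
    by (rule root_kernel(2)[OF N2c N _ that]) (rule Jt_N2)
  have Hc: "?H \<in> carrier_mat m m" using S(1) G0c by auto
  have IHc: "1\<^sub>m m - ?H \<in> carrier_mat m m" using Hc by (rule minus_carrier_mat)
  have IHv: "(1\<^sub>m m - ?H) *\<^sub>v v = v - ?H *\<^sub>v v" if "v \<in> carrier_vec m" for v
    using minus_mult_distrib_mat_vec[OF one_carrier_mat Hc that] that by simp
  have key: "0 \<le> Re ((?H *\<^sub>v v) \<bullet>c (v - ?H *\<^sub>v v))" "?H *\<^sub>v v = v \<Longrightarrow> v = 0\<^sub>v m" if v: "v \<in> carrier_vec m" for v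
  proof -
    let ?p = "?S *\<^sub>v v"
    let ?g = "G0 m G *\<^sub>v ?p"
    \<comment> \<open>Chosen to make \<open>oblique u = 0\<close>. Then \<open>Gb0 u = N2 u\<close>,
      and \<open>p - Gb0 u\<close> factors through the root as \<open>S (v - H v)\<close>.\<close>
    define q where "q = - oblique ?g"
    define u where "u = Jc *\<^sub>v q + ?g"
    have p: "?p \<in> carrier_vec m" and g: "?g \<in> carrier_vec m" using S(1) v G0c by auto
    have Hv: "?H *\<^sub>v v \<in> carrier_vec m" using Hc v by simp
    have q: "q \<in> carrier_vec r" using oblique_carrier[OF g] by (simp add: q_def)
    have Jq: "Jc *\<^sub>v q \<in> carrier_vec m" using Jcc q by simp
    have u: "u \<in> carrier_vec m" using Jq g by (simp add: u_def)
    have Kq: "K *\<^sub>v q = - (Jc\<^sup>T *\<^sub>v (Gb0 *\<^sub>v ?g))"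
    proof -
      have m1: "- v = (- 1) \<cdot>\<^sub>v v" for v :: "complex vec" by (intro eq_vecI) auto
      show ?thesis
        unfolding q_def m1 using mult_mat_vec[OF Kc oblique_carrier[OF g], of "- 1"] K_oblique[OF g] by simp
    qed
    have "Jc\<^sup>T *\<^sub>v (Gb0 *\<^sub>v u) = K *\<^sub>v q + Jc\<^sup>T *\<^sub>v (Gb0 *\<^sub>v ?g)"
      unfolding u_def K_vec[OF q] using mult_add_distrib_mat_vec[OF Gb0c Jq g]
        mult_add_distrib_mat_vec[OF Jt, of "Gb0 *\<^sub>v (Jc *\<^sub>v q)" "Gb0 *\<^sub>v ?g"] Gb0c Jq g by simp
    also have "\<dots> = 0\<^sub>v r"
      unfolding Kq using mult_mat_vec_carrier[OF Jt mult_mat_vec_carrier[OF Gb0c g]] by simp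
    finally have "oblique u = 0\<^sub>v r" unfolding oblique_def using mult_zero_vec[OF Kinv(1)] by simp
    then have "Gb0 *\<^sub>v u = N2 *\<^sub>v u"
      using Gb0_N2[OF u] N2c u by (simp add: mult_zero_vec[OF Jcc] mult_zero_vec[OF Gb0c])
    moreover have Su: "?S *\<^sub>v u = ?H *\<^sub>v v"
      unfolding u_def sandwich_vec[OF S(1) v] using mult_add_distrib_mat_vec[OF S(1) Jq g] SJ1[OF q] S(1) g by simp
    moreover have "N2 *\<^sub>v u = ?S *\<^sub>v (?S *\<^sub>v u)" using assoc_mult_mat_vec[OF S(1) S(1) u] S(3) by simp
    ultimately have d: "?p - Gb0 *\<^sub>v u = ?S *\<^sub>v (v - ?H *\<^sub>v v)"
      using mult_minus_distrib_mat_vec[OF S(1) v Hv] by simp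
    note lim = loop_limit[OF hur p SJ2[OF v] q, folded u_def, unfolded d]
    have vH: "v - ?H *\<^sub>v v \<in> carrier_vec m" using v Hv by simp
    have "u \<bullet>c (?S *\<^sub>v (v - ?H *\<^sub>v v)) = (?H *\<^sub>v v) \<bullet>c (v - ?H *\<^sub>v v)"
      using hermitian_mat_cinner[OF Sh S(1) u vH] Su by simp
    with lim(1) show "0 \<le> Re ((?H *\<^sub>v v) \<bullet>c (v - ?H *\<^sub>v v))" by simp
    assume eq: "?H *\<^sub>v v = v"
    then have "?S *\<^sub>v (v - ?H *\<^sub>v v) = 0\<^sub>v m" using v mult_zero_vec[OF S(1)] by simp
    then have "u = 0\<^sub>v m" by (rule lim(2))
    then show "v = 0\<^sub>v m" using Su eq mult_zero_vec[OF S(1)] by simp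
  qed
  have form: "0 \<le> Re (((1\<^sub>m m - ?H) *\<^sub>v v) \<bullet>c v)" if v: "v \<in> carrier_vec m" for v
  proof -
    have Hv: "?H *\<^sub>v v \<in> carrier_vec m" using Hc v by simp
    let ?z = "v - ?H *\<^sub>v v"
    have z: "?z \<in> carrier_vec m" using v Hv by simp
    have "?z \<bullet>c ?z = ?z \<bullet>c v - ?z \<bullet>c (?H *\<^sub>v v)" by (rule cinner_diff_right[OF v Hv z])
    moreover have "Re (?z \<bullet>c (?H *\<^sub>v v)) = Re ((?H *\<^sub>v v) \<bullet>c ?z)" unfolding cinner_commute[OF z Hv] by simp
    moreover have "0 \<le> Re (?z \<bullet>c ?z)" by simp
    ultimately show ?thesis using key(1)[OF v] unfolding IHv[OF v] by simp
  qed
  have herm: "hermitian_mat (1\<^sub>m m - ?H)"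
  proof (rule hermitian_matI_real_form[OF IHc])
    fix v :: "complex vec" assume v: "v \<in> carrier_vec m"
    have "Im ((?H *\<^sub>v v) \<bullet>c v) = 0"
      unfolding sandwich_form[OF S(1) Sh v] using S(1) v by (intro hermitian_mat_Im_0[OF G0_herm G0c]) simp
    moreover have "Im (v \<bullet>c v) = 0" by (simp add: cinner_self)
    ultimately show "Im (((1\<^sub>m m - ?H) *\<^sub>v v) \<bullet>c v) = 0"
      unfolding IHv[OF v] using cinner_diff_left[OF v mult_mat_vec_carrier[OF Hc v] v] by simp
  qed
  have "0 < Re (((1\<^sub>m m - ?H) *\<^sub>v v) \<bullet>c v)" if v: "v \<in> carrier_vec m" "v \<noteq> 0\<^sub>v m" for v
  proof -
    have "Re (((1\<^sub>m m - ?H) *\<^sub>v v) \<bullet>c v) \<noteq> 0"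
    proof
      assume "Re (((1\<^sub>m m - ?H) *\<^sub>v v) \<bullet>c v) = 0"
      then have "v - ?H *\<^sub>v v = 0\<^sub>v m"
        using semidef_form_zero_imp_kernel[OF herm IHc form v(1)] IHv[OF v(1)] by simp
      then have "v = ?H *\<^sub>v v" using vec_diff_eq_zero[OF v(1) mult_mat_vec_carrier[OF Hc v(1)]] by blast
      then show False using key(2)[OF v(1)] v(2) by simp
    qed
    then show ?thesis using form[OF v(1)] by simp
  qed
  then show ?thesis using herm IHc by (auto simp: pos_def_def)
qed

text \<open>Let \<open>T\<close> be the root of \<open>- N2\<close>. A kernel vector
  \<open>v\<close> would satisfy \<open>|v|\<^sup>2 + (T v)\<^sup>* G0 (T v) = 0\<close>, but
  \<open>T v\<close> lies in the kernel of \<open>J\<^sup>T\<close>, where the form of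
  \<open>G0\<close> is nonnegative.\<close>

lemma det_nonzero:
  assumes N: "neg_semidef N2"
  shows "det (1\<^sub>m m + psd_sqrt (- N2) * G0 m G * psd_sqrt (- N2)) \<noteq> 0"
proof
  let ?T = "psd_sqrt (- N2)" and ?H = "psd_sqrt (- N2) * G0 m G * psd_sqrt (- N2)"
  have Nc: "- N2 \<in> carrier_mat m m" using N2c by simp
  have herm: "hermitian_mat N2" using N by (simp add: neg_semidef_def)
  have "hermitian_mat (- N2)"
    using uminus_mat_form[OF N2c] hermitian_mat_Im_0[OF herm N2c]
    by (intro hermitian_matI_real_form[OF Nc]) simp
  then have psd: "pos_semidef (- N2)"
    using N N2c uminus_mat_form[OF N2c] by (auto simp: pos_semidef_def neg_semidef_def)
  note T = psd_sqrt[OF Nc psd]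
  have Th: "hermitian_mat ?T" using T(2) by (simp add: pos_semidef_def)
  have Jt_uminus: "Jc\<^sup>T *\<^sub>v (- N2 *\<^sub>v u) = 0\<^sub>v r" if u: "u \<in> carrier_vec m" for u
  proof -
    have "- N2 *\<^sub>v u = (- 1) \<cdot>\<^sub>v (N2 *\<^sub>v u)" using N2c u by (intro eq_vecI) auto
    then have "Jc\<^sup>T *\<^sub>v (- N2 *\<^sub>v u) = (- 1) \<cdot>\<^sub>v (Jc\<^sup>T *\<^sub>v (N2 *\<^sub>v u))"
      using mult_mat_vec[OF Jt mult_mat_vec_carrier[OF N2c u], of "- 1"] by simp
    then show ?thesis unfolding Jt_N2[OF u] by (intro eq_vecI) auto
  qed
  have Hc: "?H \<in> carrier_mat m m" using T(1) G0c by auto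
  assume "det (1\<^sub>m m + ?H) = 0"
  then obtain v where v: "v \<in> carrier_vec m" "v \<noteq> 0\<^sub>v m" "(1\<^sub>m m + ?H) *\<^sub>v v = 0\<^sub>v m"
    using det_0_iff_vec_prod_zero_field[of "1\<^sub>m m + ?H" m] Hc by auto
  have Tv: "?T *\<^sub>v v \<in> carrier_vec m" using T(1) v by simp
  have "(1\<^sub>m m + ?H) *\<^sub>v v = v + ?H *\<^sub>v v"
    using add_mult_distrib_mat_vec[OF one_carrier_mat Hc v(1)] v(1) by simp
  with v(3) have sum0: "v + ?H *\<^sub>v v = 0\<^sub>v m" by simp
  have "v \<bullet>c v + (?H *\<^sub>v v) \<bullet>c v = (v + ?H *\<^sub>v v) \<bullet>c v"
    by (rule cinner_add_left[OF v(1) mult_mat_vec_carrier[OF Hc v(1)] v(1), symmetric])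
  also have "\<dots> = 0" unfolding sum0 using v(1) by simp
  finally have "v \<bullet>c v + (?H *\<^sub>v v) \<bullet>c v = 0" .
  from arg_cong[OF this, of Re]
  have "Re (v \<bullet>c v) + Re ((G0 m G *\<^sub>v (?T *\<^sub>v v)) \<bullet>c (?T *\<^sub>v v)) = 0"
    unfolding sandwich_form[OF T(1) Th v(1)] by simp
  moreover have "0 \<le> Re ((G0 m G *\<^sub>v (?T *\<^sub>v v)) \<bullet>c (?T *\<^sub>v v))"
    by (rule G0_nonneg[OF Tv], rule root_kernel(2)[OF Nc psd _ v(1)]) (rule Jt_uminus)
  ultimately have "v = 0\<^sub>v m" by (intro cinner_self_eq_0[OF v(1)]) simp
  with v(2) show False by contradiction
qed

lemma hurwitz_iff_pos_semidef:
  assumes "pos_semidef N2"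
  shows "hurwitz Loop \<longleftrightarrow> neg_def K \<and> pos_def (1\<^sub>m m - psd_sqrt N2 * G0 m G * psd_sqrt N2)"
proof
  assume "neg_def K \<and> pos_def (1\<^sub>m m - psd_sqrt N2 * G0 m G * psd_sqrt N2)"
  then show "hurwitz Loop"
    by (intro hurwitz_Loop_sufficient energy_balance_pos_semidef[OF assms]) auto
qed (use necessary_neg_def necessary_pos_def[OF _ assms] in blast)

lemma hurwitz_iff_neg_semidef:
  assumes "neg_semidef N2"
  shows "hurwitz Loop \<longleftrightarrow> neg_def K \<and> det (1\<^sub>m m + psd_sqrt (- N2) * G0 m G * psd_sqrt (- N2)) \<noteq> 0"
proof
  assume "neg_def K \<and> det (1\<^sub>m m + psd_sqrt (- N2) * G0 m G * psd_sqrt (- N2)) \<noteq> 0"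
  then show "hurwitz Loop"
    by (intro hurwitz_Loop_sufficient energy_balance_neg_semidef[OF assms]) auto
qed (use necessary_neg_def det_nonzero[OF assms] in blast)

end

section \<open>Existence of minimal realizations and conclusion\<close>

lemma minimal_realization_exists:
  assumes "transfer_function_matrix m G"
  obtains n A B C D where "minimal_realization m n A B C D G"
proof -
  define P where "P = (\<lambda>n. \<exists>A B C D. realization m n A B C D G)"
  have "\<exists>n. P n" using assms by (auto simp: transfer_function_matrix_def P_def)
  then have "P (LEAST n. P n)" by (rule LeastI_ex)
  then obtain A B C D where "realization m (LEAST n. P n) A B C D G" by (auto simp: P_def)
  moreover have "(LEAST n. P n) \<le> n'" if "realization m n' A' B' C' D' G" for n' A' B' C' D'
    using that by (intro Least_le) (auto simp: P_def)
  ultimately have "minimal_realization m (LEAST n. P n) A B C D G"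
    unfolding minimal_realization_def by blast
  then show ?thesis by (rule that)
qed

theorem corollary1:
  fixes m r :: nat
    and G Gbar :: tfm
    and J :: "real mat"
    and Gb0 Jc N2 :: "complex mat"
  assumes "transfer_function_matrix m G"
    and "transfer_function_matrix m Gbar"
    and "strictly_negative_imaginary m Gbar"
    and "strictly_proper m G"
    and "negative_imaginary m G"
    and "G1 m G = 0\<^sub>m m m"
    and "G2 m G \<noteq> 0\<^sub>m m m"
    and "J \<in> carrier_mat m r"
    and "full_column_rank J"
    and Jc_def: "Jc = cmat J"
    and "G2 m G = Jc * Jc\<^sup>T"
    and Gb0_def: "Gb0 = tf_eval Gbar 0"
    and "invertible_mat (Jc\<^sup>T * Gb0 * Jc)"
    and N2_def: "N2 = Gb0 - Gb0 * Jc * matinv (Jc\<^sup>T * Gb0 * Jc) * Jc\<^sup>T * Gb0"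
  shows "(pos_semidef N2 \<longrightarrow>
            (internally_stable m G Gbar \<longleftrightarrow>
               neg_def (Jc\<^sup>T * Gb0 * Jc) \<and>
               pos_def (1\<^sub>m m - psd_sqrt N2 * G0 m G * psd_sqrt N2))) \<and>
         (neg_semidef N2 \<longrightarrow>
            (internally_stable m G Gbar \<longleftrightarrow>
               neg_def (Jc\<^sup>T * Gb0 * Jc) \<and>
               det (1\<^sub>m m + psd_sqrt (- N2) * G0 m G * psd_sqrt (- N2)) \<noteq> 0))"
proof -
  let ?K = "Jc\<^sup>T * Gb0 * Jc"
  let ?loop = "\<lambda>A B C A' B' C' D'. closed_loop_matrix m A B C (0\<^sub>m m m) A' B' C' D'"
  have fb: "ni_feedback m r n n' G Gbar A B C A' B' C' D' J Jc Gb0 ?K N2"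
    if "minimal_realization m n A B C (0\<^sub>m m m) G" "minimal_realization m n' A' B' C' D' Gbar"
    for n A B C n' A' B' C' D'
    by (unfold_locales) (use that assms in simp_all)
  \<comment> \<open>Brings every minimal realization of \<open>G\<close> into the form with zero
    feedthrough that the locale works with.\<close>
  have D0: "D = 0\<^sub>m m m" if "minimal_realization m n A B C D G" for n A B C D
    using that strictly_proper_feedthrough[OF _ \<open>strictly_proper m G\<close>] by (auto simp: minimal_realization_def)
  have one: "1\<^sub>m m - 0\<^sub>m m m * D' = (1\<^sub>m m :: real mat)" if "minimal_realization m n' A' B' C' D' Gbar" for n' A' B' C' D'
  proof -
    have "D' \<in> carrier_mat m m" using that by (auto simp: minimal_realization_def realization_def)
    then show ?thesis by (intro eq_matI) auto
  qed
  have inv1: "invertible_mat (1\<^sub>m m :: real mat)"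
    by (auto simp: invertible_mat_def inverts_mat_def intro!: exI[of _ "1\<^sub>m m"])
  obtain n A B C where min: "minimal_realization m n A B C (0\<^sub>m m m) G"
    using minimal_realization_exists[OF assms(1)] D0 by metis
  obtain n' A' B' C' D' where min': "minimal_realization m n' A' B' C' D' Gbar"
    using minimal_realization_exists[OF assms(2)] by metis
  have stable: "internally_stable m G Gbar" if "hurwitz (?loop A B C A' B' C' D')"
    using that min min' one[OF min'] inv1 unfolding internally_stable_def by metis
  \<comment> \<open>Internal stability asserts stability for some pair of realizations. The
    equivalence is applied to that pair in one direction and to the pair chosen above in the other;
    the conditions are the same for both.\<close>
  have unstable: "\<exists>n A B C n' A' B' C' D'. minimal_realization m n A B C (0\<^sub>m m m) G \<and>
      minimal_realization m n' A' B' C' D' Gbar \<and> hurwitz (?loop A B C A' B' C' D')"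
    if "internally_stable m G Gbar"
    using that D0 unfolding internally_stable_def by metis
  show ?thesis
    using stable unstable ni_feedback.hurwitz_iff_pos_semidef[OF fb[OF min min']]
      ni_feedback.hurwitz_iff_neg_semidef[OF fb[OF min min']]
      ni_feedback.hurwitz_iff_pos_semidef[OF fb] ni_feedback.hurwitz_iff_neg_semidef[OF fb]
    by meson
qed

end
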